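(* Let $N\ge 2$ and let $\Phi_N(x,y)\in\mathbb Z[x,y]$ be the classical modular polynomial. Then the total degree of $\Phi_N(x,y)$ (as a polynomial in the two independent variables $x,y$) equals the degree of the one-variable polynomial $\Phi_N(x,x)$, namely $$\deg\Phi_N(x,y)=2\sum_{\substack{k\mid N\\ N\ge k>\sqrt N}}\frac{k}{(k,N/k)}\,\varphi\big((k,N/k)\big)+\varphi(\sqrt N).$$
   Context: $j$ denotes the elliptic modular $j$-function. The classical modular polynomial $\Phi_N\in\mathbb Z[x,y]$ is the minimal polynomial of $j(Nz)$ over $\mathbb C(j)$, written as a polynomial in two variables with $\Phi_N(j(z),j(Nz))=0$; it is symmetric and irreducible in $\mathbb C[x,y]$. $\varphi$ is Euler's function, $(a,b)$ is the greatest common divisor, and by convention $\varphi(\sqrt N)=0$ if $N$ is not a perfect square. *)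

theory Defs
  imports Complex_Main "HOL-Computational_Algebra.Polynomial" "HOL-Number_Theory.Totient"
begin

definition divsum :: "nat \<Rightarrow> nat \<Rightarrow> complex" where
  "divsum k n = of_nat (\<Sum>d\<in>{d. d dvd n}. d ^ k)"

definition qpar :: "complex \<Rightarrow> complex" where
  "qpar z = exp (2 * complex_of_real pi * \<i> * z)"

definition E4 :: "complex \<Rightarrow> complex" where
  "E4 z = 1 + 240 * (\<Sum>n. divsum 3 (Suc n) * qpar z ^ Suc n)"

definition E6 :: "complex \<Rightarrow> complex" where
  "E6 z = 1 - 504 * (\<Sum>n. divsum 5 (Suc n) * qpar z ^ Suc n)"

definition jfun :: "complex \<Rightarrow> complex" where
  "jfun z = 1728 * E4 z ^ 3 / (E4 z ^ 3 - E6 z ^ 2)"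

(* bivariate polynomials: complex poly poly, outer variable y, inner variable x *)
definition eval2 :: "complex poly poly \<Rightarrow> complex \<Rightarrow> complex \<Rightarrow> complex" where
  "eval2 P x y = poly (map_poly (\<lambda>c. poly c x) P) y"

definition annihilators :: "nat \<Rightarrow> complex poly poly set" where
  "annihilators N = {P. lead_coeff P = 1 \<and>
     (\<forall>z. Im z > 0 \<longrightarrow> eval2 P (jfun z) (jfun (of_nat N * z)) = 0)}"

(* classical modular polynomial: the minimal polynomial of j(Nz) over C(j) *)
definition Phi :: "nat \<Rightarrow> complex poly poly" where
  "Phi N = (THE P. P \<in> annihilators N \<and> (\<forall>Q\<in>annihilators N. degree P \<le> degree Q))"

definition total_degree :: "complex poly poly \<Rightarrow> nat" where
  "total_degree P = Max {degree (coeff P i) + i | i. i \<le> degree P \<and> coeff P i \<noteq> 0}"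

definition diag :: "complex poly poly \<Rightarrow> complex poly" where
  "diag P = (\<Sum>i\<le>degree P. coeff P i * [:0, 1:] ^ i)"

definition phi_sqrt :: "nat \<Rightarrow> nat" where
  "phi_sqrt N = (if \<exists>m. m * m = N then totient (THE m. m * m = N) else 0)"

definition deg_formula :: "nat \<Rightarrow> nat" where
  "deg_formula N = 2 * (\<Sum>k\<in>{k. k dvd N \<and> k \<le> N \<and> N < k * k}.
       (k div gcd k (N div k)) * totient (gcd k (N div k))) + phi_sqrt N"

end

theory Submission
  imports Defs "HOL-Complex_Analysis.Complex_Analysis"
begin

text \<open>
  The conjugates of \<open>j(Nz)\<close> over \<open>\<complex>(j)\<close> are the functions \<open>j((az + b)/d)\<close> with \<open>ad = N\<close>, \<open>0 \<le> b < d\<close> and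
  \<open>gcd(a, b, d) = 1\<close>; they are permuted transitively by \<open>SL\<^sub>2(\<int>)\<close> and pairwise distinct, so the product
  \<open>\<Prod>(y - j((az + b)/d))\<close>, whose coefficients are polynomials in \<open>j\<close>, is the minimal monic annihilator.
  As \<open>z = \<i>t\<close> tends to the cusp, \<open>j((az + b)/d)\<close> has size \<open>X\<close> to the power \<open>a/d\<close>, where \<open>X = exp(2\<pi>t)\<close> is the
  size of \<open>j\<close>. Each factor therefore contributes at most \<open>max(1, a/d)\<close> to the total degree, and exactly
  this much on the diagonal: for \<open>a = d\<close> the leading terms of \<open>j(z)\<close> and \<open>j(z + b/d)\<close> differ by a nontrivial
  root of unity because \<open>N > 1\<close>. Hence both degrees equal \<open>\<Sum> max(1, a/d)\<close>.

  The modularity of \<open>E4\<close> and \<open>E6\<close> comes from the Lipschitz formula for the lattice sums. That the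
  discriminant has no zeros is deduced, without the valence formula, from a differential equation
  satisfied by it.
\<close>

section \<open>The cotangent series\<close>

text \<open>\<open>E4\<close> and \<open>E6\<close> are given only as q-series, so their behaviour
  under z -> -1/z is invisible until they are matched with lattice sums. The bridge is the expansion
  of pi cot(pi z), obtained here from polygamma functions. A discriminant without zeros makes j
  holomorphic on the whole half plane; this is what lets the symmetric functions of the conjugates
  be polynomials in j and not merely rational functions. The differential equation is 12 Delta
  Delta'' - 13 Delta'^2 = 4 pi^2 E4 Delta^2. Both sides have weight 28 and agree up to the q^2 term.
  A form of weight k vanishing to order n at the cusp is zero once k < 2 pi sqrt(3) n, and 28
  satisfies this for n = 3. The sharp constant would be 12; the loss to about 10.88 is harmless.
  Degrees are read off analytically: the value at j(iy) of a polynomial of degree n grows like X^n.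
  The total degree is squeezed between the growth of the coefficients and the degree on the
  diagonal, where nothing cancels.\<close>

lemma summable_poly_growth:
  fixes c :: "nat \<Rightarrow> complex" and x :: complex
  assumes "\<And>n. norm (c n) \<le> real n ^ k" "norm x < 1"
  shows "summable (\<lambda>n. norm (c n * x ^ n))"
proof (rule summable_comparison_test')
  show "summable (\<lambda>n. norm (of_nat n ^ k * x ^ n))"
  proof (rule root_test_convergence)
    show "(\<lambda>n. root n (norm (norm (of_nat n ^ k * x ^ n :: complex)))) \<longlonglongrightarrow> 1 ^ k * norm x"
    proof (rule Lim_transform_eventually)
      show "(\<lambda>n. root n (real n) ^ k * norm x) \<longlonglongrightarrow> 1 ^ k * norm x"
        by (intro tendsto_intros LIMSEQ_root)
      show "\<forall>\<^sub>F n in sequentially. root n (real n) ^ k * norm x =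
        root n (norm (norm (of_nat n ^ k * x ^ n :: complex)))"
        using eventually_gt_at_top[of 0]
        by eventually_elim
          (simp add: norm_mult norm_power real_root_mult real_root_power real_root_power_cancel)
    qed
  qed (use assms(2) in auto)
  fix n :: nat
  show "norm (norm (c n * x ^ n)) \<le> norm (of_nat n ^ k * x ^ n :: complex)"
    using assms(1)[of n] by (simp add: norm_mult norm_power mult_right_mono)
qed

text \<open>The polylogarithm of order \<open>-k\<close>. The sum starts at exponent 1, so there is
  no constant term even for \<open>k = 0\<close>.\<close>

definition power_sum :: "nat \<Rightarrow> complex \<Rightarrow> complex" where
  "power_sum k x = (\<Sum>n. of_nat (Suc n) ^ k * x ^ Suc n)"

lemma power_sum_sums:
  assumes "norm x < 1"
  shows "(\<lambda>n. of_nat (Suc n) ^ k * x ^ Suc n) sums power_sum k x"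
proof -
  have "summable (\<lambda>n. of_nat n ^ k * x ^ n)"
    using summable_poly_growth[of "\<lambda>n. of_nat n ^ k" k x] assms
    by - (rule summable_norm_cancel, auto simp: norm_power)
  then have "summable (\<lambda>n. of_nat (Suc n) ^ k * x ^ Suc n)"
    by (subst summable_Suc_iff)
  then show ?thesis
    unfolding power_sum_def by (rule summable_sums)
qed

lemma power_sum_0:
  assumes "norm x < 1"
  shows "power_sum 0 x = x / (1 - x)"
proof -
  have "(\<lambda>n. x * x ^ n) sums (x * (1 / (1 - x)))"
    using assms by (intro sums_mult geometric_sums)
  then show ?thesis
    using power_sum_sums[OF assms, of 0] by (auto dest: sums_unique2)
qed

text \<open>The operator x d/dx multiplies the coefficient of x^n by n. The factor \<open>x\<close>
  stays on the left because differentiating through \<open>qpar\<close> supplies exactly this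
  factor.\<close>

lemma power_sum_has_field_derivative:
  assumes "norm x < 1"
  shows "\<exists>d. (power_sum k has_field_derivative d) (at x) \<and> x * d = power_sum (Suc k) x"
proof -
  \<comment> \<open>\<open>0 ^ 0 = 1\<close>, so for \<open>k = 0\<close> the coefficient at 0 has
    to be suppressed by hand.\<close>
  define c :: "nat \<Rightarrow> complex" where "c = (\<lambda>n. if n = 0 then 0 else of_nat n ^ k)"
  obtain K :: real where K: "norm x < K" "K < 1"
    using assms dense by blast
  have Kpos: "0 < K" using K(1) norm_ge_zero[of x] by linarith
  have summ: "summable (\<lambda>n. c n * y ^ n)" if "norm y < 1" for y
    using summable_poly_growth[of c k y] that
    by - (rule summable_norm_cancel, auto simp: norm_power c_def)
  have 1: "((\<lambda>x. \<Sum>n. c n * x ^ n) has_field_derivative (\<Sum>n. diffs c n * x ^ n)) (at x)"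
    using K Kpos by (intro termdiffs_strong[OF summ[of "of_real K"]]) auto
  have 2: "(\<Sum>n. c n * y ^ n) = power_sum k y" if "norm y < 1" for y
    using suminf_split_head[OF summ[OF that]] by (simp add: c_def power_sum_def)
  have D: "(power_sum k has_field_derivative (\<Sum>n. diffs c n * x ^ n)) (at x)"
    by (rule has_field_derivative_transform_within_open[OF 1, where S = "ball 0 1"]) (use assms 2 in auto)
  have "summable (\<lambda>n. diffs c n * x ^ n)"
    using K Kpos by (intro termdiff_converges[of x K]) (auto intro: summ)
  then have "x * (\<Sum>n. diffs c n * x ^ n) = (\<Sum>n. x * (diffs c n * x ^ n))"
    by (simp add: suminf_mult)
  also have "\<dots> = power_sum (Suc k) x"
    unfolding power_sum_def by (intro suminf_cong) (simp add: diffs_def c_def)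
  finally show ?thesis using D by blast
qed

lemma qpar_has_field_derivative [derivative_intros]:
  assumes "(g has_field_derivative g') (at z within A)"
  shows "((\<lambda>z. qpar (g z)) has_field_derivative (2 * pi * \<i> * g' * qpar (g z))) (at z within A)"
  unfolding qpar_def by (rule derivative_eq_intros assms refl | simp add: assms)+

lemma norm_qpar: "norm (qpar z) = exp (- 2 * pi * Im z)"
  by (simp add: qpar_def)

lemma norm_qpar_less_1: "Im z > 0 \<Longrightarrow> norm (qpar z) < 1"
  by (simp add: norm_qpar)

lemma power_sum_qpar_has_field_derivative:
  assumes "Im z > 0"
  shows "((\<lambda>z. power_sum k (qpar z)) has_field_derivative 2 * pi * \<i> * power_sum (Suc k) (qpar z)) (at z)"
proof -
  obtain d where d: "(power_sum k has_field_derivative d) (at (qpar z))"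
    "qpar z * d = power_sum (Suc k) (qpar z)"
    using power_sum_has_field_derivative[OF norm_qpar_less_1[OF assms]] by blast
  have "((\<lambda>z. power_sum k (qpar z)) has_field_derivative d * (2 * pi * \<i> * 1 * qpar z)) (at z)"
    by (rule DERIV_chain2[where f = "power_sum k" and g = qpar, OF d(1)]) (rule derivative_eq_intros refl)+
  then show ?thesis
    using d(2)[symmetric] by (simp add: mult_ac)
qed

text \<open>The n-th derivative of pi cot(pi z). The sign \<open>(-1) ^ n\<close> absorbs the inner
  derivative of \<open>1 - z\<close>, so differentiating raises the index with no further
  factor.\<close>

definition polygamma_refl :: "nat \<Rightarrow> complex \<Rightarrow> complex" where
  "polygamma_refl n z = (-1) ^ n * Polygamma n (1 - z) - Polygamma n z"

lemma not_Ints_imp_not_nonpos_Ints: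
  "(z :: complex) \<notin> \<int> \<Longrightarrow> z \<notin> \<int>\<^sub>\<le>\<^sub>0" "(z :: complex) \<notin> \<int> \<Longrightarrow> 1 - z \<notin> \<int>\<^sub>\<le>\<^sub>0"
proof -
  show "(z :: complex) \<notin> \<int> \<Longrightarrow> z \<notin> \<int>\<^sub>\<le>\<^sub>0" by auto
  assume "(z :: complex) \<notin> \<int>"
  show "1 - z \<notin> \<int>\<^sub>\<le>\<^sub>0"
  proof
    assume "1 - z \<in> \<int>\<^sub>\<le>\<^sub>0"
    then have "1 - (1 - z) \<in> \<int>" by (intro Ints_diff) auto
    with \<open>z \<notin> \<int>\<close> show False by simp
  qed
qed

lemma polygamma_refl_has_field_derivative:
  assumes "z \<notin> \<int>"
  shows "(polygamma_refl n has_field_derivative polygamma_refl (Suc n) z) (at z)"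
  unfolding polygamma_refl_def
  by (rule derivative_eq_intros refl not_Ints_imp_not_nonpos_Ints assms | simp)+

lemma polygamma_refl_Suc:
  assumes "open A" "A \<inter> \<int> = {}" "z \<in> A" "\<And>w. w \<in> A \<Longrightarrow> polygamma_refl n w = g w"
    and "(g has_field_derivative g') (at z)"
  shows "polygamma_refl (Suc n) z = g'"
proof -
  have "(g has_field_derivative polygamma_refl (Suc n) z) (at z)"
    by (rule has_field_derivative_transform_within_open[OF polygamma_refl_has_field_derivative assms(1,3)])
      (use assms in auto)
  then show ?thesis using assms(5) DERIV_unique by blast
qed

lemma open_complement_Ints: "open (- (\<int> :: complex set))"
  using closed_Ints[where ?'a = complex] by (simp add: open_closed)

lemma sin_pi_nonzero: "z \<notin> \<int> \<Longrightarrow> sin (of_real pi * z) \<noteq> (0 :: complex)"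
  by (auto simp: sin_eq_0)

text \<open>Up to sign both sides are the logarithmic derivative of Euler's reflection formula,
  computed once from the Gamma factors and once from the sine.\<close>

lemma polygamma_refl_0:
  assumes "z \<notin> \<int>"
  shows "polygamma_refl 0 z = of_real pi * cot (of_real pi * z)"
proof -
  note nz = sin_pi_nonzero[OF assms]
  note ni = not_Ints_imp_not_nonpos_Ints[OF assms]
  have G: "Gamma z * Gamma (1 - z) = of_real pi / sin (of_real pi * z)" for z :: complex
    by (rule Gamma_reflection_complex)
  have "((\<lambda>z. Gamma z * Gamma (1 - z)) has_field_derivative
      Gamma z * Gamma (1 - z) * (Digamma z - Digamma (1 - z))) (at z)"
    by (rule derivative_eq_intros refl ni | simp add: algebra_simps)+
  moreover have "((\<lambda>z. Gamma z * Gamma (1 - z)) has_field_derivative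
      - (of_real pi / sin (of_real pi * z)) * (of_real pi * cot (of_real pi * z))) (at z)"
    unfolding G by (rule derivative_eq_intros refl nz | simp add: nz cot_def field_simps)+
  ultimately have "of_real pi / sin (of_real pi * z) * (Digamma z - Digamma (1 - z)) = 
      - (of_real pi / sin (of_real pi * z)) * (of_real pi * cot (of_real pi * z))"
    unfolding G by (rule DERIV_unique)
  then have "of_real pi / sin (of_real pi * z) * (Digamma z - Digamma (1 - z)) =
      of_real pi / sin (of_real pi * z) * (- (of_real pi * cot (of_real pi * z)))"
    by simp
  then have "Digamma z - Digamma (1 - z) = - (of_real pi * cot (of_real pi * z))"
    using nz by (subst (asm) mult_cancel_left) auto
  then show ?thesis
    by (simp add: polygamma_refl_def algebra_simps)
qed

lemma cot_pi_has_field_derivative: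
  assumes "z \<notin> \<int>"
  shows "((\<lambda>z. of_real pi * cot (of_real pi * z) :: complex) has_field_derivative - (of_real pi ^ 2 + (of_real pi * cot (of_real pi * z)) ^ 2)) (at z)"
proof -
  note nz = sin_pi_nonzero[OF assms]
  have "((\<lambda>z. cos (of_real pi * z) / sin (of_real pi * z) :: complex) has_field_derivative
      (- sin (of_real pi * z) * of_real pi * sin (of_real pi * z) -
        cos (of_real pi * z) * (cos (of_real pi * z) * of_real pi)) /
        (sin (of_real pi * z) * sin (of_real pi * z))) (at z)"
    by (rule derivative_eq_intros refl nz | simp)+
  then have "((\<lambda>z. of_real pi * (cos (of_real pi * z) / sin (of_real pi * z)) :: complex) has_field_derivative
      of_real pi * ((- sin (of_real pi * z) * of_real pi * sin (of_real pi * z) -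
        cos (of_real pi * z) * (cos (of_real pi * z) * of_real pi)) /
        (sin (of_real pi * z) * sin (of_real pi * z)))) (at z)"
    by (rule DERIV_cmult)
  moreover have "p * ((- s * p * s - c * (c * p)) / (s * s)) = - (p ^ 2 + (p * (c / s)) ^ 2)"
    if "s \<noteq> 0" for p s c :: complex
    using that by (simp add: field_simps power2_eq_square)
  ultimately show ?thesis using nz by (simp add: cot_def)
qed

text \<open>
  The function \<open>f = \<pi> cot(\<pi>z)\<close> satisfies \<open>f' = - \<pi>\<^sup>2 - f\<^sup>2\<close> and vanishes at \<open>1/2\<close>; this evaluates the
  odd-denominator sums, and with them \<open>\<zeta>(4)\<close> and \<open>\<zeta>(6)\<close>.
\<close>
lemma polygamma_refl_half:
  "polygamma_refl 3 (1/2) = - 2 * of_real pi ^ 4" "polygamma_refl 5 (1/2) = - 16 * of_real pi ^ 6"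
proof -
  define f :: "complex \<Rightarrow> complex" where "f = (\<lambda>z. of_real pi * cot (of_real pi * z))"
  define p :: complex where "p = of_real pi ^ 2"
  have f: "(f has_field_derivative - (p + f z ^ 2)) (at z)" if "z \<notin> \<int>" for z
    using cot_pi_has_field_derivative[OF that] by (simp add: f_def p_def)
  note [derivative_intros] = DERIV_chain2[OF f]
  note step = polygamma_refl_Suc[OF open_complement_Ints]
  have 0: "polygamma_refl 0 z = f z" if "z \<notin> \<int>" for z
    using polygamma_refl_0[OF that] by (simp add: f_def)
  have 1: "polygamma_refl 1 z = - (p + f z ^ 2)" if "z \<notin> \<int>" for z
    unfolding One_nat_def by (rule step[OF _ _ 0]) (use that f in auto)
  have 2: "polygamma_refl 2 z = 2 * p * f z + 2 * f z ^ 3" if "z \<notin> \<int>" for z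
    unfolding numeral_2_eq_2 One_nat_def[symmetric]
    by (rule step[OF _ _ 1]) (use that in \<open>auto intro!: derivative_eq_intros simp: algebra_simps power_numeral_reduce\<close>)
  have 3: "polygamma_refl 3 z = - (2 * p ^ 2 + 8 * p * f z ^ 2 + 6 * f z ^ 4)" if "z \<notin> \<int>" for z
    unfolding numeral_3_eq_3 numeral_2_eq_2[symmetric]
    by (rule step[OF _ _ 2]) (use that in \<open>auto intro!: derivative_eq_intros simp: algebra_simps power_numeral_reduce\<close>)
  have "4 = Suc 3" "5 = Suc 4" by simp_all
  have 4: "polygamma_refl 4 z = 16 * p ^ 2 * f z + 40 * p * f z ^ 3 + 24 * f z ^ 5" if "z \<notin> \<int>" for z
    unfolding \<open>4 = Suc 3\<close>
    by (rule step[OF _ _ 3]) (use that in \<open>auto intro!: derivative_eq_intros simp: algebra_simps power_numeral_reduce\<close>)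
  have 5: "polygamma_refl 5 z = - (16 * p ^ 2 + 120 * p * f z ^ 2 + 120 * f z ^ 4) * (p + f z ^ 2)" if "z \<notin> \<int>" for z
    unfolding \<open>5 = Suc 4\<close>
    by (rule step[OF _ _ 4]) (use that in \<open>auto intro!: derivative_eq_intros simp: algebra_simps power_numeral_reduce\<close>)
  have half: "(1/2 :: complex) \<notin> \<int>"
  proof
    assume "(1/2 :: complex) \<in> \<int>"
    then obtain n :: int where "1/2 = (of_int n :: complex)" by (auto elim: Ints_cases)
    then have "of_int (2 * n) = (of_int 1 :: complex)" by (simp add: field_simps)
    then have "2 * n = 1" using of_int_eq_iff by blast
    then show False by presburger
  qed
  \<comment> \<open>The cotangent vanishes at pi/2, so up to sign only the terms free of
    \<open>f\<close> survive: \<open>2 * p ^ 2\<close> at order 3 and \<open>16 * p ^ 3\<close> at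
    order 5.\<close>
  have "cos (complex_of_real (pi / 2)) = of_real (cos (pi / 2))"
    by (rule cos_of_real)
  then have "f (1/2) = 0" by (simp add: f_def cot_def)
  then show "polygamma_refl 3 (1/2) = - 2 * of_real pi ^ 4" "polygamma_refl 5 (1/2) = - 16 * of_real pi ^ 6"
    using 3[OF half] 5[OF half] by (simp_all add: p_def)
qed

text \<open>With q = \<open>qpar z\<close>, pi cot(pi z) = -pi i - 2 pi i q/(1 - q); each derivative
  in z brings a factor 2 pi i and raises the order of \<open>power_sum\<close>. The constant -pi i
  disappears with the first derivative, hence \<open>n > 0\<close>.\<close>

lemma polygamma_refl_upper_half_plane:
  assumes "Im z > 0" "n > 0"
  shows "polygamma_refl n z = - ((2 * of_real pi * \<i>) ^ Suc n) * power_sum n (qpar z)"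
proof -
  define A where "A = {z. Im z > 0}"
  have A: "open A" unfolding A_def by (rule open_halfspace_Im_gt)
  have AZ: "A \<inter> \<int> = {}" unfolding A_def by (auto elim!: Ints_cases)
  have base: "polygamma_refl 0 z = - (of_real pi * \<i>) - (2 * of_real pi * \<i>) * power_sum 0 (qpar z)" if "z \<in> A" for z
  proof -
    have "z \<notin> \<int>" using that AZ by auto
    note nz = sin_pi_nonzero[OF this]
    have q: "norm (qpar z) < 1" using that norm_qpar_less_1 by (simp add: A_def)
    then have q1: "qpar z \<noteq> 1" by auto
    define e where "e = exp (\<i> * (of_real pi * z))"
    have e0: "e \<noteq> 0" by (simp add: e_def)
    have e2: "qpar z = e * e" unfolding e_def qpar_def exp_add[symmetric] by (simp add: algebra_simps)
    have s: "sin (of_real pi * z) = (e - 1 / e) / (2 * \<i>)" and c: "cos (of_real pi * z) = (e + 1 / e) / 2"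
      unfolding e_def sin_exp_eq cos_exp_eq by (simp_all add: exp_minus field_simps)
    have "a / 2 / (b / (2 * \<i>)) = \<i> * a / b" for a b
      by (simp add: field_simps)
    then have "cot (of_real pi * z) = \<i> * (e + 1/e) / (e - 1 / e)"
      unfolding cot_def s c .
    then have "of_real pi * cot (of_real pi * z) = of_real pi * (\<i> * (e + 1/e) / (e - 1 / e))"
      by (rule arg_cong)
    also have "\<dots> = - (of_real pi * \<i>) - (2 * of_real pi * \<i>) * (qpar z / (1 - qpar z))"
      using q1 e0 unfolding e2 by (simp add: divide_simps) (simp add: algebra_simps)
    finally show ?thesis
      using polygamma_refl_0[OF \<open>z \<notin> \<int>\<close>] power_sum_0[OF q] by simp
  qed
  have "\<forall>z\<in>A. polygamma_refl (Suc n) z = - ((2 * of_real pi * \<i>) ^ Suc (Suc n)) * power_sum (Suc n) (qpar z)" for n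
  proof (induction n)
    case 0
    show ?case
    proof
      fix z assume z: "z \<in> A"
      have "((\<lambda>z. - (of_real pi * \<i>) - (2 * of_real pi * \<i>) * power_sum 0 (qpar z)) has_field_derivative
          - ((2 * of_real pi * \<i>) ^ Suc (Suc 0)) * power_sum (Suc 0) (qpar z)) (at z)"
        using z by (auto simp: A_def intro!: derivative_eq_intros power_sum_qpar_has_field_derivative)
      from polygamma_refl_Suc[OF A AZ z _ this] base
      show "polygamma_refl (Suc 0) z = - ((2 * of_real pi * \<i>) ^ Suc (Suc 0)) * power_sum (Suc 0) (qpar z)"
        by blast
    qed
  next
    case (Suc n)
    show ?case
    proof
      fix z assume z: "z \<in> A"
      have "((\<lambda>z. - ((2 * of_real pi * \<i>) ^ Suc (Suc n)) * power_sum (Suc n) (qpar z)) has_field_derivative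
          - ((2 * of_real pi * \<i>) ^ Suc (Suc (Suc n))) * power_sum (Suc (Suc n)) (qpar z)) (at z)"
        using z by (auto simp: A_def intro!: derivative_eq_intros power_sum_qpar_has_field_derivative)
      from polygamma_refl_Suc[OF A AZ z _ this] Suc
      show "polygamma_refl (Suc (Suc n)) z =
          - ((2 * of_real pi * \<i>) ^ Suc (Suc (Suc n))) * power_sum (Suc (Suc n)) (qpar z)"
        by blast
    qed
  qed
  from this[of "n - 1"] assms show ?thesis by (auto simp: A_def)
qed

section \<open>Eisenstein series of weight 4 and 6\<close>

text \<open>The maximum with 1 avoids division by zero at \<open>m = 0\<close>; a product of two
  such series will majorise the lattice sum.\<close>

lemma int_summable_inverse_square: "(\<lambda>m::int. 1 / (max 1 \<bar>real_of_int m\<bar>) ^ 2) summable_on UNIV"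
proof -
  define w where "w = (\<lambda>m::int. 1 / (max 1 \<bar>real_of_int m\<bar>) ^ 2)"
  have "summable (\<lambda>n. inverse (real (Suc n) ^ 2))"
    by (subst summable_Suc_iff) (simp add: inverse_power_summable)
  then have "summable (\<lambda>n. w (int (Suc n)))"
    by (rule summable_cong[THEN iffD1, rotated]) (auto simp: w_def inverse_eq_divide max_def)
  then have s: "summable (\<lambda>n. w (int n))"
    by (subst (asm) summable_Suc_iff)
  have "(\<lambda>n. w (int n)) summable_on UNIV"
    using s by (rule summable_nonneg_imp_summable_on) (simp add: w_def)
  then have 1: "w summable_on range int"
    by (subst summable_on_reindex) (auto simp: o_def)
  have "(\<lambda>n. w (- int n)) summable_on UNIV"
    using s by (intro summable_nonneg_imp_summable_on) (simp_all add: w_def)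
  then have 2: "w summable_on range (\<lambda>n. - int n)"
    by (subst summable_on_reindex) (auto simp: o_def inj_on_def)
  have "range int \<union> range (\<lambda>n. - int n) = UNIV"
  proof -
    have "m \<in> range int \<union> range (\<lambda>n. - int n)" for m
      by (cases m rule: int_cases2) auto
    then show ?thesis by blast
  qed
  then show ?thesis
    using summable_on_union[OF 1 2] by (simp add: w_def)
qed

lemma lattice_norm_ge:
  assumes "Im z > 0"
  shows "\<exists>c>0. \<forall>m n::int. c * (of_int m ^ 2 + of_int n ^ 2) \<le> norm (of_int m * z + of_int n) ^ 2"
proof -
  define x y where "x = Re z" and "y = Im z"
  have y: "y > 0" using assms by (simp add: y_def)
  \<comment> \<open>For u = m and v = n: v^2 <= 2 (ux + v)^2 + 2 (ux)^2 and u^2 = (uy)^2 / y^2;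
    \<open>C\<close> is the sum of all coefficients that arise.\<close>
  define C where "C = 1 / y ^ 2 + 2 + 2 * x ^ 2 / y ^ 2"
  have C: "C > 0" unfolding C_def by (intro add_pos_nonneg add_pos_pos) (use y in auto)
  have "of_int m ^ 2 + of_int n ^ 2 \<le> C * norm (of_int m * z + of_int n) ^ 2" for m n :: int
  proof -
    define u v where "u = real_of_int m" and "v = real_of_int n"
    have nm: "norm (of_int m * z + of_int n) ^ 2 = (u * x + v) ^ 2 + (u * y) ^ 2"
      unfolding cmod_power2 by (simp add: u_def v_def x_def y_def)
    have "v = (u * x + v) - u * x" by simp
    then have "v ^ 2 \<le> 2 * (u * x + v) ^ 2 + 2 * (u * x) ^ 2"
      using sum_squares_bound[of "u*x+v" "-(u * x)"] by (simp add: power2_eq_square algebra_simps)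
    moreover have "C * ((u * x + v) ^ 2 + (u * y) ^ 2) =
       u ^ 2 + 2 * (u * x + v) ^ 2 + 2 * (u * x) ^ 2 + 
         ((1 + 2 * x ^ 2) / y ^ 2 * (u * x + v) ^ 2 + 2 * (u * y) ^ 2)"
      using y by (simp add: C_def field_simps power_mult_distrib)
    moreover have "0 \<le> (1 + 2 * x ^ 2) / y ^ 2 * (u * x + v) ^ 2 + 2 * (u * y) ^ 2"
      by (intro add_nonneg_nonneg mult_nonneg_nonneg divide_nonneg_nonneg) auto
    ultimately show ?thesis
      unfolding nm u_def[symmetric] v_def[symmetric] by linarith
  qed
  then show ?thesis
    using C by (intro exI[of _ "1 / C"]) (auto simp: field_simps)
qed

text \<open>By the inequality of means \<open>M * K\<close> is at most m^2 + n^2, so |mz + n|^(2l)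
  dominates a constant times \<open>(M * K) ^ 2\<close> as soon as \<open>l \<ge> 2\<close>. The
  majorant is a product of two convergent series in one variable.\<close>

lemma lattice_abs_summable:
  assumes "Im z > 0" "l \<ge> 2"
  shows "(\<lambda>x. norm (case x of (m::int, n::int) \<Rightarrow> 1 / (of_int m * z + of_int n) ^ (2 * l))) summable_on UNIV - {(0,0)}"
proof -
  define w where "w = (\<lambda>m::int. 1 / (max 1 \<bar>real_of_int m\<bar>) ^ 2)"
  have w: "w summable_on UNIV" using int_summable_inverse_square by (simp add: w_def)
  have wpos: "w m \<ge> 0" for m by (simp add: w_def)
  obtain c where c: "c > 0" "\<And>m n::int. c * (of_int m ^ 2 + of_int n ^ 2) \<le> norm (of_int m * z + of_int n) ^ 2"
    using lattice_norm_ge[OF assms(1)] by blast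
  have "(\<lambda>x. norm (case x of (m,n) \<Rightarrow> w m * w n)) summable_on UNIV \<times> UNIV"
    unfolding Infinite_Sum.abs_summable_on_Sigma_iff
    using w wpos by (auto intro!: summable_on_cmult_right summable_on_cmult_left simp: infsum_cmult_right' infsum_nonneg)
  then have "(\<lambda>x. norm (case x of (m,n) \<Rightarrow> (1 / c ^ l) * (w m * w n))) summable_on UNIV \<times> UNIV"
    by (drule_tac c = "norm (1 / c ^ l)" in summable_on_cmult_right)
      (simp add: abs_mult case_prod_unfold)
  then have "(\<lambda>x. norm (case x of (m,n) \<Rightarrow> (1 / c ^ l) * (w m * w n))) summable_on UNIV - {(0,0)}"
    by (rule summable_on_subset) auto
  then show ?thesis
  proof (rule Infinite_Sum.abs_summable_on_comparison_test)
    fix x :: "int \<times> int"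
    assume x: "x \<in> UNIV - {(0, 0)}"
    obtain m n where mn': "x = (m, n)" by force
    with x have mn: "(m, n) \<noteq> (0, 0)" by simp
    define M K where "M = max 1 \<bar>real_of_int m\<bar>" and "K = max 1 \<bar>real_of_int n\<bar>"
    have MK: "M \<ge> 1" "K \<ge> 1" by (auto simp: M_def K_def)
    have MK1: "M * K \<ge> 1" using MK by (metis mult_mono' mult_1 zero_le_one)
    have sq: "real_of_int i ^ 2 \<ge> \<bar>real_of_int i\<bar>" for i
    proof -
      have "\<bar>i\<bar> * 1 \<le> \<bar>i\<bar> * \<bar>i\<bar>" by (cases "i = 0") (simp, intro mult_left_mono, auto)
      then have "\<bar>i\<bar> \<le> \<bar>i\<bar> * \<bar>i\<bar>" by simp
      then have "real_of_int \<bar>i\<bar> \<le> real_of_int (\<bar>i\<bar> * \<bar>i\<bar>)" by (subst of_int_le_iff)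
      then show ?thesis by (simp add: power2_eq_square)
    qed
    have "M * K \<le> of_int m ^ 2 + of_int n ^ 2"
    proof (cases "m = 0 \<or> n = 0")
      case True
      then show ?thesis
        using mn sq[of m] sq[of n] by (auto simp: M_def K_def max_def)
    next
      case False
      then have "M = \<bar>of_int m\<bar>" "K = \<bar>of_int n\<bar>" by (auto simp: M_def K_def max_def)
      then have "of_int m ^ 2 = M ^ 2" "of_int n ^ 2 = K ^ 2" by simp_all
      moreover have "2 * M * K \<le> M ^ 2 + K ^ 2" by (rule sum_squares_bound)
      moreover have "2 * M * K = M * K + M * K" by simp
      ultimately show ?thesis using MK1 by linarith
    qed
    then have "c * (M * K) \<le> norm (of_int m * z + of_int n) ^ 2"
      using c by (meson mult_left_mono less_imp_le order_trans)
    then have "(c * (M * K)) ^ l \<le> (norm (of_int m * z + of_int n) ^ 2) ^ l"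
      using c MK1 by (intro power_mono) auto
    moreover have "c ^ l * (M * K) ^ 2 \<le> (c * (M * K)) ^ l"
      unfolding power_mult_distrib[of c] using c MK1 assms(2)
      by (intro mult_left_mono power_increasing) auto
    ultimately have "c ^ l * (M * K) ^ 2 \<le> norm (of_int m * z + of_int n) ^ (2 * l)"
      by (simp add: power_mult)
    moreover have "0 < M * K" using MK1 by linarith
    then have "0 < c ^ l * (M * K) ^ 2"
      by (intro mult_pos_pos[OF zero_less_power[OF c(1)] zero_less_power])
    ultimately have "1 / norm (of_int m * z + of_int n) ^ (2 * l) \<le> 1 / (c ^ l * (M * K) ^ 2)"
      by (intro divide_left_mono) auto
    then show "norm (case x of (m, n) \<Rightarrow> 1 / (of_int m * z + of_int n) ^ (2 * l)) \<le>
        norm (case x of (m, n) \<Rightarrow> 1 / c ^ l * (w m * w n))"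
      using c by (simp add: mn' norm_divide norm_power w_def M_def K_def power_mult_distrib norm_mult)
  qed
qed

definition eisenstein :: "nat \<Rightarrow> complex \<Rightarrow> complex" where
  "eisenstein k z = (\<Sum>\<^sub>\<infinity>(m::int, n::int)\<in>UNIV - {(0,0)}. 1 / (of_int m * z + of_int n) ^ k)"

lemma upper_half_plane_denominator_nonzero:
  fixes c d :: int
  assumes "Im z > 0" "(c, d) \<noteq> (0, 0)"
  shows "of_int c * z + of_int d \<noteq> 0"
proof
  assume *: "of_int c * z + of_int d = 0"
  then have "Im (of_int c * z + of_int d) = 0" by simp
  then have "c = 0" using assms(1) by simp
  with * assms(2) show False by simp
qed

text \<open>Right multiplication by the matrix permutes the nonzero integer row vectors, and
  clearing the denominator from each term produces the automorphy factor.\<close>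

lemma eisenstein_modular:
  fixes a b c d :: int
  assumes "Im z > 0" "a * d - b * c = 1"
  shows "eisenstein k ((of_int a * z + of_int b) / (of_int c * z + of_int d)) =
    (of_int c * z + of_int d) ^ k * eisenstein k z"
proof -
  define w where "w = of_int c * z + of_int d"
  have "w \<noteq> 0" unfolding w_def
    using assms by (intro upper_half_plane_denominator_nonzero) auto
  have dt: "d * a = 1 + b * c" "a * d = 1 + b * c" using assms(2) by (simp_all add: algebra_simps)
  have e: "m * (d * a) = m + m * (b * c)" "m * (a * d) = m + m * (b * c)" for m
    unfolding dt by (simp_all add: algebra_simps)
  have inj: "d * (m * a + n * c) - c * (m * b + n * d) = m" "a * (m * b + n * d) - b * (m * a + n * c) = n" 
    "(d * m - c * n) * a + (a * n - b * m) * c = m" "(d * m - c * n) * b + (a * n - b * m) * d = n" for m n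
    using e[of m] e[of n] by (simp_all add: algebra_simps)
  have "eisenstein k ((of_int a * z + of_int b) / w) =
    (\<Sum>\<^sub>\<infinity>(m::int, n::int)\<in>UNIV - {(0,0)}. w ^ k * (1 / (of_int m * z + of_int n) ^ k))"
    unfolding eisenstein_def
  proof (rule infsum_reindex_bij_witness[of _ "\<lambda>(m, n). (d * m - c * n, a * n - b * m)"
        "\<lambda>(m, n). (m * a + n * c, m * b + n * d)"], goal_cases)
    case (1 x)
    then show ?case using inj by (auto split: prod.splits)
  next
    case (2 x)
    obtain m n where x: "x = (m, n)" by force
    have "(m, n) = (0, 0)" if "m * a + n * c = 0" "m * b + n * d = 0"
      using inj(1,2)[of m n] unfolding that by simp
    then show ?case using 2 x by auto
  next
    case (3 x)
    then show ?case using inj by (auto split: prod.splits)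
  next
    case (4 x)
    obtain m n where x: "x = (m, n)" by force
    have "(m, n) = (0, 0)" if "d * m - c * n = 0" "a * n - b * m = 0"
      using inj(3,4)[of m n] unfolding that by simp
    then show ?case using 4 x by auto
  next
    case (5 x)
    obtain m n where x: "x = (m, n)" by force
    have "of_int m * ((of_int a * z + of_int b) / w) + of_int n =
        (of_int (m * a + n * c) * z + of_int (m * b + n * d)) / w"
      using \<open>w \<noteq> 0\<close> by (simp add: field_simps w_def)
    then show ?case by (simp add: x power_divide)
  qed
  also have "\<dots> = w ^ k * eisenstein k z"
    unfolding eisenstein_def by (subst infsum_cmult_right'[symmetric]) (simp add: case_prod_unfold)
  finally show ?thesis by (simp add: w_def)
qed

section \<open>Fourier expansion of the Eisenstein series\<close>

lemma norm_divsum_le: "norm (divsum k n) \<le> real n ^ Suc k"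
proof (cases "n = 0")
  case True
  \<comment> \<open>Every natural number divides 0, and a sum over an infinite set is 0 by
    convention.\<close>
  have "infinite (UNIV :: nat set)" by simp
  then have "divsum k n = 0" unfolding divsum_def True by simp
  then show ?thesis by simp
next
  case False
  have "(\<Sum>d\<in>{d. d dvd n}. d ^ k) \<le> (\<Sum>d\<in>{1..n}. n ^ k)"
    using False by (intro order_trans[OF sum_mono2[of "{1..n}"] sum_mono])
      (auto intro: dvd_imp_le power_mono simp: Suc_le_eq dvd_pos_nat)
  also have "\<dots> = n ^ Suc k" by simp
  finally have "real (\<Sum>d\<in>{d. d dvd n}. d ^ k) \<le> real (n ^ Suc k)"
    by (subst of_nat_le_iff)
  then show ?thesis unfolding divsum_def norm_of_nat by simp
qed

text \<open>With n = m r, where r is the divisor, the double series of r^k q^(m r) is summed once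
  along n, giving divisor sums, and once along m, giving \<open>power_sum\<close>. Absolute
  convergence is checked in the former order, where the inner sums are finite.\<close>

lemma lambert_series:
  assumes "norm q < 1"
  shows "((\<lambda>m. power_sum k (q ^ m)) has_sum (\<Sum>n. divsum k (Suc n) * q ^ Suc n)) {0<..}"
proof -
  define F where "F = (\<lambda>(n::nat, d::nat). of_nat d ^ k * q ^ n)"
  define S where "S = (SIGMA n:{0<..}. {d::nat. d dvd n})"
  have fin: "finite {d. d dvd n}" if "n \<in> {0<..}" for n :: nat using that by simp
  have inner: "(\<Sum>d\<in>{d. d dvd n}. F (n, d)) = divsum k n * q ^ n" for n
    by (simp add: F_def divsum_def sum_distrib_right)
  have inner_norm: "(\<Sum>d\<in>{d. d dvd n}. norm (F (n, d))) = norm (divsum k n * q ^ n)" for n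
    by (simp add: F_def divsum_def norm_mult norm_power flip: sum_distrib_right of_nat_sum of_nat_power)
  have sn: "summable (\<lambda>n. norm (divsum k n * q ^ n))"
    using norm_divsum_le assms by (rule summable_poly_growth)
  have "(\<lambda>n. norm (divsum k n * q ^ n)) summable_on UNIV"
    by (rule summable_nonneg_imp_summable_on[OF sn]) simp
  then have "(\<lambda>n. norm (divsum k n * q ^ n)) summable_on {0<..}"
    by (rule summable_on_subset) auto
  then have "(\<lambda>n. norm (infsum (\<lambda>d. norm (F (n, d))) {d. d dvd n})) summable_on {0<..}"
    by (rule summable_on_cong[THEN iffD1, rotated]) (use fin inner_norm in auto)
  then have "(\<lambda>x. norm (F x)) summable_on S"
    unfolding S_def Infinite_Sum.abs_summable_on_Sigma_iff using fin by auto
  then have FS: "F summable_on S" by (rule abs_summable_summable)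
  have "(\<lambda>n. divsum k n * q ^ n) sums (\<Sum>n. divsum k n * q ^ n)"
    using sn by (intro summable_sums) (rule summable_norm_cancel)
  then have hs: "((\<lambda>n. divsum k n * q ^ n) has_sum (\<Sum>n. divsum k n * q ^ n)) UNIV"
    by (rule norm_summable_imp_has_sum[OF sn])
  have z0: "divsum k 0 = 0" using norm_divsum_le[of k 0] by simp
  have "(\<Sum>n. divsum k n * q ^ n) = (\<Sum>n. divsum k (Suc n) * q ^ Suc n)"
    using suminf_split_head[OF summable_norm_cancel[OF sn]] by (simp add: z0)
  with hs have "((\<lambda>n. divsum k n * q ^ n) has_sum (\<Sum>n. divsum k (Suc n) * q ^ Suc n)) UNIV"
    by simp
  then have hs': "((\<lambda>n. divsum k n * q ^ n) has_sum (\<Sum>n. divsum k (Suc n) * q ^ Suc n)) {0<..}"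
    by (rule has_sum_cong_neutral[THEN iffD1, rotated -1]) (auto simp: z0)
  have "(F has_sum (\<Sum>n. divsum k (Suc n) * q ^ Suc n)) S"
    unfolding S_def
    by (rule has_sum_SigmaI[OF _ hs'])
      (use FS fin inner in \<open>auto simp: S_def intro!: has_sum_finiteI\<close>)
  also have "?this \<longleftrightarrow> ((\<lambda>(m, r). of_nat r ^ k * (q ^ m) ^ r) has_sum (\<Sum>n. divsum k (Suc n) * q ^ Suc n)) ({0<..} \<times> {0<..})"
    by (rule has_sum_reindex_bij_witness[of _ "\<lambda>(m, r). (m * r, r)" "\<lambda>(n, d). (n div d, d)"])
      (auto simp: S_def F_def power_mult[symmetric] mult.commute intro: dvd_pos_nat elim!: dvdE)
  finally have P: "((\<lambda>(m, r). of_nat r ^ k * (q ^ m) ^ r) has_sum (\<Sum>n. divsum k (Suc n) * q ^ Suc n)) ({0<..} \<times> {0<..})" .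
  show ?thesis
  proof (rule has_sum_SigmaD[OF P])
    fix m :: nat assume m: "m \<in> {0<..}"
    have qm: "norm (q ^ m) < 1"
      using assms m by (simp add: norm_power power_less_one_iff)
    have sm: "summable (\<lambda>r. norm (of_nat r ^ k * (q ^ m) ^ r))"
      by (rule summable_poly_growth[OF _ qm, of _ k]) (simp add: norm_power)
    then have sm': "summable (\<lambda>r. norm (of_nat (Suc r) ^ k * (q ^ m) ^ Suc r))"
      by (subst summable_Suc_iff)
    have "((\<lambda>r. of_nat (Suc r) ^ k * (q ^ m) ^ Suc r) has_sum power_sum k (q ^ m)) UNIV"
      by (rule norm_summable_imp_has_sum[OF sm' power_sum_sums[OF qm]])
    also have "?this \<longleftrightarrow> ((\<lambda>r. of_nat r ^ k * (q ^ m) ^ r) has_sum power_sum k (q ^ m)) {0<..}"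
      by (rule has_sum_reindex_bij_witness[of _ "\<lambda>n. n - 1" Suc]) auto
    finally show "((\<lambda>r. case (m, r) of (m, r) \<Rightarrow> of_nat r ^ k * (q ^ m) ^ r) has_sum power_sum k (q ^ m)) {0<..}"
      by simp
  qed
qed

text \<open>The nonnegative and the negative integers give the polygamma series at \<open>z\<close>
  and at \<open>1 - z\<close>; together they form \<open>polygamma_refl\<close>, whose q-expansion
  is known.\<close>

lemma lipschitz_formula:
  assumes "Im z > 0" "n > 0" "(\<lambda>j::int. 1 / (z + of_int j) ^ Suc n) summable_on UNIV"
  shows "(\<Sum>\<^sub>\<infinity>j::int. 1 / (z + of_int j) ^ Suc n) =
    (-2 * of_real pi * \<i>) ^ Suc n / fact n * power_sum n (qpar z)"
proof -
  define f where "f = (\<lambda>j::int. 1 / (z + of_int j) ^ Suc n)"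
  have f: "f summable_on A" for A
    using assms(3) unfolding f_def by (rule summable_on_subset) auto
  have z: "z \<noteq> 0" "1 - z \<noteq> 0" using assms(1) by auto
  have "bij_betw int UNIV {0..}"
    by (rule bij_betwI[of _ _ _ nat]) auto
  from has_sum_reindex_bij_betw[OF this, of f "infsum f {0..}"] f
  have "((\<lambda>k. f (int k)) has_sum infsum f {0..}) UNIV" by simp
  then have "(\<lambda>k. f (int k)) sums infsum f {0..}" by (rule has_sum_imp_sums)
  moreover have "(\<lambda>k. f (int k)) sums ((-1) ^ Suc n * Polygamma n z / fact n)"
    using Polygamma_LIMSEQ[OF z(1) assms(2)] by (simp add: f_def inverse_eq_divide)
  ultimately have 1: "infsum f {0..} = (-1) ^ Suc n * Polygamma n z / fact n"
    by (rule sums_unique2)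
  \<comment> \<open>Enumerating the negative integers as -1 - k turns z + j into -(1 - z + k), the
    base of the polygamma series at \<open>1 - z\<close>.\<close>
  have "bij_betw (\<lambda>k. - 1 - int k) UNIV {..<0}"
    by (rule bij_betwI[of _ _ _ "\<lambda>j. nat (- 1 - j)"]) auto
  from has_sum_reindex_bij_betw[OF this, of f "infsum f {..<0}"] f
  have "((\<lambda>k. f (- 1 - int k)) has_sum infsum f {..<0}) UNIV" by simp
  then have "(\<lambda>k. f (- 1 - int k)) sums infsum f {..<0}" by (rule has_sum_imp_sums)
  moreover have "f (- 1 - int k) = (-1) ^ Suc n * inverse ((1 - z + of_nat k) ^ Suc n)" for k
  proof -
    have "z + of_int (- 1 - int k) = (-1) * (1 - z + of_nat k)" by (simp add: algebra_simps)
    then have "(z + of_int (- 1 - int k)) ^ Suc n = (-1) ^ Suc n * (1 - z + of_nat k) ^ Suc n"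
      by (simp only: power_mult_distrib)
    then show ?thesis
      unfolding f_def by (cases "even n") (simp_all add: inverse_eq_divide)
  qed
  then have "(\<lambda>k. f (- 1 - int k)) sums ((-1) ^ Suc n * ((-1) ^ Suc n * Polygamma n (1 - z) / fact n))"
    using sums_mult[OF Polygamma_LIMSEQ[OF z(2) assms(2)], of "(-1) ^ Suc n"] by simp
  ultimately have 2: "infsum f {..<0} = (-1) ^ Suc n * ((-1) ^ Suc n * Polygamma n (1 - z) / fact n)"
    by (rule sums_unique2)
  have "infsum f UNIV = infsum f {0..} + infsum f {..<0}"
    by (subst infsum_Un_disjoint[symmetric, OF f f]) (auto intro!: arg_cong[where f = "infsum f"])
  also have "\<dots> = (-1) ^ n * polygamma_refl n z / fact n"
    unfolding 1 2 polygamma_refl_def by (cases "even n") (simp_all add: diff_divide_distrib add_divide_distrib)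
  also have "\<dots> = (-2 * of_real pi * \<i>) ^ Suc n / fact n * power_sum n (qpar z)"
  proof -
    have "-2 * of_real pi * \<i> = (-1) * (2 * of_real pi * \<i>)" by simp
    then have "(-2 * of_real pi * \<i>) ^ Suc n = (-1) ^ Suc n * (2 * of_real pi * \<i>) ^ Suc n"
      by (simp only: power_mult_distrib)
    then show ?thesis
      using polygamma_refl_upper_half_plane[OF assms(1,2)] by simp
  qed
  finally show ?thesis by (simp add: f_def)
qed

lemma qpar_of_nat_mult: "qpar (of_nat m * z) = qpar z ^ m"
  unfolding qpar_def exp_of_nat_mult[symmetric] by (simp add: algebra_simps)

text \<open>The row m = 0 gives twice the zeta value. A row m > 0 is Lipschitz's formula at m z, and
  these rows add up to a Lambert series; the rows m < 0 repeat them because the weight is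
  even.\<close>

lemma eisenstein_fourier:
  assumes "Im z > 0" "l \<ge> 2"
    and zeta: "((\<lambda>n. 1 / of_nat (Suc n) ^ (2 * l)) has_sum Z) UNIV"
  shows "eisenstein (2 * l) z = 2 * Z +
     2 * ((-2 * of_real pi * \<i>) ^ (2 * l) / fact (2 * l - 1) * (\<Sum>n. divsum (2 * l - 1) (Suc n) * qpar z ^ Suc n))"
proof -
  define k where "k = 2 * l"
  define f where "f = (\<lambda>(m::int, n::int). 1 / (of_int m * z + of_int n) ^ k)"
  define C where "C = (-2 * of_real pi * \<i>) ^ k / fact (k - 1)"
  define L where "L = (\<Sum>n. divsum (k - 1) (Suc n) * qpar z ^ Suc n)"
  have k: "Suc (k - 1) = k" "k - 1 > 0" using assms(2) by (auto simp: k_def)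
  have f0: "f summable_on UNIV - {(0,0)}"
    using abs_summable_summable[OF lattice_abs_summable[OF assms(1,2)]] by (simp add: f_def k_def)
  then have f: "f summable_on A" if "A \<subseteq> UNIV - {(0,0)}" for A
    using that by (rule summable_on_subset)
  have sym: "f (- m, - n) = f (m, n)" for m n
  proof -
    have "of_int (- m) * z + of_int (- n) = - (of_int m * z + of_int n)" by simp
    then have "(of_int (- m) * z + of_int (- n)) ^ k = (of_int m * z + of_int n) ^ k"
      unfolding k_def by (simp only: power_minus_even even_mult_iff even_numeral simp_thms)
    then show ?thesis unfolding f_def prod.case by (rule arg_cong)
  qed
  have pos: "(f has_sum C * L) ({0<..} \<times> UNIV)"
  proof -
    have inner: "((\<lambda>n. f (int m, n)) has_sum C * power_sum (k - 1) (qpar z ^ m)) UNIV" if "m \<in> {0<..}" for m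
    proof -
      have "f summable_on Pair (int m) ` UNIV" using that by (intro f) auto
      then have s: "(\<lambda>n. f (int m, n)) summable_on UNIV"
        by (subst (asm) summable_on_reindex) (auto simp: inj_on_def o_def)
      then have "(\<lambda>j. 1 / (of_nat m * z + of_int j) ^ Suc (k - 1)) summable_on UNIV"
        unfolding k by (simp add: f_def)
      from lipschitz_formula[OF _ k(2) this] that assms(1)
      have "(\<Sum>\<^sub>\<infinity>n. f (int m, n)) = C * power_sum (k - 1) (qpar z ^ m)"
        unfolding k by (simp add: f_def C_def qpar_of_nat_mult)
      with s show ?thesis using has_sum_infsum by metis
    qed
    have "((\<lambda>m. power_sum (k - 1) (qpar z ^ m)) has_sum L) {0<..}"
      unfolding L_def by (rule lambert_series) (use assms norm_qpar_less_1 in auto)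
    then have outer: "((\<lambda>m. C * power_sum (k - 1) (qpar z ^ m)) has_sum C * L) {0<..}"
      by (rule has_sum_cmult_right)
    have bij: "bij_betw (\<lambda>(m, n). (int m, n)) ({0<..} \<times> UNIV) ({0<..} \<times> (UNIV :: int set))"
      by (rule bij_betwI[of _ _ _ "\<lambda>(m, n). (nat m, n)"]) auto
    have "(\<lambda>x. f (case x of (m, n) \<Rightarrow> (int m, n))) summable_on ({0<..} \<times> UNIV)"
      by (subst summable_on_reindex_bij_betw[OF bij]) (intro f, auto)
    then have "((\<lambda>x. f (case x of (m, n) \<Rightarrow> (int m, n))) has_sum C * L) ({0<..} \<times> UNIV)"
      by (intro has_sum_SigmaI[OF _ outer]) (use inner in auto)
    then show ?thesis
      by (subst (asm) has_sum_reindex_bij_betw[OF bij])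
  qed
  have "bij_betw (\<lambda>(m::int, n::int). (- m, - n)) ({..<0} \<times> UNIV) ({0<..} \<times> (UNIV :: int set))"
    by (rule bij_betwI[of _ _ _ "\<lambda>(m, n). (- m, - n)"]) (auto simp: less_minus_iff)
  from has_sum_reindex_bij_betw[OF this, of f "C * L"] pos
  have "((\<lambda>x. f (case x of (m, n) \<Rightarrow> (- m, - n))) has_sum C * L) ({..<0} \<times> UNIV)"
    by simp
  moreover have "(\<lambda>x. f (case x of (m, n) \<Rightarrow> (- m, - n))) = f"
    using sym by auto
  ultimately have neg: "(f has_sum C * L) ({..<0} \<times> UNIV)"
    by simp
  have Z: "(f has_sum Z) ({0} \<times> {0<..})"
  proof -
    have "((\<lambda>n. 1 / of_nat (Suc n) ^ k) has_sum Z) UNIV = (f has_sum Z) ({0} \<times> {0<..})"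
      by (rule has_sum_reindex_bij_witness[of _ "\<lambda>(m, n). nat n - 1" "\<lambda>n. (0, int (Suc n))"])
        (auto simp: f_def)
    then show ?thesis using zeta by (simp add: k_def)
  qed
  have "bij_betw (\<lambda>(m::int, n::int). (- m, - n)) ({0} \<times> {..<0}) ({0} \<times> {0<..} :: (int \<times> int) set)"
    by (rule bij_betwI[of _ _ _ "\<lambda>(m, n). (- m, - n)"]) (auto simp: less_minus_iff)
  from has_sum_reindex_bij_betw[OF this, of f Z] Z
  have "((\<lambda>x. f (case x of (m, n) \<Rightarrow> (- m, - n))) has_sum Z) ({0} \<times> {..<0})"
    by simp
  moreover have "(\<lambda>x. f (case x of (m, n) \<Rightarrow> (- m, - n))) = f"
    using sym by auto
  ultimately have Z': "(f has_sum Z) ({0} \<times> {..<0})"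
    by simp
  have "(f has_sum (Z + Z) + (C * L + C * L))
      (({0} \<times> {0<..} \<union> {0} \<times> {..<0}) \<union> ({0<..} \<times> UNIV \<union> {..<0} \<times> UNIV))"
    by (intro has_sum_Un_disjoint Z Z' pos neg) auto
  also have "({0} \<times> {0<..} \<union> {0} \<times> {..<0}) \<union> ({0<..} \<times> UNIV \<union> {..<0} \<times> UNIV) = UNIV - {(0::int, 0::int)}"
    by auto
  finally have "infsum f (UNIV - {(0,0)}) = 2 * Z + 2 * (C * L)"
    by (simp add: infsumI)
  then show ?thesis
    by (simp add: eisenstein_def f_def C_def L_def k_def)
qed

text \<open>Even denominators reproduce Z / 2^(n+1); the odd ones are the polygamma series at 1/2
  divided by 2^(n+1). Solving for Z leaves the factor 2^(n+1) - 1. At 1/2 the arguments z and 1 - z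
  coincide, so for odd \<open>n\<close> the reflected combination is -2 times the polygamma
  value.\<close>

lemma zeta_has_sum:
  assumes "n > 0" "odd n"
  shows "((\<lambda>k. 1 / of_nat (Suc k) ^ Suc n :: complex) has_sum
    - polygamma_refl n (1/2) / (2 * fact n * (2 ^ Suc n - 1))) UNIV"
proof -
  define f :: "nat \<Rightarrow> complex" where "f = (\<lambda>k. 1 / of_nat (Suc k) ^ Suc n)"
  have "summable (\<lambda>k. inverse (real (Suc k) ^ Suc n))"
    by (subst summable_Suc_iff) (use assms in \<open>simp add: inverse_power_summable del: power_Suc\<close>)
  then have nf: "summable (\<lambda>k. norm (f k))"
    by (simp add: f_def norm_divide norm_power inverse_eq_divide del: of_nat_Suc power_Suc)
  define Z where "Z = suminf f"
  have Z: "f sums Z" unfolding Z_def by (rule summable_sums, rule summable_norm_cancel, rule nf)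
  have "(\<lambda>m. sum f {m * 2..<m * 2 + 2}) sums Z"
    by (rule sums_group[OF Z]) simp
  moreover have "sum f {m * 2..<m * 2 + 2} = inverse ((1/2 + of_nat m) ^ Suc n) / 2 ^ Suc n + f m / 2 ^ Suc n" for m
  proof -
    have e1: "of_nat (Suc (m * 2)) = 2 * (1/2 + of_nat m :: complex)"
      by (simp add: field_simps)
    have e2: "of_nat (Suc (Suc (m * 2))) = (2 * of_nat (Suc m) :: complex)"
      by (simp add: field_simps)
    have "{m * 2..<m * 2 + 2} = {m * 2, Suc (m * 2)}" by auto
    then have "sum f {m * 2..<m * 2 + 2} = f (m * 2) + f (Suc (m * 2))" by simp
    also have "\<dots> = inverse ((1/2 + of_nat m) ^ Suc n) / 2 ^ Suc n + f m / 2 ^ Suc n"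
      unfolding f_def e1 e2 power_mult_distrib by (simp add: field_simps del: of_nat_Suc power_Suc)
    finally show ?thesis .
  qed
  moreover have "(\<lambda>m. inverse ((1/2 + of_nat m :: complex) ^ Suc n) / 2 ^ Suc n + f m / 2 ^ Suc n) sums
      (((-1) ^ Suc n * Polygamma n (1/2) / fact n) / 2 ^ Suc n + Z / 2 ^ Suc n)"
    by (intro sums_add sums_divide Polygamma_LIMSEQ Z) (use assms in auto)
  ultimately have "Z = ((-1) ^ Suc n * Polygamma n (1/2) / fact n) / 2 ^ Suc n + Z / 2 ^ Suc n"
    by (auto dest: sums_unique2)
  moreover have "(-1) ^ Suc n * Polygamma n (1/2) = - polygamma_refl n (1/2) / 2"
    using assms(2) by (simp add: polygamma_refl_def)
  ultimately have "Z = (- polygamma_refl n (1/2) / 2 / fact n) / 2 ^ Suc n + Z / 2 ^ Suc n"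
    by (simp only:)
  moreover have "(2 :: complex) ^ Suc n - 1 \<noteq> 0"
  proof -
    have "norm ((2 :: complex) ^ Suc n) \<noteq> norm (1 :: complex)"
      unfolding norm_power norm_numeral norm_one
      by (metis less_irrefl one_less_numeral_iff one_less_power semiring_norm(76) zero_less_Suc)
    then have "(2 :: complex) ^ Suc n \<noteq> 1" by (metis (no_types))
    then show ?thesis by (subst right_minus_eq)
  qed
  ultimately have "Z = - polygamma_refl n (1/2) / (2 * fact n * (2 ^ Suc n - 1))"
    by (simp add: divide_simps del: power_Suc) (simp add: algebra_simps del: power_Suc)
  then show ?thesis
    using norm_summable_imp_has_sum[OF nf Z] by (simp add: f_def del: of_nat_Suc power_Suc)
qed

lemma zeta_4: "((\<lambda>k. 1 / of_nat (Suc k) ^ 4 :: complex) has_sum of_real pi ^ 4 / 90) UNIV"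
  using zeta_has_sum[of 3] polygamma_refl_half(1) by (simp add: fact_numeral)

lemma zeta_6: "((\<lambda>k. 1 / of_nat (Suc k) ^ 6 :: complex) has_sum of_real pi ^ 6 / 945) UNIV"
  using zeta_has_sum[of 5] polygamma_refl_half(2) by (simp add: fact_numeral)

section \<open>Normalisation and modularity of \<open>E4\<close> and \<open>E6\<close>\<close>

lemma E4_eq_eisenstein:
  assumes "Im z > 0"
  shows "E4 z = 45 / of_real pi ^ 4 * eisenstein 4 z"
proof -
  have "eisenstein (2 * 2) z = 2 * (of_real pi ^ 4 / 90) +
     2 * ((-2 * of_real pi * \<i>) ^ (2 * 2) / fact (2 * 2 - 1) * (\<Sum>n. divsum (2 * 2 - 1) (Suc n) * qpar z ^ Suc n))"
    by (rule eisenstein_fourier[OF assms]) (use zeta_4 in simp_all)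
  \<comment> \<open>Dividing by the constant term pi^4/45 turns 2 (2 pi)^4 / 3! into 240.\<close>
  then show ?thesis
    by (simp add: E4_def fact_numeral power_mult_distrib field_simps)
qed

lemma E6_eq_eisenstein:
  assumes "Im z > 0"
  shows "E6 z = 945 / (2 * of_real pi ^ 6) * eisenstein 6 z"
proof -
  have "eisenstein (2 * 3) z = 2 * (of_real pi ^ 6 / 945) +
     2 * ((-2 * of_real pi * \<i>) ^ (2 * 3) / fact (2 * 3 - 1) * (\<Sum>n. divsum (2 * 3 - 1) (Suc n) * qpar z ^ Suc n))"
    by (rule eisenstein_fourier[OF assms]) (use zeta_6 in simp_all)
  \<comment> \<open>Dividing by 2 pi^6/945 turns 2 (-2 pi i)^6 / 5! into -504, the sign coming from
    i^6 = -1.\<close>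
  then show ?thesis
    by (simp add: E6_def fact_numeral power_mult_distrib field_simps)
qed

lemma Im_moebius:
  fixes a b c d :: int
  assumes "Im z > 0" "a * d - b * c = n"
  shows "Im ((of_int a * z + of_int b) / (of_int c * z + of_int d)) =
    of_int n * Im z / norm (of_int c * z + of_int d) ^ 2"
proof -
  have n: "real_of_int n = of_int a * of_int d - of_int b * of_int c"
    using assms(2) by (metis of_int_diff of_int_mult)
  show ?thesis
    unfolding n Im_divide cmod_power2 by (simp add: algebra_simps)
qed

lemma Im_moebius_pos:
  fixes a b c d :: int
  assumes "Im z > 0" "a * d - b * c = n" "n > 0"
  shows "Im ((of_int a * z + of_int b) / (of_int c * z + of_int d)) > 0"
proof -
  have "(c, d) \<noteq> (0, 0)" using assms by auto
  then have "of_int c * z + of_int d \<noteq> 0"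
    by (rule upper_half_plane_denominator_nonzero[OF assms(1)])
  then show ?thesis
    unfolding Im_moebius[OF assms(1,2)] using assms(1,3) by simp
qed

lemma
  fixes a b c d :: int
  assumes "Im z > 0" "a * d - b * c = 1"
  shows E4_modular: "E4 ((of_int a * z + of_int b) / (of_int c * z + of_int d)) =
      (of_int c * z + of_int d) ^ 4 * E4 z"
    and E6_modular: "E6 ((of_int a * z + of_int b) / (of_int c * z + of_int d)) =
      (of_int c * z + of_int d) ^ 6 * E6 z"
  using eisenstein_modular[OF assms] Im_moebius_pos[OF assms] assms(1)
  by (simp_all add: E4_eq_eisenstein E6_eq_eisenstein)

section \<open>A vanishing criterion for modular forms\<close>

text \<open>Only the transformation law. Holomorphy and growth at the cusp remain separate
  hypotheses, since functions such as j, with a pole at the cusp, have to be covered.\<close>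

definition modular_weight :: "nat \<Rightarrow> (complex \<Rightarrow> complex) \<Rightarrow> bool" where
  "modular_weight k f \<longleftrightarrow> (\<forall>(a::int) (b::int) (c::int) (d::int) z. Im z > 0 \<longrightarrow> a * d - b * c = 1 \<longrightarrow>
     f ((of_int a * z + of_int b) / (of_int c * z + of_int d)) = (of_int c * z + of_int d) ^ k * f z)"

lemma modular_weightD:
  fixes a b c d :: int
  assumes "modular_weight k f" "Im z > 0" "a * d - b * c = 1"
  shows "f ((of_int a * z + of_int b) / (of_int c * z + of_int d)) = (of_int c * z + of_int d) ^ k * f z"
  using assms unfolding modular_weight_def by blast

lemma modular_weight_periodic:
  assumes "modular_weight k f" "Im z > 0"
  shows "f (z + of_int m) = f z"
  using modular_weightD[OF assms, of 1 1 m 0] by simp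

text \<open>The image of z under a matrix with bottom row (c, d) has height Im z / |cz + d|^2, so
  this row moves z as high as possible. A minimum exists because discs contain finitely many lattice
  points, and a common factor of c and d could be divided out.\<close>

lemma minimal_denominator:
  assumes "Im z > 0"
  obtains c d :: int where "coprime c d"
    "\<And>c' d' :: int. (c', d') \<noteq> (0, 0) \<Longrightarrow> norm (of_int c * z + of_int d) \<le> norm (of_int c' * z + of_int d')"
proof -
  define N where "N = (\<lambda>(c::int, d::int). norm (of_int c * z + of_int d))"
  obtain e where e: "e > 0" "\<And>m n::int. e * (of_int m ^ 2 + of_int n ^ 2) \<le> norm (of_int m * z + of_int n) ^ 2"
    using lattice_norm_ge[OF assms] by blast
  \<comment> \<open>The vector (0, 1) has norm 1, so the minimum over all nonzero vectors lies in
    this set.\<close>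
  define S where "S = {x. x \<noteq> (0, 0) \<and> N x \<le> 1}"
  define R where "R = \<lceil>1 / e\<rceil>"
  have "S \<subseteq> {-R..R} \<times> {-R..R}"
  proof (rule subsetI)
    fix x assume "x \<in> S"
    moreover obtain c d where x: "x = (c, d)" by force
    ultimately have "norm (of_int c * z + of_int d) \<le> 1" by (simp add: S_def N_def)
    then have "norm (of_int c * z + of_int d) ^ 2 \<le> 1" by (simp add: power_le_one)
    then have *: "of_int c ^ 2 + of_int d ^ 2 \<le> 1 / e"
      using e(2)[of c d] e(1) by (simp add: field_simps)
    have "\<bar>m\<bar> \<le> R" if "real_of_int m ^ 2 \<le> 1 / e" for m
    proof -
      have "\<bar>m\<bar> * 1 \<le> \<bar>m\<bar> * \<bar>m\<bar>" by (cases "m = 0") (simp, intro mult_left_mono, auto)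
      then have "real_of_int (\<bar>m\<bar>) \<le> real_of_int (\<bar>m\<bar> * \<bar>m\<bar>)" by (subst of_int_le_iff) simp
      also have "\<dots> = real_of_int m ^ 2" by (simp add: power2_eq_square)
      also have "\<dots> \<le> of_int R" using that unfolding R_def by linarith
      finally show ?thesis by (subst (asm) of_int_le_iff)
    qed
    from this[of c] this[of d] * have "\<bar>c\<bar> \<le> R" "\<bar>d\<bar> \<le> R"
      by (smt (verit) zero_le_power2)+
    then show "x \<in> {-R..R} \<times> {-R..R}" by (auto simp: x)
  qed
  then have fin: "finite S" by (rule finite_subset) auto
  have "(0, 1) \<in> S" by (simp add: S_def N_def)
  then have "S \<noteq> {}" by blast
  obtain c d where cd: "(c, d) \<in> S" "\<And>x. x \<in> S \<Longrightarrow> N (c, d) \<le> N x"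
    using ex_min_if_finite[OF finite_imageI[OF fin, of N]] \<open>S \<noteq> {}\<close>
    by (metis (no_types, opaque_lifting) arg_min_if_finite(1) arg_min_if_finite(2) fin linorder_not_le surj_pair)
  have min: "N (c, d) \<le> N x" if "x \<noteq> (0, 0)" for x
  proof (cases "N x \<le> 1")
    case True
    then show ?thesis using cd(2) that by (simp add: S_def)
  next
    case False
    then show ?thesis using cd(1) by (simp add: S_def)
  qed
  have cd0: "(c, d) \<noteq> (0, 0)" using cd(1) by (simp add: S_def)
  have "coprime c d"
  proof -
    define g where "g = gcd c d"
    have g: "g > 0" using cd0 by (auto simp: g_def)
    obtain c' d' where cd': "c = g * c'" "d = g * d'"
      unfolding g_def by (meson dvdE gcd_dvd1 gcd_dvd2)
    have "(c', d') \<noteq> (0, 0)" using cd0 cd' by auto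
    then have "N (c, d) \<le> N (c', d')" and nz: "of_int c' * z + of_int d' \<noteq> 0"
      using min upper_half_plane_denominator_nonzero[OF assms] by auto
    moreover have "N (c, d) = of_int g * N (c', d')"
    proof -
      have "of_int c * z + of_int d = of_int g * (of_int c' * z + of_int d')"
        by (simp add: cd' algebra_simps)
      then show ?thesis using g by (simp add: N_def norm_mult)
    qed
    ultimately have "of_int g * N (c', d') \<le> 1 * N (c', d')" by simp
    moreover have "N (c', d') > 0" using nz by (simp add: N_def)
    ultimately have "real_of_int g \<le> 1" by (simp only: mult_le_cancel_right_pos)
    then have "g = 1" using g by linarith
    then show ?thesis by (simp add: g_def coprime_iff_gcd_eq_1)
  qed
  then show ?thesis
    using min by (intro that[of c d]) (auto simp: N_def)
qed

text \<open>The numerator az + b is again a nonzero lattice vector, so by minimality of the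
  denominator the image p satisfies |p| >= 1; with |Re p| <= 1/2 this forces (Im p)^2 >=
  3/4.\<close>

lemma fundamental_domain_reduction:
  assumes "Im z > 0"
  obtains a b c d :: int where "a * d - b * c = 1"
    "\<bar>Re ((of_int a * z + of_int b) / (of_int c * z + of_int d))\<bar> \<le> 1 / 2"
    "Im ((of_int a * z + of_int b) / (of_int c * z + of_int d)) \<ge> sqrt 3 / 2"
proof -
  obtain c d :: int where cd: "coprime c d"
    "\<And>c' d' :: int. (c', d') \<noteq> (0, 0) \<Longrightarrow> norm (of_int c * z + of_int d) \<le> norm (of_int c' * z + of_int d')"
    using minimal_denominator[OF assms] by blast
  obtain u v where uv: "u * c + v * d = 1"
    using cd(1) bezout_int[of c d] by (auto simp: coprime_iff_gcd_eq_1)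
  define w where "w = of_int c * z + of_int d"
  have cd0: "(c, d) \<noteq> (0, 0)" using cd(1) by auto
  have "w \<noteq> 0" unfolding w_def
    by (rule upper_half_plane_denominator_nonzero[OF assms cd0])
  define s where "s = (of_int v * z - of_int u) / w"
  \<comment> \<open>Translating by the nearest integer adds \<open>t\<close> times the bottom row to
    the top row and leaves the minimal denominator alone.\<close>
  define t where "t = - round (Re s)"
  define a b where "a = v + t * c" and "b = - u + t * d"
  have det: "a * d - b * c = 1" using uv by (simp add: a_def b_def algebra_simps)
  have eq: "(of_int a * z + of_int b) / w = s + of_int t"
    using \<open>w \<noteq> 0\<close> by (simp add: s_def a_def b_def w_def field_simps)
  define p where "p = (of_int a * z + of_int b) / w"
  have re: "\<bar>Re p\<bar> \<le> 1 / 2"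
    using of_int_round_abs_le[of "Re s"] unfolding p_def eq by (simp add: t_def abs_minus_commute)
  have "(a, b) \<noteq> (0, 0)" using det by auto
  then have "norm w \<le> norm (of_int a * z + of_int b)" unfolding w_def by (rule cd(2))
  then have "1 \<le> norm p" using \<open>w \<noteq> 0\<close> by (simp add: p_def norm_divide)
  then have "1 \<le> norm p ^ 2" by (simp add: one_le_power)
  moreover have "norm p ^ 2 = Re p ^ 2 + Im p ^ 2" by (rule cmod_power2)
  moreover have "Re p ^ 2 \<le> (1 / 2) ^ 2" using re by (metis abs_ge_zero power2_abs power_mono)
  ultimately have "3 / 4 \<le> Im p ^ 2" by (simp add: power2_eq_square)
  then have "sqrt (3 / 4) \<le> \<bar>Im p\<bar>" by (metis real_sqrt_abs real_sqrt_le_mono)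
  moreover have "Im p > 0" unfolding p_def w_def by (rule Im_moebius_pos[OF assms det]) simp
  ultimately have "sqrt 3 / 2 \<le> Im p" by (simp add: real_sqrt_divide)
  then show ?thesis using det re that unfolding p_def w_def by blast
qed

section \<open>Periodic functions in the variable q\<close>

abbreviation upper_half_plane :: "complex set" where
  "upper_half_plane \<equiv> {z. Im z > 0}"

lemma open_upper_half_plane: "open upper_half_plane"
  by (rule open_halfspace_Im_gt)

lemma qpar_nonzero [simp]: "qpar z \<noteq> 0"
  by (simp add: qpar_def)

lemma qpar_eq_iff: "qpar z = qpar w \<longleftrightarrow> (\<exists>m::int. z = w + of_int m)"
proof
  assume "qpar z = qpar w"
  then obtain m :: int where "2 * of_real pi * \<i> * z = 2 * of_real pi * \<i> * w + of_int (2 * m) * of_real pi * \<i>"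
    unfolding qpar_def by (auto simp: exp_eq)
  then have "(2 * of_real pi * \<i>) * z = (2 * of_real pi * \<i>) * (w + of_int m)"
    by (simp add: algebra_simps)
  then have "z = w + of_int m" by (subst (asm) mult_cancel_left) simp
  then show "\<exists>m::int. z = w + of_int m" by blast
next
  assume "\<exists>m::int. z = w + of_int m"
  then obtain m :: int where m: "z = w + of_int m" by blast
  show "qpar z = qpar w"
    unfolding qpar_def exp_eq m by (intro exI[of _ m]) (simp add: algebra_simps)
qed

lemma qpar_Ln: "q \<noteq> 0 \<Longrightarrow> qpar (Ln q / (2 * of_real pi * \<i>)) = q"
  by (simp add: qpar_def)

lemma Im_pos_if_norm_qpar_less_1: "norm (qpar z) < 1 \<Longrightarrow> Im z > 0"
  by (simp add: norm_qpar zero_less_mult_iff)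

text \<open>Periodicity makes the value at a logarithm of q independent of the branch. The global
  definition uses the principal \<open>Ln\<close>, which jumps across the negative axis; holomorphy
  at p is therefore proved with a branch adapted to p.\<close>

lemma periodic_factors_through_qpar:
  assumes "f holomorphic_on upper_half_plane"
    and "\<And>z m. Im z > 0 \<Longrightarrow> f (z + of_int m) = f z"
  shows "\<exists>g. g holomorphic_on ball 0 1 - {0} \<and> (\<forall>z. Im z > 0 \<longrightarrow> g (qpar z) = f z)"
proof (intro exI conjI allI impI)
  define g where "g = (\<lambda>q. f (Ln q / (2 * of_real pi * \<i>)))"
  show g: "g (qpar z) = f z" if "Im z > 0" for z
  proof -
    have "qpar (Ln (qpar z) / (2 * of_real pi * \<i>)) = qpar z" by (simp add: qpar_Ln)
    then obtain m :: int where "Ln (qpar z) / (2 * of_real pi * \<i>) = z + of_int m"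
      unfolding qpar_eq_iff by blast
    then show ?thesis unfolding g_def using assms(2)[OF that] by simp
  qed
  show "g holomorphic_on ball 0 1 - {0}"
  proof (rule holomorphic_on_subset[OF analytic_imp_holomorphic[OF analytic_on_UN[THEN iffD2]]])
    show "\<forall>p\<in>ball 0 1 - {0}. g analytic_on {p}"
    proof
      fix p :: complex assume p: "p \<in> ball 0 1 - {0}"
      define U where "U = ball p (norm p) \<inter> ball 0 1"
      \<comment> \<open>Near p the quotient q/p stays in the right half plane, where
        \<open>Ln\<close> is holomorphic; adding \<open>Ln p\<close> gives a logarithm of q.\<close>
      define L where "L = (\<lambda>q. Ln (q / p) / (2 * of_real pi * \<i>) + Ln p / (2 * of_real pi * \<i>))"
      have re: "Re (q / p) > 0" if "q \<in> U" for q
      proof -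
        have "norm (q / p - 1) = norm (q - p) / norm p"
          using p by (simp add: norm_divide[symmetric] diff_divide_distrib)
        also have "\<dots> < 1" using that p by (simp add: U_def dist_norm norm_minus_commute)
        finally have "norm (q / p - 1) < 1" .
        then have "\<bar>Re (q / p - 1)\<bar> < 1" using abs_Re_le_cmod le_less_trans by blast
        then show ?thesis by simp
      qed
      have nz: "q \<noteq> 0" if "q \<in> U" for q using re[OF that] by auto
      have Lq: "qpar (L q) = q" if "q \<in> U" for q
      proof -
        have "qpar (L q) = (q / p) * p"
          unfolding L_def qpar_def distrib_left exp_add using nz[OF that] p by simp
        then show ?thesis using p by simp
      qed
      have LU: "L q \<in> upper_half_plane" if "q \<in> U" for q
        using Lq[OF that] that by (intro CollectI Im_pos_if_norm_qpar_less_1) (simp add: U_def)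
      have "q / p \<notin> \<real>\<^sub>\<le>\<^sub>0" if "q \<in> U" for q
        using re[OF that] by (auto simp: complex_nonpos_Reals_iff)
      then have "L holomorphic_on U"
        unfolding L_def using p by (auto intro!: holomorphic_intros)
      then have "(f \<circ> L) holomorphic_on U"
        using LU by (intro holomorphic_on_compose_gen[OF _ assms(1)]) auto
      moreover have "(f \<circ> L) q = g q" if "q \<in> U" for q
        using g[of "L q"] LU[OF that] Lq[OF that] by simp
      ultimately have "g holomorphic_on U"
        by (rule holomorphic_transform)
      moreover have "open U" "p \<in> U" using p by (auto simp: U_def)
      ultimately show "g analytic_on {p}"
        by (meson analytic_at)
    qed
  qed auto
qed

lemma bounded_periodic_factors_through_qpar:
  assumes "f holomorphic_on upper_half_plane"
    and "\<And>z m. Im z > 0 \<Longrightarrow> f (z + of_int m) = f z"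
    and "\<And>z. Im z \<ge> 1 \<Longrightarrow> norm (f z) \<le> B"
  obtains h where "h holomorphic_on ball 0 1" "\<And>z. Im z > 0 \<Longrightarrow> f z = h (qpar z)"
proof -
  obtain g where g: "g holomorphic_on ball 0 1 - {0}" "\<And>z. Im z > 0 \<Longrightarrow> g (qpar z) = f z"
    using periodic_factors_through_qpar[OF assms(1,2)] by blast
  \<comment> \<open>\<open>exp (- 2 * pi)\<close> is the modulus of q on the line Im z = 1, so the
    bound on f becomes a bound near q = 0 and the singularity is removable.\<close>
  have "eventually (\<lambda>q. q \<in> ball 0 (exp (- 2 * pi)) - {0}) (at (0::complex))"
    by (rule eventually_at_in_open) auto
  then have ev: "eventually (\<lambda>q. norm (g q) \<le> B) (at 0)"
  proof eventually_elim
    case (elim q)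
    define z where "z = Ln q / (2 * of_real pi * \<i>)"
    have q: "qpar z = q" using elim by (simp add: z_def qpar_Ln)
    have "norm (qpar z) < exp (- 2 * pi)" using elim q by simp
    then have "Im z > 1" by (simp add: norm_qpar)
    then show ?case using g(2)[of z] assms(3)[of z] q by simp
  qed
  have "\<exists>h. h holomorphic_on ball 0 1 \<and> (\<forall>z\<in>ball 0 1 - {0}. h z = g z)"
    by (subst holomorphic_on_extend_bounded[OF g(1)]) (use ev in auto)
  then obtain h where h: "h holomorphic_on ball 0 1" "\<forall>z\<in>ball 0 1 - {0}. h z = g z" by blast
  have "f z = h (qpar z)" if "Im z > 0" for z
    using h(2) g(2)[OF that] norm_qpar_less_1[OF that] by simp
  with h(1) that show ?thesis by blast
qed

text \<open>The powers of |cz + d| cancel between f and the imaginary part; squaring avoids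
  half-integral powers of Im z.\<close>

lemma modular_weight_abs_invariant:
  fixes a b c d :: int
  assumes "modular_weight k f" "Im z > 0" "a * d - b * c = 1"
  defines "w \<equiv> (of_int a * z + of_int b) / (of_int c * z + of_int d)"
  shows "norm (f w) ^ 2 * Im w ^ k = norm (f z) ^ 2 * Im z ^ k"
proof -
  define v where "v = of_int c * z + of_int d"
  have "(c, d) \<noteq> (0, 0)" using assms(3) by auto
  then have v: "v \<noteq> 0" unfolding v_def
    by (rule upper_half_plane_denominator_nonzero[OF assms(2)])
  have "f w = v ^ k * f z" unfolding w_def v_def by (rule modular_weightD[OF assms(1-3)])
  moreover have "Im w = Im z / norm v ^ 2"
    unfolding w_def v_def using Im_moebius[OF assms(2,3)] by simp
  ultimately show ?thesis
    using v by (simp add: norm_mult norm_power power_mult_distrib power_divide power_mult[symmetric] mult.commute)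
qed

text \<open>By invariance only the region |Re| <= 1/2, Im >= sqrt(3)/2 matters. High up, the
  exponential decay of q beats y^k, and what remains is a compact rectangle.\<close>

lemma modular_weight_attains_max:
  assumes f: "f holomorphic_on upper_half_plane" and wt: "modular_weight k f" and n: "n > 0"
    and B: "\<And>z. Im z \<ge> 1 \<Longrightarrow> norm (f z) \<le> B * norm (qpar z) ^ n"
    and nz: "Im z1 > 0" "f z1 \<noteq> 0"
  obtains z0 where "Im z0 \<ge> sqrt 3 / 2" "f z0 \<noteq> 0"
    "\<And>z. Im z > 0 \<Longrightarrow> norm (f z) ^ 2 * Im z ^ k \<le> norm (f z0) ^ 2 * Im z0 ^ k"
proof -
  define \<phi> where "\<phi> = (\<lambda>z. norm (f z) ^ 2 * Im z ^ k)"
  have inv: "\<phi> ((of_int a * z + of_int b) / (of_int c * z + of_int d)) = \<phi> z"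
    if "Im z > 0" "a * d - b * c = 1" for z and a b c d :: int
    unfolding \<phi>_def by (rule modular_weight_abs_invariant[OF wt that])
  have red: "\<exists>w. \<bar>Re w\<bar> \<le> 1 / 2 \<and> Im w \<ge> sqrt 3 / 2 \<and> \<phi> w = \<phi> z" if z: "Im z > 0" for z
    using fundamental_domain_reduction[OF z] inv[OF z] by metis
  have p: "\<phi> z1 > 0" using nz by (simp add: \<phi>_def)
  have "((\<lambda>y. B ^ 2 * (y ^ k / exp y)) \<longlongrightarrow> B ^ 2 * 0) at_top"
    by (intro tendsto_intros tendsto_power_div_exp_0)
  then have "\<forall>\<^sub>F y in at_top. B ^ 2 * (y ^ k / exp y) < \<phi> z1"
    using p by (simp add: order_tendsto_iff)
  then obtain Y0 where Y0: "\<And>y. y \<ge> Y0 \<Longrightarrow> B ^ 2 * (y ^ k / exp y) < \<phi> z1"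
    by (auto simp: eventually_at_top_linorder)
  define Y where "Y = max 1 Y0"
  have small: "\<phi> z < \<phi> z1" if "Im z \<ge> Y" for z
  proof -
    have y: "Im z \<ge> 1" "Im z \<ge> Y0" using that by (auto simp: Y_def)
    have "norm (f z) ^ 2 \<le> (B * norm (qpar z) ^ n) ^ 2"
      using B[OF y(1)] by (intro power_mono) auto
    also have "\<dots> = B ^ 2 * (norm (qpar z) ^ n) ^ 2" by (simp add: power_mult_distrib)
    \<comment> \<open>A crude bound suffices: a single factor exp(-y) already beats y^k.\<close>
    also have "\<dots> \<le> B ^ 2 * (1 / exp (Im z))"
    proof (rule mult_left_mono)
      have "norm (qpar z) ^ n \<le> norm (qpar z) ^ 1"
        using n y norm_qpar_less_1[of z] by (intro power_decreasing) auto
      then have "(norm (qpar z) ^ n) ^ 2 \<le> norm (qpar z) ^ 2" by (intro power_mono) auto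
      also have "\<dots> \<le> norm (qpar z) ^ 1"
        using y norm_qpar_less_1[of z] by (intro power_decreasing) auto
      also have "\<dots> \<le> exp (- Im z)"
        using y pi_ge_two by (simp add: norm_qpar)
      finally show "(norm (qpar z) ^ n) ^ 2 \<le> 1 / exp (Im z)" by (simp add: exp_minus inverse_eq_divide)
    qed simp
    finally have "\<phi> z \<le> B ^ 2 * (1 / exp (Im z)) * Im z ^ k"
      unfolding \<phi>_def using y by (intro mult_right_mono) auto
    also have "\<dots> < \<phi> z1" using Y0[OF y(2)] by (simp add: field_simps)
    finally show ?thesis .
  qed
  define K where "K = cbox (Complex (-1/2) (sqrt 3 / 2)) (Complex (1/2) Y)"
  have K: "z \<in> K \<longleftrightarrow> \<bar>Re z\<bar> \<le> 1 / 2 \<and> sqrt 3 / 2 \<le> Im z \<and> Im z \<le> Y" for z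
    by (auto simp: K_def in_cbox_complex_iff abs_le_iff)
  have s3: "sqrt 3 / 2 > 0" by simp
  have KH: "K \<subseteq> upper_half_plane" using s3 K by (auto intro: less_le_trans[OF s3])
  have "continuous_on K f"
    using holomorphic_on_imp_continuous_on[OF f] KH continuous_on_subset by blast
  then have cont: "continuous_on K \<phi>" unfolding \<phi>_def by (intro continuous_intros)
  obtain w1 where w1: "\<bar>Re w1\<bar> \<le> 1 / 2" "Im w1 \<ge> sqrt 3 / 2" "\<phi> w1 = \<phi> z1"
    using red[OF nz(1)] by blast
  have "w1 \<in> K" using w1 small[of w1] K by force
  then obtain z0 where z0: "z0 \<in> K" "\<And>z. z \<in> K \<Longrightarrow> \<phi> z \<le> \<phi> z0"
    using continuous_attains_sup[OF _ _ cont] by (auto simp: K_def)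
  have ge: "\<phi> z1 \<le> \<phi> z0" using z0(2)[OF \<open>w1 \<in> K\<close>] w1 by simp
  have max: "\<phi> z \<le> \<phi> z0" if z: "Im z > 0" for z
  proof -
    obtain w where w: "\<bar>Re w\<bar> \<le> 1 / 2" "Im w \<ge> sqrt 3 / 2" "\<phi> w = \<phi> z"
      using red[OF z] by blast
    show ?thesis
    proof (cases "Im w \<ge> Y")
      case True
      then show ?thesis using small[OF True] ge w by simp
    next
      case False
      then show ?thesis using z0(2)[of w] K w by simp
    qed
  qed
  show ?thesis
  proof (rule that[of z0])
    show "Im z0 \<ge> sqrt 3 / 2" using z0 K by blast
    show "f z0 \<noteq> 0" using ge p by (auto simp: \<phi>_def zero_power)
  qed (use max in \<open>simp add: \<phi>_def\<close>)
qed

text \<open>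
  The maximum principle for \<open>f / q ^ n\<close> on a disc around the cusp, played against the maximality of
  \<open>\<bar>f\<bar> y ^ (k / 2)\<close>, bounds the order of vanishing at the cusp by a multiple of the weight.
  This replaces the valence formula.
\<close>
lemma modular_weight_vanishing:
  assumes f: "f holomorphic_on upper_half_plane" and wt: "modular_weight k f" and n: "n > 0"
    and B: "\<And>z. Im z \<ge> 1 \<Longrightarrow> norm (f z) \<le> B * norm (qpar z) ^ n"
    and k: "real k < 2 * pi * real n * sqrt 3"
    and z1: "Im z1 > 0"
  shows "f z1 = 0"
proof (rule ccontr)
  assume "f z1 \<noteq> 0"
  then obtain z0 where z0: "Im z0 \<ge> sqrt 3 / 2" "f z0 \<noteq> 0"
    "\<And>z. Im z > 0 \<Longrightarrow> norm (f z) ^ 2 * Im z ^ k \<le> norm (f z0) ^ 2 * Im z0 ^ k"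
    using modular_weight_attains_max[OF f wt n B z1] by blast
  define y0 where "y0 = Im z0"
  have y0: "y0 > 0" using z0(1) by (auto simp: y0_def intro: less_le_trans[of 0 "sqrt 3 / 2"])
  define F where "F = (\<lambda>z. f z / qpar z ^ n)"
  have q_hol: "qpar holomorphic_on S" for S unfolding qpar_def by (intro holomorphic_intros)
  have "F holomorphic_on upper_half_plane" unfolding F_def
    by (intro holomorphic_intros f q_hol) auto
  moreover have "F (z + of_int m) = F z" if "Im z > 0" for z m
  proof -
    have "qpar (z + of_int m) = qpar z" unfolding qpar_eq_iff by blast
    then show ?thesis using modular_weight_periodic[OF wt that] by (simp add: F_def)
  qed
  moreover have "norm (F z) \<le> B" if "Im z \<ge> 1" for z
    using B[OF that] by (simp add: F_def norm_divide norm_power divide_le_eq)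
  ultimately obtain h where h: "h holomorphic_on ball 0 1" "\<And>z. Im z > 0 \<Longrightarrow> F z = h (qpar z)"
    using bounded_periodic_factors_through_qpar by metis
  \<comment> \<open>The maximum principle is applied on the disc whose boundary circle corresponds
    to height t y0, below z0. As t approaches 1 the inequality becomes 4 pi n y0 <= k.\<close>
  have main: "4 * pi * n * y0 * t \<le> k" if t: "0 < t" "t < 1" for t :: real
  proof -
    define y where "y = t * y0"
    define r where "r = exp (- 2 * pi * y)"
    have y: "0 < y" "y < y0" using t y0 by (auto simp: y_def)
    have r: "0 < r" "r < 1" using y by (auto simp: r_def)
    define M where "M = sqrt (norm (f z0) ^ 2 * y0 ^ k / y ^ k) / r ^ n"
    have "norm (h (qpar z0)) \<le> M"
    proof (rule maximum_modulus_frontier[of h "cball 0 r"])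
      have sub: "cball 0 r \<subseteq> ball (0::complex) 1" "ball 0 r \<subseteq> ball (0::complex) 1" using r by auto
      show "h holomorphic_on interior (cball 0 r)"
        using holomorphic_on_subset[OF h(1) sub(2)] by simp
      show "continuous_on (closure (cball 0 r)) h"
        using continuous_on_subset[OF holomorphic_on_imp_continuous_on[OF h(1)] sub(1)] by simp
      show "bounded (cball (0::complex) r)" by simp
      show "qpar z0 \<in> cball 0 r" using y by (simp add: norm_qpar r_def y0_def)
      fix q :: complex assume "q \<in> frontier (cball 0 r)"
      then have q: "norm q = r" using r by (simp add: sphere_def)
      then have "q \<noteq> 0" using r by auto
      define z where "z = Ln q / (2 * of_real pi * \<i>)"
      have qz: "qpar z = q" unfolding z_def by (rule qpar_Ln[OF \<open>q \<noteq> 0\<close>])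
      then have "exp (- 2 * pi * Im z) = exp (- 2 * pi * y)" using q norm_qpar[of z] by (simp add: r_def)
      then have Imz: "Im z = y" by simp
      then have "norm (f z) ^ 2 * y ^ k \<le> norm (f z0) ^ 2 * y0 ^ k"
        using z0(3)[of z] y by (simp add: y0_def)
      then have "norm (f z) ^ 2 \<le> norm (f z0) ^ 2 * y0 ^ k / y ^ k"
        using y by (simp add: field_simps)
      then have "norm (f z) \<le> sqrt (norm (f z0) ^ 2 * y0 ^ k / y ^ k)"
        by (rule real_le_rsqrt)
      then have "norm (F z) \<le> M"
        using r by (simp add: F_def M_def norm_divide norm_power qz q divide_right_mono)
      then show "norm (h q) \<le> M" using h(2)[of z] Imz y qz by simp
    qed
    then have "norm (F z0) \<le> M" using h(2)[of z0] y0 by (simp add: y0_def)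
    then have "norm (F z0) ^ 2 \<le> M ^ 2" by (intro power_mono) auto
    moreover have "norm (F z0) ^ 2 = norm (f z0) ^ 2 / (exp (- 2 * pi * y0) ^ n) ^ 2"
      by (simp add: F_def norm_divide norm_power norm_qpar y0_def power_divide)
    moreover have "M ^ 2 = norm (f z0) ^ 2 * (y0 ^ k / y ^ k) / (r ^ n) ^ 2"
      using y y0 by (simp add: M_def power_divide)
    ultimately have "norm (f z0) ^ 2 * (1 / (exp (- 2 * pi * y0) ^ n) ^ 2) \<le>
        norm (f z0) ^ 2 * ((y0 / y) ^ k / (r ^ n) ^ 2)"
      by (simp add: power_divide)
    then have "1 / (exp (- 2 * pi * y0) ^ n) ^ 2 \<le> (y0 / y) ^ k / (r ^ n) ^ 2"
      using z0(2) by (subst (asm) mult_le_cancel_left_pos) auto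
    moreover have "C / A \<le> X" if "1 / A \<le> X / C" "C > 0" for A C X :: real
      using mult_left_mono[OF that(1), of C] that(2) by simp
    ultimately have "(r ^ n) ^ 2 / (exp (- 2 * pi * y0) ^ n) ^ 2 \<le> (y0 / y) ^ k"
      using r by simp
    moreover have "(r ^ n) ^ 2 / (exp (- 2 * pi * y0) ^ n) ^ 2 = exp (4 * pi * n * (y0 - y))"
      unfolding r_def exp_of_nat_mult[symmetric] exp_diff[symmetric] power_mult[symmetric]
      by (simp add: algebra_simps)
    moreover have "y0 / y = 1 / t" using y0 t by (simp add: y_def)
    ultimately have "exp (4 * pi * n * (y0 - y)) \<le> (1 / t) ^ k" by simp
    then have "4 * pi * n * (y0 - y) \<le> ln ((1 / t) ^ k)"
      using t by (subst ln_ge_iff) auto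
    also have "\<dots> = k * ln (1 / t)" using t by (subst ln_realpow) auto
    \<comment> \<open>The linear bound for the logarithm has the same factor 1 - t as the left side,
      where y0 - y = (1 - t) y0, so it cancels.\<close>
    also have "\<dots> \<le> k * (1 / t - 1)" using t by (intro mult_left_mono ln_le_minus_one) auto
    finally have "4 * pi * n * y0 * (1 - t) \<le> k * (1 - t) / t"
      using t by (simp add: y_def field_simps)
    then have "(4 * pi * n * y0 * t) * (1 - t) \<le> k * (1 - t)"
      using t by (simp add: field_simps)
    then show ?thesis using t by (subst (asm) mult_le_cancel_right_pos) auto
  qed
  \<comment> \<open>The height bound y0 >= sqrt(3)/2 is the source of the constant 2 pi
    sqrt(3).\<close>
  have "2 * pi * real n * sqrt 3 \<le> 4 * pi * n * y0"
    using z0(1) n by (simp add: y0_def)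
  then have "real k < 4 * pi * n * y0" using k by linarith
  then have "k / (4 * pi * n * y0) < 1" using y0 n by simp
  then obtain t where t: "k / (4 * pi * n * y0) < t" "t < 1" using dense by blast
  have "0 \<le> k / (4 * pi * n * y0)" using y0 by simp
  then have "0 < t" using t(1) by linarith
  from main[OF this t(2)] t(1) show False using y0 n by (simp add: field_simps)
qed

section \<open>The discriminant and the modular invariant\<close>

lemma divsum_series_holomorphic:
  obtains B where "B holomorphic_on ball 0 1" "B 0 = 1"
    "\<And>q. norm q < 1 \<Longrightarrow> (\<Sum>n. divsum k (Suc n) * q ^ Suc n) = q * B q"
proof -
  define B where "B = (\<lambda>q. \<Sum>n. divsum k (Suc n) * q ^ n)"
  have s: "summable (\<lambda>n. divsum k (Suc n) * q ^ n)" if "norm q < 1" for q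
  proof (cases "q = 0")
    case True
    then show ?thesis by (simp add: summable_0_powser)
  next
    case False
    have "summable (\<lambda>n. divsum k n * q ^ n)"
      using norm_divsum_le that by (rule summable_norm_cancel[OF summable_poly_growth])
    then have "summable (\<lambda>n. q * (divsum k (Suc n) * q ^ n))"
      by (subst (asm) summable_Suc_iff[symmetric]) (simp add: mult_ac)
    then show ?thesis using False by (simp add: summable_mult_D)
  qed
  have "B holomorphic_on ball 0 1"
    by (rule power_series_holomorphic[of _ _ "\<lambda>n. divsum k (Suc n)"])
      (use s in \<open>auto simp: B_def intro: summable_sums\<close>)
  moreover have "B 0 = 1" by (simp add: B_def divsum_def)
  moreover have "(\<Sum>n. divsum k (Suc n) * q ^ Suc n) = q * B q" if "norm q < 1" for q
    unfolding B_def suminf_mult[OF s[OF that], symmetric] by (simp add: mult_ac)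
  ultimately show ?thesis using that by blast
qed

text \<open>1728 times the cusp form of weight 12 with leading coefficient 1.\<close>

definition Delta :: "complex \<Rightarrow> complex" where
  "Delta z = E4 z ^ 3 - E6 z ^ 2"

lemma E4_Delta_q_expansion:
  obtains e u where "e holomorphic_on ball 0 1" "u holomorphic_on ball 0 1" "e 0 = 1" "u 0 = 1728"
    "\<And>z. Im z > 0 \<Longrightarrow> E4 z = e (qpar z)" "\<And>z. Im z > 0 \<Longrightarrow> Delta z = qpar z * u (qpar z)"
proof -
  obtain A where A: "A holomorphic_on ball 0 1" "A 0 = 1"
    "\<And>q. norm q < 1 \<Longrightarrow> (\<Sum>n. divsum 3 (Suc n) * q ^ Suc n) = q * A q"
    using divsum_series_holomorphic by blast
  obtain B where B: "B holomorphic_on ball 0 1" "B 0 = 1"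
    "\<And>q. norm q < 1 \<Longrightarrow> (\<Sum>n. divsum 5 (Suc n) * q ^ Suc n) = q * B q"
    using divsum_series_holomorphic by blast
  define e where "e = (\<lambda>q. 1 + 240 * (q * A q))"
  \<comment> \<open>Expand (1 + 240 q A)^3 - (1 - 504 q B)^2 and divide by q; the value 1728 at 0 is
    720 + 1008.\<close>
  define u where "u = (\<lambda>q. 720 * A q + 172800 * q * A q ^ 2 + 13824000 * q ^ 2 * A q ^ 3 + 1008 * B q - 254016 * q * B q ^ 2)"
  show ?thesis
  proof (rule that[of e u])
    show "e holomorphic_on ball 0 1" "u holomorphic_on ball 0 1"
      unfolding e_def u_def by (intro holomorphic_intros A B)+
    show "e 0 = 1" "u 0 = 1728" by (simp_all add: e_def u_def A B)
    fix z assume z: "Im z > 0"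
    show E4: "E4 z = e (qpar z)"
      using A(3)[OF norm_qpar_less_1[OF z]] by (simp add: E4_def e_def)
    have E6: "E6 z = 1 - 504 * (qpar z * B (qpar z))"
      using B(3)[OF norm_qpar_less_1[OF z]] by (simp add: E6_def)
    show "Delta z = qpar z * u (qpar z)"
      unfolding Delta_def E4 E6 e_def u_def by (simp add: algebra_simps power2_eq_square power3_eq_cube)
  qed
qed

lemma qpar_holomorphic_on [holomorphic_intros]:
  "f holomorphic_on S \<Longrightarrow> (\<lambda>z. qpar (f z)) holomorphic_on S"
  unfolding qpar_def by (intro holomorphic_intros)

lemma qpar_upper_half_plane: "qpar ` upper_half_plane \<subseteq> ball 0 1"
  using norm_qpar_less_1 by auto

lemma holomorphic_on_compose_qpar:
  assumes "h holomorphic_on ball 0 1"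
  shows "(\<lambda>z. h (qpar z)) holomorphic_on upper_half_plane"
  using holomorphic_on_compose_gen[OF qpar_holomorphic_on[OF holomorphic_on_ident] assms qpar_upper_half_plane]
  by (simp add: o_def)

lemma E4_holomorphic: "E4 holomorphic_on upper_half_plane"
  and Delta_holomorphic: "Delta holomorphic_on upper_half_plane"
proof -
  obtain e u where *: "e holomorphic_on ball 0 1" "u holomorphic_on ball 0 1" "e 0 = 1" "u 0 = 1728"
    "\<And>z. Im z > 0 \<Longrightarrow> E4 z = e (qpar z)" "\<And>z. Im z > 0 \<Longrightarrow> Delta z = qpar z * u (qpar z)"
    using E4_Delta_q_expansion by blast
  have "(\<lambda>z. e (qpar z)) holomorphic_on upper_half_plane"
    "(\<lambda>z. qpar z * u (qpar z)) holomorphic_on upper_half_plane"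
    by (intro holomorphic_intros holomorphic_on_compose_qpar *)+
  then show "E4 holomorphic_on upper_half_plane" "Delta holomorphic_on upper_half_plane"
    by (auto intro: holomorphic_transform simp: *)
qed

lemma E4_weight: "modular_weight 4 E4"
  unfolding modular_weight_def using E4_modular by blast

lemma Delta_weight: "modular_weight 12 Delta"
  unfolding modular_weight_def
proof (intro allI impI)
  fix a b c d :: int and z :: complex
  assume *: "0 < Im z" "a * d - b * c = 1"
  show "Delta ((of_int a * z + of_int b) / (of_int c * z + of_int d)) = (of_int c * z + of_int d) ^ 12 * Delta z"
    unfolding Delta_def E4_modular[OF *] E6_modular[OF *]
    by (simp add: power_mult_distrib right_diff_distrib flip: power_mult)
qed

section \<open>A differential equation for the discriminant\<close>

definition Delta' :: "complex \<Rightarrow> complex" where "Delta' = deriv Delta"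
definition Delta'' :: "complex \<Rightarrow> complex" where "Delta'' = deriv Delta'"

lemma Delta'_holomorphic: "Delta' holomorphic_on upper_half_plane"
  unfolding Delta'_def by (rule holomorphic_deriv[OF Delta_holomorphic open_upper_half_plane])

lemma Delta''_holomorphic: "Delta'' holomorphic_on upper_half_plane"
  unfolding Delta''_def by (rule holomorphic_deriv[OF Delta'_holomorphic open_upper_half_plane])

lemma Delta_has_derivative: "Im z > 0 \<Longrightarrow> (Delta has_field_derivative Delta' z) (at z)"
  unfolding Delta'_def
  by (rule holomorphic_derivI[OF Delta_holomorphic open_upper_half_plane]) simp

lemma Delta'_has_derivative: "Im z > 0 \<Longrightarrow> (Delta' has_field_derivative Delta'' z) (at z)"
  unfolding Delta''_def
  by (rule holomorphic_derivI[OF Delta'_holomorphic open_upper_half_plane]) simp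

lemma moebius_has_derivative:
  fixes a b c d :: int
  assumes "Im z > 0" "a * d - b * c = 1"
  shows "((\<lambda>z. (of_int a * z + of_int b) / (of_int c * z + of_int d)) has_field_derivative
    1 / (of_int c * z + of_int d) ^ 2) (at z)"
proof -
  have "(c, d) \<noteq> (0, 0)" using assms(2) by auto
  then have nz: "of_int c * z + of_int d \<noteq> 0"
    by (rule upper_half_plane_denominator_nonzero[OF assms(1)])
  have n: "of_int a * of_int d - of_int b * of_int c = (1::complex)"
    using assms(2) by (metis of_int_1 of_int_diff of_int_mult)
  have "((\<lambda>z. (of_int a * z + of_int b) / (of_int c * z + of_int d)) has_field_derivative
    ((of_int a * (of_int c * z + of_int d) - (of_int a * z + of_int b) * of_int c)) /
      ((of_int c * z + of_int d) * (of_int c * z + of_int d))) (at z)"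
    by (rule derivative_eq_intros refl nz | simp)+
  moreover have "of_int a * (of_int c * z + of_int d) - (of_int a * z + of_int b) * of_int c = 1"
    using n by (simp add: algebra_simps)
  ultimately show ?thesis by (simp add: power2_eq_square)
qed

text \<open>The Moebius map has derivative (cz + d)^(-2), so differentiating a transformation law
  costs two powers of cz + d. The right side \<open>g\<close> is arbitrary in order to cover also
  the law of \<open>Delta'\<close>, which has an extra term.\<close>

lemma modular_derivative:
  fixes a b c d :: int
  assumes z: "Im z > 0" and det: "a * d - b * c = 1"
    and f: "\<And>z. Im z > 0 \<Longrightarrow> (f has_field_derivative f' z) (at z)"
    and eq: "\<And>z. Im z > 0 \<Longrightarrow> f ((of_int a * z + of_int b) / (of_int c * z + of_int d)) = g z"
    and g: "(g has_field_derivative g') (at z)"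
  shows "f' ((of_int a * z + of_int b) / (of_int c * z + of_int d)) = (of_int c * z + of_int d) ^ 2 * g'"
proof -
  define w where "w = of_int c * z + of_int d"
  have "(c, d) \<noteq> (0, 0)" using det by auto
  then have nz: "w \<noteq> 0"
    unfolding w_def by (rule upper_half_plane_denominator_nonzero[OF z])
  have "((\<lambda>z. f ((of_int a * z + of_int b) / (of_int c * z + of_int d))) has_field_derivative
      f' ((of_int a * z + of_int b) / (of_int c * z + of_int d)) * (1 / w ^ 2)) (at z)"
    unfolding w_def
    by (rule DERIV_chain2[OF f[OF Im_moebius_pos[OF z det]] moebius_has_derivative[OF z det]]) simp
  then have "(g has_field_derivative
      f' ((of_int a * z + of_int b) / (of_int c * z + of_int d)) * (1 / w ^ 2)) (at z)"
    by (rule has_field_derivative_transform_within_open[OF _ open_upper_half_plane]) (use z eq in auto)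
  then have "g' = f' ((of_int a * z + of_int b) / (of_int c * z + of_int d)) * (1 / w ^ 2)"
    using g DERIV_unique by blast
  then show ?thesis using nz by (simp add: w_def)
qed

lemma Delta'_modular:
  fixes a b c d :: int
  assumes z: "Im z > 0" and det: "a * d - b * c = 1"
  defines "w \<equiv> of_int c * z + of_int d"
  shows "Delta' ((of_int a * z + of_int b) / w) = w ^ 14 * Delta' z + 12 * of_int c * w ^ 13 * Delta z"
proof -
  have "((\<lambda>z. (of_int c * z + of_int d) ^ 12 * Delta z) has_field_derivative
     12 * of_int c * w ^ 11 * Delta z + w ^ 12 * Delta' z) (at z)"
    unfolding w_def by (rule derivative_eq_intros Delta_has_derivative[OF z] refl | simp)+
  from modular_derivative[OF z det Delta_has_derivative modular_weightD[OF Delta_weight _ det] this]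
  have "Delta' ((of_int a * z + of_int b) / w) =
      w ^ 2 * (12 * of_int c * w ^ 11 * Delta z + w ^ 12 * Delta' z)"
    by (simp add: w_def)
  also have "\<dots> = w ^ 14 * Delta' z + 12 * of_int c * w ^ 13 * Delta z"
    by (simp add: algebra_simps power_numeral_reduce)
  finally show ?thesis .
qed

text \<open>Product rule applied to the law of \<open>Delta'\<close>: 26 = 14 + 12 and 156 = 12 *
  13.\<close>

lemma Delta''_modular:
  fixes a b c d :: int
  assumes z: "Im z > 0" and det: "a * d - b * c = 1"
  defines "w \<equiv> of_int c * z + of_int d"
  shows "Delta'' ((of_int a * z + of_int b) / w) =
    w ^ 16 * Delta'' z + 26 * of_int c * w ^ 15 * Delta' z + 156 * of_int c ^ 2 * w ^ 14 * Delta z"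
proof -
  have "((\<lambda>z. (of_int c * z + of_int d) ^ 14 * Delta' z + 12 * of_int c * (of_int c * z + of_int d) ^ 13 * Delta z) has_field_derivative
     14 * of_int c * w ^ 13 * Delta' z + w ^ 14 * Delta'' z + 
       (12 * of_int c * (13 * of_int c * w ^ 12) * Delta z + 12 * of_int c * w ^ 13 * Delta' z)) (at z)"
    unfolding w_def
    by (rule derivative_eq_intros Delta_has_derivative[OF z] Delta'_has_derivative[OF z] refl | simp)+
  from modular_derivative[OF z det Delta'_has_derivative Delta'_modular[OF _ det] this]
  have "Delta'' ((of_int a * z + of_int b) / w) = w ^ 2 * (14 * of_int c * w ^ 13 * Delta' z + w ^ 14 * Delta'' z + 
       (12 * of_int c * (13 * of_int c * w ^ 12) * Delta z + 12 * of_int c * w ^ 13 * Delta' z))"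
    by (simp add: w_def)
  also have "\<dots> = w ^ 16 * Delta'' z + 26 * of_int c * w ^ 15 * Delta' z + 156 * of_int c ^ 2 * w ^ 14 * Delta z"
    by (simp add: algebra_simps power_numeral_reduce)
  finally show ?thesis .
qed

text \<open>The second Rankin--Cohen bracket of \<open>Delta\<close> with itself, up to a factor.\<close>
definition Delta_bracket :: "complex \<Rightarrow> complex" where
  "Delta_bracket z = 12 * Delta z * Delta'' z - 13 * Delta' z ^ 2"

text \<open>The ratio 12 : 13 cancels every term containing c: 12 * 26 = 13 * 24 in the linear terms
  and 12 * 156 = 13 * 144 in the quadratic ones.\<close>

lemma Delta_bracket_weight: "modular_weight 28 Delta_bracket"
  unfolding modular_weight_def
proof (intro allI impI)
  fix a b c d :: int and z :: complex
  assume *: "0 < Im z" "a * d - b * c = 1"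
  define w where "w = of_int c * z + of_int d"
  define c' :: complex where "c' = of_int c"
  have "Delta_bracket ((of_int a * z + of_int b) / w) = 12 * (w ^ 12 * Delta z) * 
     (w ^ 16 * Delta'' z + 26 * c' * w ^ 15 * Delta' z + 156 * c' ^ 2 * w ^ 14 * Delta z) -
     13 * (w ^ 14 * Delta' z + 12 * c' * w ^ 13 * Delta z) ^ 2"
    unfolding Delta_bracket_def w_def c'_def
    by (simp only: Delta''_modular[OF *] Delta'_modular[OF *] modular_weightD[OF Delta_weight *])
  also have "\<dots> = w ^ 28 * Delta_bracket z"
    unfolding Delta_bracket_def by algebra
  finally show "Delta_bracket ((of_int a * z + of_int b) / (of_int c * z + of_int d)) =
    (of_int c * z + of_int d) ^ 28 * Delta_bracket z" by (simp add: w_def)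
qed

text \<open>Dividing by q removes the zero at the origin; the quotient is continuous on a compact
  disc and hence bounded.\<close>

lemma holomorphic_bound_at_zero:
  assumes "v holomorphic_on ball 0 1" "v 0 = 0" "r < 1"
  obtains C where "\<And>q. norm q \<le> r \<Longrightarrow> norm (v q) \<le> C * norm q"
proof -
  define h where "h = (\<lambda>z. if z = 0 then deriv v 0 else (v z - v 0) / (z - 0))"
  have "h holomorphic_on ball 0 1" unfolding h_def
    by (rule pole_lemma[OF assms(1)]) auto
  then have "continuous_on (cball 0 r) h"
    using assms(3) by (intro holomorphic_on_imp_continuous_on) (rule holomorphic_on_subset, auto)
  then have "bounded (h ` cball 0 r)"
    by (intro compact_imp_bounded compact_continuous_image compact_cball)
  then obtain C where C: "\<And>q. norm q \<le> r \<Longrightarrow> norm (h q) \<le> C"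
    by (force simp: bounded_iff)
  have "norm (v q) \<le> C * norm q" if "norm q \<le> r" for q
  proof -
    have "v q = h q * q" using assms(2) by (simp add: h_def)
    then show ?thesis using C[OF that] by (simp add: norm_mult mult_right_mono)
  qed
  then show ?thesis by (rule that)
qed

text \<open>d/dz acts as 2 pi i q d/dq. One factor q is kept outside so that the result has the
  shape of the hypothesis and the lemma can be applied twice.\<close>

lemma q_expansion_derivative:
  assumes "u holomorphic_on ball 0 1" "\<And>z. Im z > 0 \<Longrightarrow> f z = qpar z * u (qpar z)"
    and "(f has_field_derivative f') (at z)" "Im z > 0"
  shows "f' = qpar z * (2 * of_real pi * \<i> * (u (qpar z) + qpar z * deriv u (qpar z)))"
proof -
  define q where "q = qpar z"
  have q: "qpar z \<in> ball 0 1" using norm_qpar_less_1[OF assms(4)] by simp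
  have u: "(u has_field_derivative deriv u (qpar z)) (at (qpar z))"
    by (rule holomorphic_derivI[OF assms(1) open_ball q])
  have dq: "(qpar has_field_derivative 2 * of_real pi * \<i> * q) (at z)"
    unfolding q_def by (rule derivative_eq_intros refl | simp)+
  have "((\<lambda>z. qpar z * u (qpar z)) has_field_derivative
      (2 * of_real pi * \<i> * q) * u q + (deriv u q * (2 * of_real pi * \<i> * q)) * q) (at z)"
    unfolding q_def
    by (rule DERIV_mult[OF dq[unfolded q_def] DERIV_chain2[OF u dq[unfolded q_def]]])
  moreover have "((\<lambda>z. qpar z * u (qpar z)) has_field_derivative f') (at z)"
    by (rule has_field_derivative_transform_within_open[OF assms(3) open_upper_half_plane])
      (use assms in auto)
  ultimately have "f' = (2 * of_real pi * \<i> * q) * u q + (deriv u q * (2 * of_real pi * \<i> * q)) * q"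
    by (rule DERIV_unique[symmetric])
  then show ?thesis by (simp add: q_def algebra_simps)
qed

text \<open>A form of weight 28 with a double zero at the cusp should be Delta^2 times a form of
  weight 4, hence a multiple of E4 Delta^2. Matching the q^2 terms makes the difference vanish to
  order 3, and the vanishing criterion applies.\<close>

lemma Delta_bracket_eq:
  assumes "Im z > 0"
  shows "Delta_bracket z = 4 * of_real pi ^ 2 * E4 z * Delta z ^ 2"
proof -
  obtain e u where eu: "e holomorphic_on ball 0 1" "u holomorphic_on ball 0 1" "e 0 = 1" "u 0 = 1728"
    "\<And>z. Im z > 0 \<Longrightarrow> E4 z = e (qpar z)" "\<And>z. Im z > 0 \<Longrightarrow> Delta z = qpar z * u (qpar z)"
    using E4_Delta_q_expansion by blast
  define u1 where "u1 = (\<lambda>q. 2 * of_real pi * \<i> * (u q + q * deriv u q))"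
  define u2 where "u2 = (\<lambda>q. 2 * of_real pi * \<i> * (u1 q + q * deriv u1 q))"
  have u1: "u1 holomorphic_on ball 0 1" unfolding u1_def
    by (intro holomorphic_intros holomorphic_deriv eu) auto
  have u2: "u2 holomorphic_on ball 0 1" unfolding u2_def
    by (intro holomorphic_intros holomorphic_deriv u1) auto
  have D1: "Delta' z = qpar z * u1 (qpar z)" if "Im z > 0" for z
    unfolding u1_def by (rule q_expansion_derivative[OF eu(2,6) Delta_has_derivative[OF that] that])
  have D2: "Delta'' z = qpar z * u2 (qpar z)" if "Im z > 0" for z
    unfolding u2_def by (rule q_expansion_derivative[OF u1 D1 Delta'_has_derivative[OF that] that])
  define v where "v = (\<lambda>q. 12 * u q * u2 q - 13 * u1 q ^ 2 - 4 * of_real pi ^ 2 * e q * u q ^ 2)"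
  have v: "v holomorphic_on ball 0 1" unfolding v_def
    by (intro holomorphic_intros eu u1 u2)
  \<comment> \<open>At q = 0 each derivative multiplies by s = 2 pi i, so the bracket contributes
    (12 - 13) s^2 = 4 pi^2 times u(0)^2; this fixes the constant.\<close>
  have v0: "v 0 = 0"
    by (simp add: v_def u2_def u1_def eu power2_eq_square algebra_simps)
  define G where "G = (\<lambda>z. Delta_bracket z - 4 * of_real pi ^ 2 * E4 z * Delta z ^ 2)"
  have Gv: "G z = qpar z ^ 2 * v (qpar z)" if "Im z > 0" for z
    unfolding G_def Delta_bracket_def v_def D1[OF that] D2[OF that] eu(5,6)[OF that]
    by (simp add: algebra_simps power2_eq_square)
  have Ghol: "G holomorphic_on upper_half_plane"
    unfolding G_def Delta_bracket_def
    by (intro holomorphic_intros Delta_holomorphic Delta'_holomorphic Delta''_holomorphic E4_holomorphic)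
  have Gwt: "modular_weight 28 G"
    unfolding modular_weight_def G_def
  proof (intro allI impI)
    fix a b c d :: int and z :: complex
    assume *: "0 < Im z" "a * d - b * c = 1"
    show "Delta_bracket ((of_int a * z + of_int b) / (of_int c * z + of_int d)) -
        4 * of_real pi ^ 2 * E4 ((of_int a * z + of_int b) / (of_int c * z + of_int d)) *
          Delta ((of_int a * z + of_int b) / (of_int c * z + of_int d)) ^ 2 =
        (of_int c * z + of_int d) ^ 28 * (Delta_bracket z - 4 * of_real pi ^ 2 * E4 z * Delta z ^ 2)"
      unfolding modular_weightD[OF Delta_bracket_weight *] modular_weightD[OF Delta_weight *]
        modular_weightD[OF E4_weight *]
      by (simp add: algebra_simps power_mult_distrib flip: power_mult power_add)
  qed
  obtain C where C: "\<And>q. norm q \<le> exp (- 2 * pi) \<Longrightarrow> norm (v q) \<le> C * norm q"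
    using holomorphic_bound_at_zero[OF v v0, of "exp (- 2 * pi)"] by auto
  have bound: "norm (G z) \<le> C * norm (qpar z) ^ 3" if "Im z \<ge> 1" for z
  proof -
    have "norm (qpar z) \<le> exp (- 2 * pi)" using that by (simp add: norm_qpar)
    from C[OF this] have "norm (qpar z) ^ 2 * norm (v (qpar z)) \<le> norm (qpar z) ^ 2 * (C * norm (qpar z))"
      by (intro mult_left_mono) auto
    then show ?thesis
      using Gv[of z] that by (simp add: norm_mult norm_power power3_eq_cube power2_eq_square mult_ac)
  qed
  \<comment> \<open>These rough bounds for sqrt 3 and pi already push 2 pi 3 sqrt(3) above
    30.6.\<close>
  have "17 / 10 < sqrt 3" by (rule real_less_rsqrt) (simp add: power2_eq_square)
  then have "3 * (17 / 10) < pi * sqrt 3" using pi_gt3 by (intro mult_strict_mono) auto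
  then have "real 28 < 2 * pi * real 3 * sqrt 3" by simp
  from modular_weight_vanishing[OF Ghol Gwt _ bound this assms] show ?thesis
    by (simp add: G_def)
qed

text \<open>Near the cusp \<open>Delta\<close> is close to 1728 q. This excludes zeros of infinite
  order in the argument that follows.\<close>

lemma Delta_not_identically_zero: "\<exists>z. Im z > 0 \<and> Delta z \<noteq> 0"
proof -
  obtain e u where eu: "u holomorphic_on ball 0 1" "u 0 = (1728 :: complex)"
    "\<And>z. Im z > 0 \<Longrightarrow> Delta z = qpar z * u (qpar z)"
    using E4_Delta_q_expansion by metis
  have "isCont u 0"
    using eu(1) holomorphic_on_imp_continuous_on continuous_on_interior by fastforce
  then obtain r where r: "r > 0" "\<And>q. norm q < r \<Longrightarrow> u q \<noteq> 0"
    using continuous_at_avoid[of 0 u 0] eu(2) by (auto simp: dist_norm)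
  define p :: complex where "p = of_real (min r 1 / 2)"
  have p: "p \<noteq> 0" "norm p < r" "norm p < 1" using r(1) by (auto simp: p_def)
  define z where "z = Ln p / (2 * of_real pi * \<i>)"
  have qz: "qpar z = p" unfolding z_def by (rule qpar_Ln[OF p(1)])
  have "Im z > 0" using p(3) qz by (intro Im_pos_if_norm_qpar_less_1) simp
  then show ?thesis using eu(3)[of z] r(2)[OF p(2)] p(1) qz by auto
qed

text \<open>The operator (w - \<xi>) d/dw keeps the exponent n, where d/dw alone would produce n -
  1; derivatives near a zero are therefore taken in this form.\<close>

lemma zero_order_derivative:
  assumes "\<And>w. w \<in> ball \<xi> r \<Longrightarrow> f w = (w - \<xi>) ^ n * g w"
    and "(f has_field_derivative f') (at w)" "(g has_field_derivative g') (at w)" "w \<in> ball \<xi> r"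
  shows "(w - \<xi>) * f' = (w - \<xi>) ^ n * (of_nat n * g w + (w - \<xi>) * g')"
proof -
  have "((\<lambda>w. (w - \<xi>) ^ n * g w) has_field_derivative f') (at w)"
    by (rule has_field_derivative_transform_within_open[OF assms(2) open_ball assms(4)]) (use assms(1) in auto)
  moreover have "((\<lambda>w. (w - \<xi>) ^ n * g w) has_field_derivative
      of_nat n * (w - \<xi>) ^ (n - 1) * g w + (w - \<xi>) ^ n * g') (at w)"
    by (rule derivative_eq_intros assms(3) refl | simp)+
  ultimately have "f' = of_nat n * (w - \<xi>) ^ (n - 1) * g w + (w - \<xi>) ^ n * g'"
    by (rule DERIV_unique)
  moreover have "s * (of_nat n * s ^ (n - 1) * g w + s ^ n * g') = s ^ n * (of_nat n * g w + s * g')" for s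
    by (cases n) (simp_all add: algebra_simps)
  ultimately show ?thesis by simp
qed

text \<open>
  If \<open>Delta\<close> had a zero of order \<open>n > 0\<close>, its bracket would have order \<open>2 * n - 2\<close> there,
  but by the previous identity the order is at least \<open>2 * n\<close>.
\<close>
lemma Delta_nonzero:
  assumes "Im \<xi> > 0"
  shows "Delta \<xi> \<noteq> 0"
proof
  assume 0: "Delta \<xi> = 0"
  have "\<not> Delta constant_on upper_half_plane"
    using Delta_not_identically_zero 0 assms by (auto simp: constant_on_def) metis
  moreover have "connected upper_half_plane"
    by (intro convex_connected convex_halfspace_Im_gt)
  ultimately obtain g r n where g: "0 < n" "0 < r" "ball \<xi> r \<subseteq> upper_half_plane" "g holomorphic_on ball \<xi> r"
    "\<And>w. w \<in> ball \<xi> r \<Longrightarrow> Delta w = (w - \<xi>) ^ n * g w" "\<And>w. w \<in> ball \<xi> r \<Longrightarrow> g w \<noteq> 0"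
    using holomorphic_factor_zero_nonconstant[OF Delta_holomorphic open_upper_half_plane] assms 0
    by (metis mem_Collect_eq)
  define g1 where "g1 = (\<lambda>w. of_nat n * g w + (w - \<xi>) * deriv g w)"
  have g1: "g1 holomorphic_on ball \<xi> r" unfolding g1_def
    by (intro holomorphic_intros holomorphic_deriv g) auto
  define g2 where "g2 = (\<lambda>w. of_nat n * g1 w + (w - \<xi>) * deriv g1 w)"
  have g2: "g2 holomorphic_on ball \<xi> r" unfolding g2_def
    by (intro holomorphic_intros holomorphic_deriv g1) auto
  have H: "Im w > 0" if "w \<in> ball \<xi> r" for w using g(3) that by auto
  have D1: "(w - \<xi>) * Delta' w = (w - \<xi>) ^ n * g1 w" if "w \<in> ball \<xi> r" for w
    unfolding g1_def
    by (rule zero_order_derivative[OF g(5) Delta_has_derivative[OF H[OF that]]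
          holomorphic_derivI[OF g(4) open_ball that] that])
  \<comment> \<open>With s = w - \<xi>, applying s d/dw twice gives s Delta' + s^2 Delta'', whence
    the difference \<open>g2 w - g1 w\<close>.\<close>
  have D2: "(w - \<xi>) ^ 2 * Delta'' w = (w - \<xi>) ^ n * (g2 w - g1 w)" if "w \<in> ball \<xi> r" for w
  proof -
    have "((\<lambda>w. (w - \<xi>) * Delta' w) has_field_derivative Delta' w + (w - \<xi>) * Delta'' w) (at w)"
      by (rule derivative_eq_intros Delta'_has_derivative[OF H[OF that]] refl | simp)+
    from zero_order_derivative[OF D1 this holomorphic_derivI[OF g1 open_ball that] that]
    have "(w - \<xi>) * (Delta' w + (w - \<xi>) * Delta'' w) = (w - \<xi>) ^ n * g2 w"
      by (simp add: g2_def)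
    then show ?thesis using D1[OF that] by (simp add: algebra_simps power2_eq_square)
  qed
  \<comment> \<open>The differential equation multiplied by s^2 and divided by s^(2n), s = w -
    \<xi>. In this form it extends to \<open>\<xi>\<close> by continuity.\<close>
  define R where "R = (\<lambda>w. 12 * g w * (g2 w - g1 w) - 13 * g1 w ^ 2 -
      (w - \<xi>) ^ 2 * (4 * of_real pi ^ 2 * E4 w * g w ^ 2))"
  have R0: "R w = 0" if "w \<in> ball \<xi> r - {\<xi>}" for w
  proof -
    have w: "w \<in> ball \<xi> r" using that by auto
    define s where "s = w - \<xi>"
    have "s \<noteq> 0" using that by (simp add: s_def)
    have "s ^ 2 * (12 * Delta w * Delta'' w - 13 * Delta' w ^ 2) = s ^ 2 * (4 * of_real pi ^ 2 * E4 w * Delta w ^ 2)"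
      using Delta_bracket_eq[OF H[OF w]] by (simp add: Delta_bracket_def)
    then have "12 * Delta w * (s ^ 2 * Delta'' w) - 13 * (s * Delta' w) ^ 2 = s ^ 2 * (4 * of_real pi ^ 2 * E4 w * Delta w ^ 2)"
      by (simp add: algebra_simps power_mult_distrib)
    then have "12 * (s ^ n * g w) * (s ^ n * (g2 w - g1 w)) - 13 * (s ^ n * g1 w) ^ 2 -
        s ^ 2 * (4 * of_real pi ^ 2 * E4 w * (s ^ n * g w) ^ 2) = 0"
      using D1[OF w] D2[OF w] g(5)[OF w] by (simp add: s_def)
    moreover have "12 * (s ^ n * g w) * (s ^ n * (g2 w - g1 w)) - 13 * (s ^ n * g1 w) ^ 2 -
        s ^ 2 * (4 * of_real pi ^ 2 * E4 w * (s ^ n * g w) ^ 2) = (s ^ n) ^ 2 * R w"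
      unfolding R_def s_def[symmetric] by (simp add: algebra_simps power2_eq_square)
    ultimately show ?thesis using \<open>s \<noteq> 0\<close> by simp
  qed
  have "continuous_on (ball \<xi> r) R" unfolding R_def
    by (intro holomorphic_on_imp_continuous_on holomorphic_intros g g1 g2
        holomorphic_on_subset[OF E4_holomorphic])
  then have "isCont R \<xi>" using g(2) by (simp add: continuous_on_eq_continuous_at)
  then have lim: "R \<midarrow>\<xi>\<rightarrow> R \<xi>" by (simp add: isCont_def)
  have "eventually (\<lambda>w. w \<in> ball \<xi> r - {\<xi>}) (at \<xi>)"
    using g(2) by (intro eventually_at_in_open) auto
  then have "eventually (\<lambda>w. 0 = R w) (at \<xi>)"
    by eventually_elim (use R0 in simp)
  then have "R \<midarrow>\<xi>\<rightarrow> 0" by (rule Lim_transform_eventually[OF tendsto_const])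
  with lim have "R \<xi> = 0" using LIM_unique by blast
  \<comment> \<open>At the zero \<open>g1\<close> equals n g and \<open>g2\<close> equals n^2 g, so
    the coefficient of g^2 is 12 (n^2 - n) - 13 n^2 = -(n^2 + 12 n), which is negative for n >
    0.\<close>
  moreover have "R \<xi> = (of_nat n ^ 2 + 12 * of_nat n) * (- (g \<xi> ^ 2))"
    by (simp add: R_def g2_def g1_def algebra_simps power2_eq_square)
  moreover have "(of_nat n ^ 2 + 12 * of_nat n :: complex) \<noteq> 0"
  proof -
    have "(of_nat n ^ 2 + 12 * of_nat n :: complex) = of_nat (n ^ 2 + 12 * n)" by simp
    then show ?thesis using g(1) by (simp only: of_nat_eq_0_iff)
  qed
  ultimately have "- (g \<xi> ^ 2) = 0" by (metis mult_eq_0_iff)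
  then show False using g(6)[of \<xi>] g(2) by simp
qed

section \<open>The modular invariant and its pole at the cusp\<close>

lemma jfun_eq: "jfun z = 1728 * E4 z ^ 3 / Delta z"
  by (simp add: jfun_def Delta_def)

lemma jfun_holomorphic: "jfun holomorphic_on upper_half_plane"
  unfolding jfun_eq[abs_def]
  by (intro holomorphic_intros E4_holomorphic Delta_holomorphic) (auto simp: Delta_nonzero)

lemma jfun_modular:
  fixes a b c d :: int
  assumes "Im z > 0" "a * d - b * c = 1"
  shows "jfun ((of_int a * z + of_int b) / (of_int c * z + of_int d)) = jfun z"
proof -
  have "(c, d) \<noteq> (0, 0)" using assms(2) by auto
  then have "of_int c * z + of_int d \<noteq> 0"
    by (rule upper_half_plane_denominator_nonzero[OF assms(1)])
  then show ?thesis
    unfolding jfun_eq modular_weightD[OF Delta_weight assms] modular_weightD[OF E4_weight assms]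
    by (simp add: power_mult_distrib flip: power_mult)
qed

text \<open>\<open>Delta\<close> has no zeros on the half plane and Delta / q tends to 1728 at the
  cusp, so the denominator \<open>u\<close> is nonzero on the whole disc. \<open>J 0 = 1\<close>
  expresses that j has a simple pole in q with leading coefficient 1.\<close>

lemma jfun_q_expansion:
  obtains J where "J holomorphic_on ball 0 1" "J 0 = 1"
    "\<And>z. Im z > 0 \<Longrightarrow> jfun z * qpar z = J (qpar z)"
proof -
  obtain e u where eu: "e holomorphic_on ball 0 1" "u holomorphic_on ball 0 1" "e 0 = 1" "u 0 = 1728"
    "\<And>z. Im z > 0 \<Longrightarrow> E4 z = e (qpar z)" "\<And>z. Im z > 0 \<Longrightarrow> Delta z = qpar z * u (qpar z)"
    using E4_Delta_q_expansion by blast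
  have nz: "u q \<noteq> 0" if "q \<in> ball 0 1" for q
  proof (cases "q = 0")
    case False
    define z where "z = Ln q / (2 * of_real pi * \<i>)"
    have qz: "qpar z = q" unfolding z_def by (rule qpar_Ln[OF False])
    then have "Im z > 0" using that by (intro Im_pos_if_norm_qpar_less_1) simp
    then show ?thesis using Delta_nonzero eu(6) qz by auto
  qed (simp add: eu)
  show ?thesis
  proof (rule that[of "\<lambda>q. 1728 * e q ^ 3 / u q"])
    show "(\<lambda>q. 1728 * e q ^ 3 / u q) holomorphic_on ball 0 1"
      by (intro holomorphic_intros eu nz)
    show "1728 * e 0 ^ 3 / u 0 = 1" by (simp add: eu)
    show "jfun z * qpar z = 1728 * e (qpar z) ^ 3 / u (qpar z)" if "Im z > 0" for z
      unfolding jfun_eq eu(5,6)[OF that] by simp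
  qed
qed

section \<open>Modular functions as polynomials in the modular invariant\<close>

lemma modular_weight_0_jfun: "modular_weight 0 jfun"
  unfolding modular_weight_def using jfun_modular by simp

text \<open>Induction on a bound for the pole order at the cusp: subtracting a multiple of j^(n+1)
  lowers it by one. When no pole is left, subtracting the value at the cusp leaves a function of
  weight 0 that vanishes there, and the vanishing criterion applies with k = 0.\<close>

lemma modular_function_is_polynomial_in_jfun:
  assumes "h holomorphic_on upper_half_plane" "modular_weight 0 h"
    and "\<And>z. Im z \<ge> 1 \<Longrightarrow> norm (h z * qpar z ^ n) \<le> B"
  shows "\<exists>p. \<forall>z. Im z > 0 \<longrightarrow> h z = poly p (jfun z)"
  using assms
proof (induction n arbitrary: h B)
  case (0 h)
  obtain H where H: "H holomorphic_on ball 0 1" "\<And>z. Im z > 0 \<Longrightarrow> h z = H (qpar z)"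
    using bounded_periodic_factors_through_qpar[OF 0(1) modular_weight_periodic[OF 0(2)], of B] 0(3) by auto
  have "(\<lambda>q. H q - H 0) holomorphic_on ball 0 1" by (intro holomorphic_intros H)
  then obtain C where C: "\<And>q. norm q \<le> exp (- 2 * pi) \<Longrightarrow> norm (H q - H 0) \<le> C * norm q"
    using holomorphic_bound_at_zero[of "\<lambda>q. H q - H 0" "exp (- 2 * pi)"] by auto
  have "h z - H 0 = 0" if "Im z > 0" for z
  proof (rule modular_weight_vanishing[of "\<lambda>z. h z - H 0" 0 1 C])
    show "(\<lambda>z. h z - H 0) holomorphic_on upper_half_plane" by (intro holomorphic_intros 0)
    show "modular_weight 0 (\<lambda>z. h z - H 0)" using 0(2) unfolding modular_weight_def by simp
    show "norm (h z - H 0) \<le> C * norm (qpar z) ^ 1" if "Im z \<ge> 1" for z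
      using C[of "qpar z"] H(2)[of z] that by (simp add: norm_qpar)
  qed (use that in auto)
  then show ?case by (intro exI[of _ "[:H 0:]"]) auto
next
  case (Suc n h)
  obtain J where J: "J holomorphic_on ball 0 1" "J 0 = 1" "\<And>z. Im z > 0 \<Longrightarrow> jfun z * qpar z = J (qpar z)"
    using jfun_q_expansion by blast
  define F where "F = (\<lambda>z. h z * qpar z ^ Suc n)"
  have F_hol: "F holomorphic_on upper_half_plane" unfolding F_def by (intro holomorphic_intros Suc.prems)
  have F_per: "F (z + of_int m) = F z" if "Im z > 0" for z m
  proof -
    have "qpar (z + of_int m) = qpar z" unfolding qpar_eq_iff by blast
    then show ?thesis using modular_weight_periodic[OF Suc.prems(2) that] by (simp add: F_def)
  qed
  have F_bound: "norm (F z) \<le> B" if "Im z \<ge> 1" for z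
    using Suc.prems(3)[OF that] by (simp add: F_def)
  obtain H where H: "H holomorphic_on ball 0 1" "\<And>z. Im z > 0 \<Longrightarrow> F z = H (qpar z)"
    using bounded_periodic_factors_through_qpar[OF F_hol F_per F_bound] by blast
  define h2 where "h2 = (\<lambda>z. h z - H 0 * jfun z ^ Suc n)"
  define v where "v = (\<lambda>q. H q - H 0 * J q ^ Suc n)"
  have v: "v holomorphic_on ball 0 1" "v 0 = 0"
    unfolding v_def by (intro holomorphic_intros H J) (simp add: J)
  obtain C where C: "\<And>q. norm q \<le> exp (- 2 * pi) \<Longrightarrow> norm (v q) \<le> C * norm q"
    using holomorphic_bound_at_zero[OF v, of "exp (- 2 * pi)"] by auto
  have "\<exists>p. \<forall>z. Im z > 0 \<longrightarrow> h2 z = poly p (jfun z)"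
  proof (rule Suc.IH)
    show "h2 holomorphic_on upper_half_plane" unfolding h2_def
      by (intro holomorphic_intros Suc.prems jfun_holomorphic)
    show "modular_weight 0 h2"
      using Suc.prems(2) modular_weight_0_jfun unfolding modular_weight_def h2_def by simp
    show "norm (h2 z * qpar z ^ n) \<le> C" if "Im z \<ge> 1" for z
    proof -
      have z: "Im z > 0" using that by simp
      have "h2 z * qpar z ^ n * qpar z = F z - H 0 * (jfun z * qpar z) ^ Suc n"
        unfolding h2_def F_def power_mult_distrib by (simp add: algebra_simps)
      also have "\<dots> = v (qpar z)" unfolding v_def H(2)[OF z] J(3)[OF z] ..
      finally have "norm (h2 z * qpar z ^ n) * norm (qpar z) = norm (v (qpar z))"
        by (metis norm_mult)
      also have "\<dots> \<le> C * norm (qpar z)"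
        using C[of "qpar z"] that by (simp add: norm_qpar)
      finally show ?thesis by (subst (asm) mult_le_cancel_right_pos) auto
    qed
  qed
  then obtain p where p: "\<And>z. Im z > 0 \<Longrightarrow> h2 z = poly p (jfun z)" by blast
  show ?case
    by (intro exI[of _ "p + monom (H 0) (Suc n)"])
      (auto simp: p[symmetric] poly_monom h2_def)
qed

lemma jfun_times_qpar_tendsto:
  assumes "filterlim (\<lambda>y. Im (f y)) at_top F"
  shows "((\<lambda>y. jfun (f y) * qpar (f y)) \<longlongrightarrow> 1) F"
proof -
  obtain J where J: "J holomorphic_on ball 0 1" "J 0 = 1" "\<And>z. Im z > 0 \<Longrightarrow> jfun z * qpar z = J (qpar z)"
    using jfun_q_expansion by blast
  have "((\<lambda>y. exp (- (2 * pi * Im (f y)))) \<longlongrightarrow> 0) F"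
    by (intro filterlim_compose[OF exp_at_bot] filterlim_compose[OF filterlim_uminus_at_bot_at_top]
        filterlim_tendsto_pos_mult_at_top[OF tendsto_const _ assms]) auto
  then have "((\<lambda>y. norm (qpar (f y))) \<longlongrightarrow> 0) F" by (simp add: norm_qpar)
  then have q: "((\<lambda>y. qpar (f y)) \<longlongrightarrow> 0) F" by (rule tendsto_norm_zero_cancel)
  have "isCont J 0"
    using holomorphic_on_imp_continuous_on[OF J(1)] by (simp add: continuous_on_eq_continuous_at)
  then have "((\<lambda>y. J (qpar (f y))) \<longlongrightarrow> J 0) F" by (rule isCont_tendsto_compose[OF _ q])
  moreover have "eventually (\<lambda>y. Im (f y) > 0) F"
    using assms by (simp add: filterlim_at_top_dense)
  then have "eventually (\<lambda>y. J (qpar (f y)) = jfun (f y) * qpar (f y)) F"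
    by eventually_elim (simp add: J)
  ultimately show ?thesis unfolding J(2) by (rule Lim_transform_eventually)
qed

section \<open>Primitive matrices of determinant N\<close>

text \<open>\<open>(a, b, d)\<close> stands for the upper triangular matrix with rows \<open>(a, b)\<close> and \<open>(0, d)\<close>; these matrices
  represent the orbits of \<open>SL\<^sub>2(\<int>)\<close> on the primitive integer matrices of determinant \<open>N\<close>.\<close>
definition hecke_reps :: "nat \<Rightarrow> (nat \<times> nat \<times> nat) set" where
  "hecke_reps N = {(a, b, d). a * d = N \<and> b < d \<and> gcd (gcd a b) d = 1}"

definition jrep :: "nat \<times> nat \<times> nat \<Rightarrow> complex \<Rightarrow> complex" where
  "jrep \<sigma> z = (case \<sigma> of (a, b, d) \<Rightarrow> jfun ((of_nat a * z + of_nat b) / of_nat d))"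

lemma finite_hecke_reps:
  assumes "N > 0"
  shows "finite (hecke_reps N)"
proof (rule finite_subset)
  show "hecke_reps N \<subseteq> {..N} \<times> {..N} \<times> {..N}"
  proof (rule subsetI)
    fix \<sigma> assume "\<sigma> \<in> hecke_reps N"
    moreover obtain a b d where \<sigma>: "\<sigma> = (a, b, d)" by (cases \<sigma>) auto
    ultimately have "a dvd N" "d dvd N" "b < d" by (auto simp: hecke_reps_def)
    moreover from this have "a \<le> N" "d \<le> N" using assms by (auto intro: dvd_imp_le)
    ultimately show "\<sigma> \<in> {..N} \<times> {..N} \<times> {..N}" by (simp add: \<sigma>)
  qed
qed auto

lemma hecke_repsD:
  assumes "(a, b, d) \<in> hecke_reps N" "N > 0"
  shows "a > 0" "d > 0" "a * d = N" "b < d"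
  using assms by (auto simp: hecke_reps_def intro: Nat.gr0I)

text \<open>Hermite normal form under left multiplication by SL2(Z). The gcd of the left column
  becomes a, Bezout coefficients clear the entry below it, and b is reduced modulo d. A common
  divisor of a, b, d would divide the whole matrix.\<close>

lemma primitive_matrix_normal_form:
  fixes p q r s :: int
  assumes det: "p * s - q * r = int N" and N: "N > 0"
    and prim: "\<And>e. e dvd p \<Longrightarrow> e dvd q \<Longrightarrow> e dvd r \<Longrightarrow> e dvd s \<Longrightarrow> is_unit e"
  obtains a b d \<alpha> \<beta> \<gamma> \<delta> where "(a, b, d) \<in> hecke_reps N" "\<alpha> * \<delta> - \<beta> * \<gamma> = 1"
    "p = \<alpha> * int a" "q = \<alpha> * int b + \<beta> * int d" "r = \<gamma> * int a" "s = \<gamma> * int b + \<delta> * int d"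
proof -
  define a where "a = gcd p r"
  have "p \<noteq> 0 \<or> r \<noteq> 0" using det N by auto
  then have a: "a > 0" by (auto simp: a_def)
  obtain \<alpha> \<gamma> where pr: "p = a * \<alpha>" "r = a * \<gamma>"
    unfolding a_def by (meson dvdE gcd_dvd1 gcd_dvd2)
  have "coprime \<alpha> \<gamma>"
  proof -
    have "gcd (a * \<alpha>) (a * \<gamma>) = a" unfolding pr[symmetric] by (simp only: a_def)
    then have "a * gcd \<alpha> \<gamma> = a * 1" using a gcd_mult_distrib_int[of a \<alpha> \<gamma>] by simp
    then show ?thesis using a by (simp add: coprime_iff_gcd_eq_1)
  qed
  then obtain u v where uv: "u * \<alpha> + v * \<gamma> = 1"
    using bezout_int[of \<alpha> \<gamma>] by (auto simp: coprime_iff_gcd_eq_1)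
  define d where "d = \<alpha> * s - \<gamma> * q"
  have ad: "a * d = int N" using det by (simp add: d_def pr algebra_simps)
  have d: "d > 0" using ad a N by (metis of_nat_0_less_iff zero_less_mult_pos)
  define b0 where "b0 = u * q + v * s"
  define b t where "b = b0 mod d" and "t = b0 div d"
  have b: "0 \<le> b" "b < d" using d by (auto simp: b_def)
  have b0: "b0 = b + t * d" by (simp add: b_def t_def)
  \<comment> \<open>Replacing \<open>b0\<close> by its remainder is compensated by adding
    \<open>t\<close> times the left column of the unimodular factor to its right column.\<close>
  define \<beta> \<delta> where "\<beta> = \<alpha> * t - v" and "\<delta> = \<gamma> * t + u"
  have det': "\<alpha> * \<delta> - \<beta> * \<gamma> = 1" using uv by (simp add: \<beta>_def \<delta>_def algebra_simps)
  have "\<alpha> * b + \<beta> * d = \<alpha> * b0 - v * d" by (simp add: \<beta>_def b0 algebra_simps)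
  also have "\<dots> = q * (u * \<alpha> + v * \<gamma>)" by (simp add: b0_def d_def algebra_simps)
  finally have q: "q = \<alpha> * b + \<beta> * d" using uv by simp
  have "\<gamma> * b + \<delta> * d = \<gamma> * b0 + u * d" by (simp add: \<delta>_def b0 algebra_simps)
  also have "\<dots> = s * (u * \<alpha> + v * \<gamma>)" by (simp add: b0_def d_def algebra_simps)
  finally have s: "s = \<gamma> * b + \<delta> * d" using uv by simp
  define a' b' d' where "a' = nat a" and "b' = nat b" and "d' = nat d"
  have eqs: "int a' = a" "int b' = b" "int d' = d" using a b d by (auto simp: a'_def b'_def d'_def)
  have "gcd (gcd a' b') d' = 1"
  proof -
    define e where "e = int (gcd (gcd a' b') d')"
    have e: "e dvd a" "e dvd b" "e dvd d"
      unfolding e_def eqs[symmetric] by (auto simp only: int_dvd_int_iff intro: dvd_trans[OF gcd_dvd1] gcd_dvd2)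
    then have "is_unit e"
      by (intro prim) (auto simp: pr q s)
    then show ?thesis by (simp add: e_def)
  qed
  moreover have "a' * d' = N" using ad unfolding eqs[symmetric] by (metis of_nat_eq_iff of_nat_mult)
  moreover have "b' < d'" using b d by (simp add: b'_def d'_def)
  ultimately have "(a', b', d') \<in> hecke_reps N" by (simp add: hecke_reps_def)
  then show ?thesis
  proof (rule that[OF _ det'])
    show "p = \<alpha> * int a'" unfolding eqs by (subst mult.commute) (rule pr(1))
    show "r = \<gamma> * int a'" unfolding eqs by (subst mult.commute) (rule pr(2))
    show "q = \<alpha> * int b' + \<beta> * int d'" "s = \<gamma> * int b' + \<delta> * int d'"
      unfolding eqs by (fact q, fact s)
  qed
qed

text \<open>j does not see the unimodular left factor of the normal form.\<close>

lemma jfun_primitive_matrix: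
  fixes p q r s :: int
  assumes det: "p * s - q * r = int N" and N: "N > 0"
    and prim: "\<And>e. e dvd p \<Longrightarrow> e dvd q \<Longrightarrow> e dvd r \<Longrightarrow> e dvd s \<Longrightarrow> is_unit e"
  shows "\<exists>\<sigma>\<in>hecke_reps N. \<forall>z. Im z > 0 \<longrightarrow> jfun ((of_int p * z + of_int q) / (of_int r * z + of_int s)) = jrep \<sigma> z"
proof -
  obtain a b d \<alpha> \<beta> \<gamma> \<delta> where *: "(a, b, d) \<in> hecke_reps N" "\<alpha> * \<delta> - \<beta> * \<gamma> = 1"
    "p = \<alpha> * int a" "q = \<alpha> * int b + \<beta> * int d" "r = \<gamma> * int a" "s = \<gamma> * int b + \<delta> * int d"
    by (rule primitive_matrix_normal_form[OF assms])
  have pos: "a > 0" "d > 0" using hecke_repsD[OF *(1) N] by auto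
  show ?thesis
  proof (intro bexI[OF _ *(1)] allI impI)
    fix z assume z: "Im z > 0"
    define w where "w = (of_nat a * z + of_nat b) / of_nat d"
    have w: "Im w > 0" using z pos by (simp add: w_def)
    have dw: "of_nat d * w = of_nat a * z + of_nat b" using pos by (simp add: w_def)
    have "of_int p * z + of_int q = of_int \<alpha> * (of_nat a * z + of_nat b) + of_int \<beta> * of_nat d"
      by (simp add: * algebra_simps)
    also have "\<dots> = of_nat d * (of_int \<alpha> * w + of_int \<beta>)" unfolding dw[symmetric] by (simp add: algebra_simps)
    finally have 1: "of_int p * z + of_int q = of_nat d * (of_int \<alpha> * w + of_int \<beta>)" .
    have "of_int r * z + of_int s = of_int \<gamma> * (of_nat a * z + of_nat b) + of_int \<delta> * of_nat d"
      by (simp add: * algebra_simps)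
    also have "\<dots> = of_nat d * (of_int \<gamma> * w + of_int \<delta>)" unfolding dw[symmetric] by (simp add: algebra_simps)
    finally have 2: "of_int r * z + of_int s = of_nat d * (of_int \<gamma> * w + of_int \<delta>)" .
    have "(of_int p * z + of_int q) / (of_int r * z + of_int s) = (of_int \<alpha> * w + of_int \<beta>) / (of_int \<gamma> * w + of_int \<delta>)"
      unfolding 1 2 using pos by simp
    then show "jfun ((of_int p * z + of_int q) / (of_int r * z + of_int s)) = jrep (a, b, d) z"
      using jfun_modular[OF w *(2)] by (simp add: jrep_def w_def)
  qed
qed

text \<open>Acting on z multiplies the matrix of \<open>\<sigma>\<close> on the right by a
  unimodular one; determinant and primitivity survive, so the normal form leads back to a
  representative.\<close>

lemma jrep_moebius:
  fixes \<alpha> \<beta> \<gamma> \<delta> :: int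
  assumes \<sigma>: "\<sigma> \<in> hecke_reps N" and N: "N > 0" and det: "\<alpha> * \<delta> - \<beta> * \<gamma> = 1"
  shows "\<exists>\<tau>\<in>hecke_reps N. \<forall>z. Im z > 0 \<longrightarrow>
    jrep \<sigma> ((of_int \<alpha> * z + of_int \<beta>) / (of_int \<gamma> * z + of_int \<delta>)) = jrep \<tau> z"
proof -
  obtain a b d where abd: "\<sigma> = (a, b, d)" by (cases \<sigma>) auto
  note pos = hecke_repsD[OF \<sigma>[unfolded abd] N]
  define p q r s where "p = int a * \<alpha> + int b * \<gamma>" and "q = int a * \<beta> + int b * \<delta>"
    and "r = int d * \<gamma>" and "s = int d * \<delta>"
  have "p * s - q * r = int (a * d) * (\<alpha> * \<delta> - \<beta> * \<gamma>)"
    by (simp add: p_def q_def r_def s_def algebra_simps)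
  then have dt: "p * s - q * r = int N" using det pos by simp
  have prim: "is_unit e" if e: "e dvd p" "e dvd q" "e dvd r" "e dvd s" for e
  proof -
    \<comment> \<open>Multiplying by the adjugate recovers a, b, d from the product, so a common
      divisor of its entries divides all three.\<close>
    have "int a * (\<alpha> * \<delta> - \<beta> * \<gamma>) = p * \<delta> - q * \<gamma>" "int b * (\<alpha> * \<delta> - \<beta> * \<gamma>) = q * \<alpha> - p * \<beta>"
      "int d * (\<alpha> * \<delta> - \<beta> * \<gamma>) = s * \<alpha> - r * \<beta>"
      by (simp_all add: p_def q_def r_def s_def algebra_simps)
    then have "e dvd int a" "e dvd int b" "e dvd int d" using e det by auto
    then have "e dvd gcd (gcd (int a) (int b)) (int d)" by (intro gcd_greatest)
    also have "gcd (gcd (int a) (int b)) (int d) = int (gcd (gcd a b) d)" by simp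
    also have "\<dots> = 1" using \<sigma> by (simp add: abd hecke_reps_def)
    finally show ?thesis .
  qed
  obtain \<tau> where \<tau>: "\<tau> \<in> hecke_reps N"
    "\<And>z. Im z > 0 \<Longrightarrow> jfun ((of_int p * z + of_int q) / (of_int r * z + of_int s)) = jrep \<tau> z"
    using jfun_primitive_matrix[OF dt N prim] by blast
  show ?thesis
  proof (intro bexI[OF _ \<tau>(1)] allI impI)
    fix z assume z: "Im z > 0"
    have "(\<gamma>, \<delta>) \<noteq> (0, 0)" using det by auto
    then have nz: "of_int \<gamma> * z + of_int \<delta> \<noteq> 0"
      by (rule upper_half_plane_denominator_nonzero[OF z])
    have "(of_nat a * ((of_int \<alpha> * z + of_int \<beta>) / (of_int \<gamma> * z + of_int \<delta>)) + of_nat b) / of_nat d =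
      (of_int p * z + of_int q) / (of_int r * z + of_int s)"
    proof -
      have "of_int p * z + of_int q = of_nat a * (of_int \<alpha> * z + of_int \<beta>) + of_nat b * (of_int \<gamma> * z + of_int \<delta>)"
        by (simp add: p_def q_def algebra_simps)
      moreover have "of_int r * z + of_int s = of_nat d * (of_int \<gamma> * z + of_int \<delta>)"
        by (simp add: r_def s_def algebra_simps)
      moreover have "(A * (X / Y) + B) / D = (A * X + B * Y) / (D * Y)" if "Y \<noteq> 0" for A B D X Y :: complex
        using that by (simp add: divide_simps)
      ultimately show ?thesis using nz by simp
    qed
    then show "jrep \<sigma> ((of_int \<alpha> * z + of_int \<beta>) / (of_int \<gamma> * z + of_int \<delta>)) = jrep \<tau> z"
      using \<tau>(2)[OF z] by (simp add: jrep_def abd)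
  qed
qed

text \<open>The product of the primes of \<open>d\<close> that do not divide \<open>a\<close>
  serves.\<close>

lemma ex_coprime_absorbing:
  fixes a d :: int
  assumes "d > 0"
  obtains p where "coprime p a" "\<And>l. prime l \<Longrightarrow> l dvd d \<Longrightarrow> l dvd a \<or> l dvd p"
proof -
  define S where "S = {l \<in> prime_factors d. \<not> l dvd a}"
  have fin: "finite S" by (simp add: S_def)
  have "coprime (\<Prod>S) a"
    by (rule prod_coprime_left) (auto simp: S_def prime_factors_dvd intro: prime_imp_coprime)
  moreover have "l dvd a \<or> l dvd \<Prod>S" if "prime l" "l dvd d" for l
  proof (cases "l dvd a")
    case False
    then have "l \<in> S" using that assms by (simp add: S_def prime_factors_dvd)
    then show ?thesis using fin dvd_prodI[of S l "\<lambda>x. x"] by simp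
  qed simp
  ultimately show ?thesis using that by blast
qed

text \<open>
  The row \<open>(p, q)\<close> is chosen so that multiplying it into \<open>\<sigma>\<close> gives \<open>N (p', 1)\<close>; the factor \<open>p'\<close> absorbs
  the primes of \<open>d\<close> that would otherwise be shared with \<open>q\<close>.
\<close>
lemma hecke_reps_transitive:
  assumes \<sigma>: "\<sigma> \<in> hecke_reps N" and N: "N > 0"
  obtains \<alpha> \<beta> \<gamma> \<delta> :: int where "\<alpha> * \<delta> - \<beta> * \<gamma> = 1"
    "\<And>z. Im z > 0 \<Longrightarrow> jfun (of_nat N * ((of_int \<alpha> * z + of_int \<beta>) / (of_int \<gamma> * z + of_int \<delta>))) = jrep \<sigma> z"
proof -
  obtain a0 b0 d0 where abd: "\<sigma> = (a0, b0, d0)" by (cases \<sigma>) auto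
  note pos = hecke_repsD[OF \<sigma>[unfolded abd] N]
  define a b d where "a = int a0" and "b = int b0" and "d = int d0"
  have ad: "a * d = int N" using pos by (auto simp: a_def d_def)
  have d: "d > 0" using pos by (simp add: d_def)
  obtain p' where p': "coprime p' a" "\<And>l. prime l \<Longrightarrow> l dvd d \<Longrightarrow> l dvd a \<or> l dvd p'"
    using ex_coprime_absorbing[OF d] by blast
  \<comment> \<open>These values make p a = N p' and p b + q d = a d = N.\<close>
  define p q where "p = d * p'" and "q = a - p' * b"
  have "coprime p q"
  proof (rule ccontr)
    assume "\<not> coprime p q"
    then have "\<not> is_unit (gcd p q)" unfolding is_unit_gcd .
    moreover have "gcd p q \<noteq> 0"
    proof
      assume "gcd p q = 0"
      then have "p' = 0" "a = 0" using d by (auto simp: p_def q_def)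
      then show False using ad N by simp
    qed
    ultimately obtain l where l: "prime l" "l dvd gcd p q" using prime_divisor_exists by blast
    then have lp: "l dvd p" and lq: "l dvd q" by auto
    have not_unit: "\<not> is_unit l" using l(1) not_prime_unit by blast
    show False
    proof (cases "l dvd p'")
      case True
      then have "l dvd a" using lq unfolding q_def by (metis dvd_mult2 dvd_diff_right_iff dvd_diffD1 dvd_diff_commute diff_add_cancel dvd_add)
      with True show False using p'(1) not_unit coprime_common_divisor by blast
    next
      case False
      then have "l dvd d" using lp l(1) unfolding p_def by (metis prime_dvd_mult_iff)
      then have la: "l dvd a" using p'(2)[OF l(1)] False by blast
      then have "l dvd p' * b" using lq unfolding q_def
        by (metis diff_diff_eq2 add_diff_cancel_left' dvd_diff)
      then have "l dvd b" using False l(1) by (metis prime_dvd_mult_iff)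
      then have "l dvd gcd (gcd a b) d" using la \<open>l dvd d\<close> by simp
      also have "gcd (gcd a b) d = int (gcd (gcd a0 b0) d0)" by (simp add: a_def b_def d_def)
      also have "\<dots> = 1" using \<sigma> by (simp add: abd hecke_reps_def)
      finally show False using not_unit by simp
    qed
  qed
  then obtain u v where uv: "u * p + v * q = 1"
    using bezout_int[of p q] by (auto simp: coprime_iff_gcd_eq_1)
  define r s where "r = - v" and "s = u"
  have rs: "p * s - q * r = 1" using uv by (simp add: r_def s_def algebra_simps)
  show ?thesis
  \<comment> \<open>The instances come in the order \<alpha>, \<delta>, \<beta>, \<gamma> of
    occurrence. The determinant equals p s - q r = 1.\<close>
  proof (rule that[of p' "r * b + s * d" 1 "r * a"])
    show "p' * (r * b + s * d) - 1 * (r * a) = 1" using rs by (simp add: p_def q_def algebra_simps)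
    fix z assume z: "Im z > 0"
    define w where "w = (of_nat a0 * z + of_nat b0) / of_nat d0"
    have w: "Im w > 0" using z pos by (simp add: w_def)
    have dw: "of_int d * w = of_int a * z + of_int b" using pos by (simp add: w_def a_def b_def d_def)
    have "of_int d * (of_int p * w + of_int q) = of_int p * (of_int d * w) + of_int d * of_int q"
      by (simp add: algebra_simps)
    also have "\<dots> = of_int (a * d) * (of_int p' * z + 1)"
      unfolding dw by (simp add: p_def q_def algebra_simps)
    finally have 1: "of_int d * (of_int p * w + of_int q) = of_nat N * (of_int p' * z + 1)"
      unfolding ad by simp
    have "of_int d * (of_int r * w + of_int s) = of_int r * (of_int d * w) + of_int d * of_int s"
      by (simp add: algebra_simps)
    also have "\<dots> = of_int (r * a) * z + of_int (r * b + s * d)"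
      unfolding dw by (simp add: algebra_simps)
    finally have 2: "of_int d * (of_int r * w + of_int s) = of_int (r * a) * z + of_int (r * b + s * d)" .
    have "of_nat N * ((of_int p' * z + of_int 1) / (of_int (r * a) * z + of_int (r * b + s * d))) =
       (of_int d * (of_int p * w + of_int q)) / (of_int d * (of_int r * w + of_int s))"
      unfolding 1 2 by simp
    also have "\<dots> = (of_int p * w + of_int q) / (of_int r * w + of_int s)"
      using d by simp
    finally show "jfun (of_nat N * ((of_int p' * z + of_int 1) / (of_int (r * a) * z + of_int (r * b + s * d)))) = jrep \<sigma> z"
      using jfun_modular[OF w rs] by (simp add: jrep_def abd w_def)
  qed
qed

section \<open>Counting and asymptotics of the conjugates\<close>

text \<open>Coprimality to \<open>g\<close> has period \<open>g\<close>, so each of the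
  \<open>m\<close> blocks contributes \<open>totient g\<close>. Totatives lie between 1 and g, block
  positions between 0 and g - 1; the \<open>mod g\<close> in the proof reconciles them, which
  matters for g = 1.\<close>

lemma card_coprime_block: "card {b. b < g * m \<and> coprime b g} = m * totient (g::nat)"
proof (induction m)
  case (Suc m)
  show ?case
  proof (cases "g = 0")
    case False
    have "{b. b < g * Suc m \<and> coprime b g} =
       {b. b < g * m \<and> coprime b g} \<union> (\<lambda>b. g * m + (b mod g)) ` totatives g"
    proof (intro equalityI subsetI)
      fix b assume b: "b \<in> {b. b < g * Suc m \<and> coprime b g}"
      show "b \<in> {b. b < g * m \<and> coprime b g} \<union> (\<lambda>b. g * m + (b mod g)) ` totatives g"
      proof (cases "b < g * m")
        case ge: False
        define c where "c = b - g * m"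
        have c: "b = g * m + c" "c < g" using b ge by (auto simp: c_def)
        have "gcd g (m * g + c) = gcd g c" by (rule gcd_add_mult)
        then have cop: "coprime c g" using b c by (simp add: coprime_iff_gcd_eq_1 gcd.commute mult.commute)
        define c' where "c' = (if c = 0 then g else c)"
        have "c' \<in> totatives g"
          using c False cop by (auto simp: c'_def in_totatives_iff)
        moreover have "b = g * m + c' mod g" using c by (simp add: c'_def)
        ultimately show ?thesis by blast
      qed (use b in auto)
    next
      fix b assume "b \<in> {b. b < g * m \<and> coprime b g} \<union> (\<lambda>b. g * m + (b mod g)) ` totatives g"
      then consider "b < g * m" "coprime b g" | x where "x \<in> totatives g" "b = g * m + x mod g" by auto
      then show "b \<in> {b. b < g * Suc m \<and> coprime b g}"
      proof cases
        case 2
        have "gcd g (m * g + x mod g) = gcd g (x mod g)" by (rule gcd_add_mult)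
        also have "\<dots> = gcd x g" by (rule gcd_red_nat[symmetric])
        also have "\<dots> = 1" using 2(1) by (simp add: in_totatives_iff coprime_iff_gcd_eq_1)
        finally have "coprime b g" by (simp add: 2(2) coprime_iff_gcd_eq_1 gcd.commute mult.commute)
        moreover have "b < g * Suc m" using False by (simp add: 2(2))
        ultimately show ?thesis by simp
      qed auto
    qed
    moreover have "card ({b. b < g * m \<and> coprime b g} \<union> (\<lambda>b. g * m + (b mod g)) ` totatives g) =
       card {b. b < g * m \<and> coprime b g} + card ((\<lambda>b. g * m + (b mod g)) ` totatives g)"
      by (rule card_Un_disjoint) auto
    moreover have "inj_on (\<lambda>b. g * m + (b mod g)) (totatives g)"
    proof (rule inj_onI)
      fix x y assume xy: "x \<in> totatives g" "y \<in> totatives g" "g * m + x mod g = g * m + y mod g"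
      then have "0 < x" "x \<le> g" "0 < y" "y \<le> g" "x mod g = y mod g" by (auto simp: in_totatives_iff)
      then show "x = y"
        by (metis le_neq_implies_less mod_less mod_self less_not_refl)
    qed
    ultimately show ?thesis using Suc by (simp add: card_image totient_def)
  qed simp
qed simp

text \<open>The gcd condition says that b is coprime to gcd(a, d), and the range b < d consists of d
  / gcd(a, d) full periods.\<close>

lemma card_hecke_reps_fibre:
  assumes "a * d = N" "N > 0"
  shows "card {b. (a, b, d) \<in> hecke_reps N} = d div gcd a d * totient (gcd a d)"
proof -
  have d: "d = gcd a d * (d div gcd a d)" by simp
  have "{b. (a, b, d) \<in> hecke_reps N} = {b. b < gcd a d * (d div gcd a d) \<and> coprime b (gcd a d)}"
    using assms(1) by (auto simp: hecke_reps_def coprime_iff_gcd_eq_1 gcd.assoc gcd.commute gcd.left_commute)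
  then show ?thesis by (simp only: card_coprime_block)
qed

definition rep_growth :: "nat \<times> nat \<times> nat \<Rightarrow> real" where
  "rep_growth \<sigma> = (case \<sigma> of (a, b, d) \<Rightarrow> real a / real d)"

text \<open>With g = gcd(a, d) there are (d/g) phi(g) representatives over a. For a > d the weight
  a/d turns this into (a/g) phi(g), the summand at k = a; for a < d the weight is 1 and the count is
  the summand at k = d. Hence the factor 2. The case a = d leaves phi(sqrt N).\<close>

lemma sum_rep_growth:
  assumes N: "N > 0"
  shows "(\<Sum>\<sigma>\<in>hecke_reps N. max 1 (rep_growth \<sigma>)) = real (deg_formula N)"
proof -
  define c where "c = (\<lambda>a. N div a div gcd a (N div a) * totient (gcd a (N div a)))"
  define D where "D = {a. a dvd N}"
  have fD: "finite D" using N by (simp add: D_def)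
  have fib: "card {b. (a, b, N div a) \<in> hecke_reps N} = c a" if "a \<in> D" for a
    using card_hecke_reps_fibre[of a "N div a" N] that N by (auto simp: D_def c_def)
  have reps: "hecke_reps N = (\<lambda>(a, b). (a, b, N div a)) ` (SIGMA a:D. {b. (a, b, N div a) \<in> hecke_reps N})"
    using N by (auto simp: hecke_reps_def D_def image_iff)
  have inj: "inj_on (\<lambda>(a, b). (a, b, N div a)) (SIGMA a:D. {b. (a, b, N div a) \<in> hecke_reps N})"
    by (auto simp: inj_on_def)
  have finb: "finite {b. (a, b, N div a) \<in> hecke_reps N}" for a
    by (rule finite_subset[of _ "{..<N div a}"]) (auto simp: hecke_reps_def)
  have "(\<Sum>\<sigma>\<in>hecke_reps N. max 1 (rep_growth \<sigma>)) =
      (\<Sum>(a, b)\<in>(SIGMA a:D. {b. (a, b, N div a) \<in> hecke_reps N}). max 1 (real a / real (N div a)))"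
    by (subst reps, subst sum.reindex[OF inj]) (simp add: case_prod_unfold rep_growth_def)
  also have "\<dots> = (\<Sum>a\<in>D. \<Sum>b\<in>{b. (a, b, N div a) \<in> hecke_reps N}. max 1 (real a / real (N div a)))"
    using fD finb by (subst sum.Sigma) auto
  also have "\<dots> = (\<Sum>a\<in>D. real (c a) * max 1 (real a / real (N div a)))"
    by (intro sum.cong) (auto simp: fib)
  also have "D = {a\<in>D. N < a * a} \<union> {a\<in>D. a * a < N} \<union> {a\<in>D. a * a = N}" by auto
  also have "(\<Sum>a\<in>\<dots>. real (c a) * max 1 (real a / real (N div a))) =
      (\<Sum>a\<in>{a\<in>D. N < a * a}. real (c a) * max 1 (real a / real (N div a))) +
      (\<Sum>a\<in>{a\<in>D. a * a < N}. real (c a) * max 1 (real a / real (N div a))) +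
      (\<Sum>a\<in>{a\<in>D. a * a = N}. real (c a) * max 1 (real a / real (N div a)))"
    using fD by (subst sum.union_disjoint; (subst sum.union_disjoint)?) auto
  also have "(\<Sum>a\<in>{a\<in>D. N < a * a}. real (c a) * max 1 (real a / real (N div a))) =
      (\<Sum>a\<in>{a\<in>D. N < a * a}. real (a div gcd a (N div a) * totient (gcd a (N div a))))"
  proof (rule sum.cong[OF refl])
    fix a assume a: "a \<in> {a \<in> D. N < a * a}"
    then obtain d where d: "N = a * d" by (auto simp: D_def)
    then have pos: "a > 0" "d > 0" "d < a" using N a by auto
    define g where "g = gcd a d"
    obtain a' d' where ad: "a = g * a'" "d = g * d'" unfolding g_def by (meson dvdE gcd_dvd1 gcd_dvd2)
    have g: "g > 0" using pos by (simp add: g_def)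
    have Na: "N div a = d" using d pos by simp
    have "real (c a) * max 1 (real a / real (N div a)) = real d' * real (totient g) * (real a / real d)"
      using pos g by (simp add: c_def Na g_def[symmetric] max_def) (simp add: ad)
    also have "\<dots> = real a' * real (totient g)"
      using pos g by (simp add: ad)
    finally show "real (c a) * max 1 (real a / real (N div a)) = real (a div gcd a (N div a) * totient (gcd a (N div a)))"
      using g by (simp add: Na g_def[symmetric]) (simp add: ad)
  qed
  also have "(\<Sum>a\<in>{a\<in>D. a * a < N}. real (c a) * max 1 (real a / real (N div a))) =
      (\<Sum>a\<in>{a\<in>D. N < a * a}. real (a div gcd a (N div a) * totient (gcd a (N div a))))"
  proof (rule sum.reindex_bij_witness[of _ "\<lambda>a. N div a" "\<lambda>a. N div a"])
    fix a assume a: "a \<in> {a \<in> D. a * a < N}"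
    then obtain d where d: "N = a * d" by (auto simp: D_def)
    then have pos: "a > 0" "d > 0" "a < d" using N a by auto
    have Na: "N div a = d" "N div d = a" using d pos by auto
    show "N div (N div a) = a" using Na by simp
    show "N div a \<in> {a \<in> D. N < a * a}" using Na pos d by (simp add: D_def)
    show "real (N div a div gcd (N div a) (N div (N div a)) * totient (gcd (N div a) (N div (N div a)))) =
       real (c a) * max 1 (real a / real (N div a))"
      using pos by (simp add: c_def Na max_def gcd.commute)
  next
    fix a assume a: "a \<in> {a \<in> D. N < a * a}"
    then obtain d where d: "N = a * d" by (auto simp: D_def)
    then have pos: "a > 0" "d > 0" "d < a" using N a by auto
    have Na: "N div a = d" "N div d = a" using d pos by auto
    show "N div (N div a) = a" using Na by simp
    show "N div a \<in> {a \<in> D. a * a < N}" using Na pos d by (simp add: D_def)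
  qed
  also have "(\<Sum>a\<in>{a\<in>D. a * a = N}. real (c a) * max 1 (real a / real (N div a))) = real (phi_sqrt N)"
  proof (cases "\<exists>m. m * m = N")
    case True
    then obtain m where m: "m * m = N" by blast
    have uniq: "m' = m" if "m' * m' = N" for m'
      using that m by (metis power2_eq_square power2_eq_iff_nonneg zero_le)
    have "m dvd N" using m by (metis dvd_triv_left)
    then have "{a\<in>D. a * a = N} = {m}" using m uniq unfolding D_def by blast
    moreover have "(THE m. m * m = N) = m" using m uniq by (intro the_equality)
    moreover have "m > 0" "N div m = m" using m N by auto
    ultimately show ?thesis using True by (simp add: phi_sqrt_def c_def)
  next
    case False
    then have "{a\<in>D. a * a = N} = {}" by auto
    then show ?thesis using False by (simp add: phi_sqrt_def)
  qed
  also have "{a\<in>D. N < a * a} = {k. k dvd N \<and> k \<le> N \<and> N < k * k}"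
    using N by (auto simp: D_def dvd_imp_le)
  finally show ?thesis by (simp add: deg_formula_def)
qed

text \<open>j behaves like 1/q, and at w = (a i y + b)/d the number 1/q has modulus exp(2 pi y a/d)
  and argument -2 pi b/d.\<close>

lemma jrep_asymptotics:
  assumes "(a, b, d) \<in> hecke_reps N" "N > 0"
  shows "((\<lambda>y. jrep (a, b, d) (\<i> * of_real y) * of_real (exp (- 2 * pi * rep_growth (a, b, d) * y))) \<longlongrightarrow>
    cis (- 2 * pi * (real b / real d))) at_top"
proof -
  note pos = hecke_repsD[OF assms]
  define f where "f = (\<lambda>y::real. (of_nat a * (\<i> * of_real y) + of_nat b) / of_nat d :: complex)"
  have Im: "Im (f y) = real a / real d * y" for y by (simp add: f_def)
  have "filterlim (\<lambda>y. Im (f y)) at_top at_top"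
    unfolding Im using pos by (intro filterlim_tendsto_pos_mult_at_top[OF tendsto_const _ filterlim_ident]) auto
  then have "((\<lambda>y. jfun (f y) * qpar (f y)) \<longlongrightarrow> 1) at_top"
    by (rule jfun_times_qpar_tendsto)
  then have "((\<lambda>y. jfun (f y) * qpar (f y) * cis (- 2 * pi * (real b / real d))) \<longlongrightarrow> 1 * cis (- 2 * pi * (real b / real d))) at_top"
    by (rule tendsto_mult[OF _ tendsto_const])
  moreover have "qpar (f y) * cis (- 2 * pi * (real b / real d)) = of_real (exp (- 2 * pi * rep_growth (a, b, d) * y))" for y
  proof -
    have "qpar (f y) = exp (of_real (- 2 * pi * (real a / real d) * y) + \<i> * of_real (2 * pi * (real b / real d)))"
      unfolding qpar_def f_def using pos by (intro arg_cong[where f = exp]) (simp add: field_simps)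
    then show ?thesis
      unfolding cis_conv_exp exp_of_real[symmetric] rep_growth_def prod.case
      by (simp add: exp_add[symmetric] del: of_real_mult of_real_divide)
  qed
  ultimately show ?thesis
    by (simp add: jrep_def f_def mult.assoc)
qed

lemma asymptotics_decay:
  fixes h :: "real \<Rightarrow> complex"
  assumes "((\<lambda>y. h y * of_real (exp (- 2 * pi * t * y))) \<longlongrightarrow> k) at_top" "t < t'"
  shows "((\<lambda>y. h y * of_real (exp (- 2 * pi * t' * y))) \<longlongrightarrow> 0) at_top"
proof -
  have "((\<lambda>y. exp (- (2 * pi * (t' - t) * y))) \<longlongrightarrow> 0) at_top"
    using assms(2) by (intro filterlim_compose[OF exp_at_bot] filterlim_compose[OF filterlim_uminus_at_bot_at_top]
        filterlim_tendsto_pos_mult_at_top[OF tendsto_const _ filterlim_ident]) auto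
  then have "((\<lambda>y. of_real (exp (- (2 * pi * (t' - t) * y))) :: complex) \<longlongrightarrow> of_real 0) at_top"
    by (rule tendsto_of_real)
  from tendsto_mult[OF assms(1) this] show ?thesis
    by (simp add: mult.assoc exp_add[symmetric] algebra_simps flip: of_real_mult)
qed

lemma difference_asymptotics:
  fixes f g :: "real \<Rightarrow> complex"
  assumes "((\<lambda>y. f y * of_real (exp (- 2 * pi * r * y))) \<longlongrightarrow> c) at_top"
    and "((\<lambda>y. g y * of_real (exp (- 2 * pi * s * y))) \<longlongrightarrow> c') at_top"
    and "c \<noteq> 0" "c' \<noteq> 0" "r \<noteq> s \<or> c \<noteq> c'"
  obtains l where "l \<noteq> 0" "((\<lambda>y. (f y - g y) * of_real (exp (- 2 * pi * max r s * y))) \<longlongrightarrow> l) at_top"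
proof -
  consider "r < s" | "s < r" | "r = s" "c \<noteq> c'" using assms(5) by linarith
  then show ?thesis
  proof cases
    case 1
    have "((\<lambda>y. f y * of_real (exp (- 2 * pi * s * y)) - g y * of_real (exp (- 2 * pi * s * y))) \<longlongrightarrow> 0 - c') at_top"
      by (intro tendsto_diff asymptotics_decay[OF assms(1) 1] assms(2))
    then show ?thesis using that[of "- c'"] assms(4) 1 by (simp add: left_diff_distrib max_def)
  next
    case 2
    have "((\<lambda>y. f y * of_real (exp (- 2 * pi * r * y)) - g y * of_real (exp (- 2 * pi * r * y))) \<longlongrightarrow> c - 0) at_top"
      by (intro tendsto_diff asymptotics_decay[OF assms(2) 2] assms(1))
    then show ?thesis using that[of c] assms(3) 2 by (simp add: left_diff_distrib max_def)
  next
    case 3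
    have "((\<lambda>y. f y * of_real (exp (- 2 * pi * r * y)) - g y * of_real (exp (- 2 * pi * r * y))) \<longlongrightarrow> c - c') at_top"
      using 3 assms(1,2) by (intro tendsto_diff) auto
    then show ?thesis using that[of "c - c'"] 3 by (simp add: left_diff_distrib max_def)
  qed
qed

lemma cis_root_eq_iff:
  assumes "b < d" "b' < d" "cis (- 2 * pi * (real b / real d)) = cis (- 2 * pi * (real b' / real d))"
  shows "b = b'"
proof -
  have "exp (\<i> * of_real (- 2 * pi * (real b / real d))) = exp (\<i> * of_real (- 2 * pi * (real b' / real d)))"
    using assms(3) by (simp add: cis_conv_exp)
  then obtain n :: int where "\<i> * of_real (- 2 * pi * (real b / real d)) =
      \<i> * of_real (- 2 * pi * (real b' / real d)) + of_real (of_int (2 * n) * pi) * \<i>"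
    unfolding exp_eq by blast
  then have "Im (\<i> * of_real (- 2 * pi * (real b / real d))) =
      Im (\<i> * of_real (- 2 * pi * (real b' / real d)) + of_real (of_int (2 * n) * pi) * \<i>)" by (rule arg_cong)
  then have "2 * pi * (real b / real d) = 2 * pi * (real b' / real d - of_int n)" by (simp add: algebra_simps)
  then have "real b / real d = real b' / real d - of_int n" by (subst (asm) mult_cancel_left) simp
  then have "real b = real b' - of_int n * real d" using assms(1) by (simp add: field_simps)
  then have "of_int (int b) = (of_int (int b' - n * int d) :: real)" by simp
  then have eq: "int b = int b' - n * int d" by (simp only: of_int_eq_iff)
  have "int b mod int d = (int b' - n * int d) mod int d" unfolding eq ..
  also have "\<dots> = int b' mod int d" by (simp add: mod_diff_right_eq[symmetric])
  finally show ?thesis using assms(1,2) by simp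
qed

text \<open>Two levels are allowed because j itself is the representative (1, 0, 1) of level 1, to
  be compared with those of level N.\<close>

lemma jrep_difference_asymptotics:
  assumes "\<sigma> \<in> hecke_reps N" "\<tau> \<in> hecke_reps M" "N > 0" "M > 0"
    and "rep_growth \<sigma> \<noteq> rep_growth \<tau> \<or> cis (- 2 * pi * (real (fst (snd \<sigma>)) / real (snd (snd \<sigma>)))) \<noteq>
      cis (- 2 * pi * (real (fst (snd \<tau>)) / real (snd (snd \<tau>))))"
  obtains l where "l \<noteq> 0" "((\<lambda>y. (jrep \<sigma> (\<i> * of_real y) - jrep \<tau> (\<i> * of_real y)) *
    of_real (exp (- 2 * pi * max (rep_growth \<sigma>) (rep_growth \<tau>) * y))) \<longlongrightarrow> l) at_top"
proof -
  obtain a b d where s: "\<sigma> = (a, b, d)" by (cases \<sigma>) auto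
  obtain a' b' d' where t: "\<tau> = (a', b', d')" by (cases \<tau>) auto
  have "rep_growth (a, b, d) \<noteq> rep_growth (a', b', d') \<or>
      cis (- 2 * pi * (real b / real d)) \<noteq> cis (- 2 * pi * (real b' / real d'))"
    using assms(5) by (simp add: s t)
  from difference_asymptotics[OF jrep_asymptotics[OF assms(1)[unfolded s] assms(3)]
      jrep_asymptotics[OF assms(2)[unfolded t] assms(4)] cis_neq_zero cis_neq_zero this] that
  show ?thesis unfolding s t by blast
qed

text \<open>The growth a/d together with a d = N determines a and d; the phase then determines b,
  which is less than d.\<close>

lemma eventually_jrep_neq:
  assumes "\<sigma> \<in> hecke_reps N" "\<tau> \<in> hecke_reps N" "N > 0" "\<sigma> \<noteq> \<tau>"
  shows "\<forall>\<^sub>F y in at_top. jrep \<sigma> (\<i> * of_real y) \<noteq> jrep \<tau> (\<i> * of_real y)"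
proof -
  obtain a b d where s: "\<sigma> = (a, b, d)" by (cases \<sigma>) auto
  obtain a' b' d' where t: "\<tau> = (a', b', d')" by (cases \<tau>) auto
  note p1 = hecke_repsD[OF assms(1)[unfolded s] assms(3)] and p2 = hecke_repsD[OF assms(2)[unfolded t] assms(3)]
  have "rep_growth \<sigma> \<noteq> rep_growth \<tau> \<or> cis (- 2 * pi * (real b / real d)) \<noteq> cis (- 2 * pi * (real b' / real d'))"
  proof (rule ccontr)
    assume "\<not> ?thesis"
    then have 1: "real a / real d = real a' / real d'" and 2: "cis (- 2 * pi * (real b / real d)) = cis (- 2 * pi * (real b' / real d'))"
      by (auto simp: rep_growth_def s t)
    have "real (a * d') = real (a' * d)" using 1 p1 p2 by (simp add: field_simps)
    then have e: "a * d' = a' * d" by (simp only: of_nat_eq_iff)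
    have "a * a * d' = a * (a' * d)" using e by (simp add: mult.assoc)
    also have "\<dots> = a' * (a' * d')" using p1 p2 by (metis mult.left_commute)
    finally have "(a * a) * d' = (a' * a') * d'" by (simp only: mult.assoc)
    then have "a * a = a' * a'" using p2(2) by (auto simp only: mult_cancel2)
    then have aa: "a = a'" by (metis power2_eq_square power2_eq_iff_nonneg zero_le)
    then have dd: "d = d'" using e p2 by simp
    have "b = b'" using cis_root_eq_iff[of b d b'] 2 p1 p2 dd by simp
    then show False using assms(4) aa dd s t by simp
  qed
  then obtain l where l: "l \<noteq> 0" "((\<lambda>y. (jrep \<sigma> (\<i> * of_real y) - jrep \<tau> (\<i> * of_real y)) *
    of_real (exp (- 2 * pi * max (rep_growth \<sigma>) (rep_growth \<tau>) * y))) \<longlongrightarrow> l) at_top"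
    using jrep_difference_asymptotics[OF assms(1,2,3,3)] by (auto simp: s t)
  from tendsto_imp_eventually_ne[OF l(2,1)] show ?thesis
    by eventually_elim auto
qed

section \<open>The modular polynomial as a product over the conjugates\<close>

definition jrep_poly :: "nat \<Rightarrow> complex \<Rightarrow> complex poly" where
  "jrep_poly N z = (\<Prod>\<sigma>\<in>hecke_reps N. [:- jrep \<sigma> z, 1:])"

lemma jrep_distinct_eventually:
  assumes "N > 0"
  shows "\<forall>\<^sub>F y in at_top. inj_on (\<lambda>\<sigma>. jrep \<sigma> (\<i> * of_real y)) (hecke_reps N)"
proof -
  note fin = finite_hecke_reps[OF assms]
  have "\<forall>\<^sub>F y in at_top. \<sigma> \<noteq> \<tau> \<longrightarrow> jrep \<sigma> (\<i> * of_real y) \<noteq> jrep \<tau> (\<i> * of_real y)"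
    if "\<sigma> \<in> hecke_reps N" "\<tau> \<in> hecke_reps N" for \<sigma> \<tau>
    using eventually_jrep_neq[OF that assms] by (cases "\<sigma> = \<tau>") auto
  then have "\<forall>\<^sub>F y in at_top. \<forall>\<sigma>\<in>hecke_reps N. \<forall>\<tau>\<in>hecke_reps N. \<sigma> \<noteq> \<tau> \<longrightarrow>
      jrep \<sigma> (\<i> * of_real y) \<noteq> jrep \<tau> (\<i> * of_real y)"
    by (intro eventually_ball_finite fin ballI)
  then show ?thesis by eventually_elim (auto simp: inj_on_def)
qed

lemma jrep_eq_imp_eq:
  assumes "N > 0" "\<sigma> \<in> hecke_reps N" "\<tau> \<in> hecke_reps N" "\<And>z. Im z > 0 \<Longrightarrow> jrep \<sigma> z = jrep \<tau> z"
  shows "\<sigma> = \<tau>"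
proof -
  have "\<forall>\<^sub>F y in at_top. inj_on (\<lambda>\<sigma>. jrep \<sigma> (\<i> * of_real y)) (hecke_reps N) \<and> y > 0"
    by (intro eventually_conj jrep_distinct_eventually assms eventually_gt_at_top)
  then obtain y where y: "inj_on (\<lambda>\<sigma>. jrep \<sigma> (\<i> * of_real y)) (hecke_reps N)" "y > 0"
    by (metis (mono_tags, lifting) eventually_happens trivial_limit_at_top_linorder)
  then show ?thesis using assms(2-4) by (auto simp: inj_on_def)
qed

lemma moebius_surj:
  fixes \<alpha> \<beta> \<gamma> \<delta> :: int
  assumes "\<alpha> * \<delta> - \<beta> * \<gamma> = 1" "Im w > 0"
  obtains z where "Im z > 0" "w = (of_int \<alpha> * z + of_int \<beta>) / (of_int \<gamma> * z + of_int \<delta>)"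
proof -
  have det: "\<delta> * \<alpha> - (- \<beta>) * (- \<gamma>) = 1" using assms(1) by (simp add: mult.commute)
  define v where "v = of_int (- \<gamma>) * w + of_int \<alpha>"
  define z where "z = (of_int \<delta> * w + of_int (- \<beta>)) / v"
  have "(- \<gamma>, \<alpha>) \<noteq> (0, 0)" using assms(1) by auto
  then have v: "v \<noteq> 0" unfolding v_def by (rule upper_half_plane_denominator_nonzero[OF assms(2)])
  have "Im z > 0" unfolding z_def v_def by (rule Im_moebius_pos[OF assms(2) det]) simp
  moreover have "of_int \<alpha> * z + of_int \<beta> = of_int (\<alpha> * \<delta> - \<beta> * \<gamma>) * w / v"
    using v by (simp add: z_def divide_simps) (simp add: v_def algebra_simps)
  moreover have "of_int \<gamma> * z + of_int \<delta> = of_int (\<alpha> * \<delta> - \<beta> * \<gamma>) / v"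
    using v by (simp add: z_def divide_simps) (simp add: v_def algebra_simps)
  ultimately show ?thesis using that v unfolding assms(1) by simp
qed

text \<open>The linear factors are carried to linear factors. The map on indices is injective
  because distinct representatives give distinct functions and Moebius maps are onto; on a finite
  set it is a permutation.\<close>

lemma jrep_poly_modular:
  fixes \<alpha> \<beta> \<gamma> \<delta> :: int
  assumes N: "N > 0" and z: "Im z > 0" and det: "\<alpha> * \<delta> - \<beta> * \<gamma> = 1"
  shows "jrep_poly N ((of_int \<alpha> * z + of_int \<beta>) / (of_int \<gamma> * z + of_int \<delta>)) = jrep_poly N z"
proof -
  have "\<forall>\<sigma>\<in>hecke_reps N. \<exists>\<tau>. \<tau> \<in> hecke_reps N \<and> (\<forall>z. Im z > 0 \<longrightarrow>
    jrep \<sigma> ((of_int \<alpha> * z + of_int \<beta>) / (of_int \<gamma> * z + of_int \<delta>)) = jrep \<tau> z)"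
    using jrep_moebius[OF _ N det] by blast
  then obtain f where f: "\<And>\<sigma>. \<sigma> \<in> hecke_reps N \<Longrightarrow> f \<sigma> \<in> hecke_reps N"
    "\<And>\<sigma> z. \<sigma> \<in> hecke_reps N \<Longrightarrow> Im z > 0 \<Longrightarrow>
      jrep \<sigma> ((of_int \<alpha> * z + of_int \<beta>) / (of_int \<gamma> * z + of_int \<delta>)) = jrep (f \<sigma>) z"
    by metis
  have inj: "inj_on f (hecke_reps N)"
  proof (rule inj_onI)
    fix \<sigma> \<tau> assume *: "\<sigma> \<in> hecke_reps N" "\<tau> \<in> hecke_reps N" "f \<sigma> = f \<tau>"
    show "\<sigma> = \<tau>"
    proof (rule jrep_eq_imp_eq[OF N *(1,2)])
      fix w assume "Im w > 0"
      then obtain z where "Im z > 0" "w = (of_int \<alpha> * z + of_int \<beta>) / (of_int \<gamma> * z + of_int \<delta>)"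
        using moebius_surj[OF det] by blast
      then show "jrep \<sigma> w = jrep \<tau> w" using f(2) * by simp
    qed
  qed
  then have "f ` hecke_reps N = hecke_reps N"
    using f(1) by (intro endo_inj_surj finite_hecke_reps N) auto
  then have "jrep_poly N z = (\<Prod>\<sigma>\<in>f ` hecke_reps N. [:- jrep \<sigma> z, 1:])" by (simp add: jrep_poly_def)
  also have "\<dots> = (\<Prod>\<sigma>\<in>hecke_reps N. [:- jrep (f \<sigma>) z, 1:])" by (simp add: prod.reindex[OF inj])
  also have "\<dots> = jrep_poly N ((of_int \<alpha> * z + of_int \<beta>) / (of_int \<gamma> * z + of_int \<delta>))"
    unfolding jrep_poly_def by (intro prod.cong refl) (simp add: f(2) z)
  finally show ?thesis ..
qed

lemma coeff_linear_mult:
  "coeff ([:- a, 1:] * p) i = (case i of 0 \<Rightarrow> 0 | Suc k \<Rightarrow> coeff p k) - a * (coeff p i :: complex)"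
  by (simp add: coeff_pCons split: nat.splits)

lemma jrep_holomorphic:
  assumes "\<sigma> \<in> hecke_reps N" "N > 0"
  shows "jrep \<sigma> holomorphic_on upper_half_plane"
proof -
  obtain a b d where s: "\<sigma> = (a, b, d)" by (cases \<sigma>) auto
  note pos = hecke_repsD[OF assms(1)[unfolded s] assms(2)]
  have "(jfun \<circ> (\<lambda>z. (of_nat a * z + of_nat b) / of_nat d)) holomorphic_on upper_half_plane"
    using pos by (intro holomorphic_on_compose_gen[OF _ jfun_holomorphic] holomorphic_intros) auto
  then show ?thesis by (simp add: s jrep_def[abs_def] o_def)
qed

lemma coeff_prod_linear_holomorphic:
  assumes "finite S" "\<And>\<sigma>. \<sigma> \<in> S \<Longrightarrow> f \<sigma> holomorphic_on A"
  shows "(\<lambda>z. coeff (\<Prod>\<sigma>\<in>S. [:- f \<sigma> z, 1:]) i) holomorphic_on A"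
  using assms
proof (induction S arbitrary: i rule: finite_induct)
  case (insert \<sigma> S)
  have "(\<lambda>z. coeff (\<Prod>\<sigma>\<in>S. [:- f \<sigma> z, 1:]) i) holomorphic_on A" for i
    using insert by blast
  then show ?case
    unfolding prod.insert[OF insert(1,2)] coeff_linear_mult
    using insert.prems by (cases i) (auto intro!: holomorphic_intros)
qed simp

text \<open>Each linear factor is paired with one power of \<open>q\<close>, which tames the root
  and costs nothing on the variable since |q| <= 1.\<close>

lemma coeff_prod_linear_bound:
  assumes "finite S" "\<And>\<sigma> z. \<sigma> \<in> S \<Longrightarrow> z \<in> A \<Longrightarrow> norm (f \<sigma> z * q z) \<le> C \<sigma>"
    and "\<And>z. z \<in> A \<Longrightarrow> norm (q z) \<le> 1"
  shows "\<exists>B. \<forall>z\<in>A. norm (coeff (\<Prod>\<sigma>\<in>S. [:- f \<sigma> z, 1:]) i * (q z :: complex) ^ card S) \<le> B"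
  using assms(1,2)
proof (induction S arbitrary: i rule: finite_induct)
  case empty
  show ?case by (intro exI[of _ "norm (coeff (1 :: complex poly) i)"]) simp
next
  case (insert \<sigma> S)
  define p where "p = (\<lambda>z. \<Prod>\<sigma>\<in>S. [:- f \<sigma> z, 1:])"
  have IH: "\<exists>B. \<forall>z\<in>A. norm (coeff (p z) i * q z ^ card S) \<le> B" for i
    using insert unfolding p_def by blast
  define c where "c = (\<lambda>z. case i of 0 \<Rightarrow> 0 | Suc k \<Rightarrow> coeff (p z) k)"
  have "\<exists>B. \<forall>z\<in>A. norm (c z * q z ^ card S) \<le> B"
    using IH by (cases i) (auto simp: c_def)
  then obtain B1 where B1: "\<And>z. z \<in> A \<Longrightarrow> norm (c z * q z ^ card S) \<le> B1" by blast
  obtain B2 where B2: "\<And>z. z \<in> A \<Longrightarrow> norm (coeff (p z) i * q z ^ card S) \<le> B2" using IH by blast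
  have "norm (coeff (\<Prod>\<sigma>\<in>insert \<sigma> S. [:- f \<sigma> z, 1:]) i * q z ^ card (insert \<sigma> S)) \<le> B1 + C \<sigma> * B2"
    if z: "z \<in> A" for z
  proof -
    have pz: "(\<Prod>\<sigma>\<in>S. [:- f \<sigma> z, 1:]) = p z" by (simp add: p_def)
    have cz: "(case i of 0 \<Rightarrow> 0 | Suc k \<Rightarrow> coeff (p z) k) = c z" by (simp add: c_def)
    have "coeff (\<Prod>\<sigma>\<in>insert \<sigma> S. [:- f \<sigma> z, 1:]) i * q z ^ card (insert \<sigma> S) =
        (c z * q z ^ card S) * q z - (f \<sigma> z * q z) * (coeff (p z) i * q z ^ card S)"
      unfolding prod.insert[OF insert(1,2)] coeff_linear_mult card_insert_disjoint[OF insert(1,2)]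
        pz cz
      by (simp add: algebra_simps)
    also have "norm \<dots> \<le> norm (c z * q z ^ card S) * norm (q z) +
        norm (f \<sigma> z * q z) * norm (coeff (p z) i * q z ^ card S)"
      by (rule order_trans[OF norm_triangle_ineq4]) (simp add: norm_mult)
    also have "\<dots> \<le> B1 * 1 + C \<sigma> * B2"
    proof (intro add_mono mult_mono)
      show "0 \<le> B1" using B1[OF z] norm_ge_zero order_trans by blast
      show "0 \<le> C \<sigma>" using insert.prems[of \<sigma> z] z norm_ge_zero order_trans by blast
    qed (use B1 B2 insert.prems assms(3) z in auto)
    finally show ?thesis by simp
  qed
  then show ?case by blast
qed

text \<open>At w = (az + b)/d the product j(w) q(w) is bounded, and |q(z)|^N <= |q(w)| because a/d
  <= N. The radius \<open>r\<close> is the modulus of q(w) for Im z = 1.\<close>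

lemma jrep_bound:
  assumes "\<sigma> \<in> hecke_reps N" "N > 0"
  shows "\<exists>C. \<forall>z. Im z \<ge> 1 \<longrightarrow> norm (jrep \<sigma> z * qpar z ^ N) \<le> C"
proof -
  obtain a b d where s: "\<sigma> = (a, b, d)" by (cases \<sigma>) auto
  note pos = hecke_repsD[OF assms(1)[unfolded s] assms(2)]
  obtain J where J: "J holomorphic_on ball 0 1" "J 0 = 1" "\<And>z. Im z > 0 \<Longrightarrow> jfun z * qpar z = J (qpar z)"
    using jfun_q_expansion by blast
  define r where "r = exp (- 2 * pi * (real a / real d))"
  have r: "0 < r" "r < 1" using pos by (auto simp: r_def)
  have "continuous_on (cball 0 r) J"
    using r by (intro holomorphic_on_imp_continuous_on holomorphic_on_subset[OF J(1)]) auto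
  then have "bounded (J ` cball 0 r)"
    by (intro compact_imp_bounded compact_continuous_image compact_cball)
  then obtain C where C: "\<And>q. norm q \<le> r \<Longrightarrow> norm (J q) \<le> C" by (force simp: bounded_iff)
  have "norm (jrep \<sigma> z * qpar z ^ N) \<le> C" if z: "Im z \<ge> 1" for z
  proof -
    define w where "w = (of_nat a * z + of_nat b) / of_nat d"
    have Imw: "Im w = real a / real d * Im z" by (simp add: w_def)
    have "norm (qpar w) \<le> r"
      unfolding norm_qpar r_def Imw using pos z by (simp add: field_simps)
    moreover have "Im w > 0" unfolding Imw using pos z by (intro mult_pos_pos divide_pos_pos) auto
    ultimately have le: "norm (jfun w) * norm (qpar w) \<le> C"
      using J(3)[of w] C by (metis norm_mult)
    have "real a / real d \<le> real N"
    proof -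
      have "a * 1 \<le> a * (d * d)" using pos(2) by (intro mult_le_mono2) simp
      then have "a \<le> N * d" using pos(3) by (simp add: mult.assoc[symmetric])
      then have "real a \<le> real N * real d" by (metis of_nat_le_iff of_nat_mult)
      then show ?thesis using pos by (simp add: field_simps)
    qed
    then have "real a / real d * Im z \<le> real N * Im z" using z by (intro mult_right_mono) auto
    then have "2 * pi * (real a / real d * Im z) \<le> 2 * pi * (real N * Im z)"
      by (intro mult_left_mono) auto
    moreover have "n * (- 2 * p * y) \<le> - 2 * p * x" if "2 * p * x \<le> 2 * p * (n * y)" for n p x y :: real
      using that by (simp add: mult_ac)
    ultimately have "real N * (- 2 * pi * Im z) \<le> - 2 * pi * (real a / real d * Im z)" by blast
    then have "norm (qpar z) ^ N \<le> norm (qpar w)"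
      unfolding norm_qpar Imw exp_of_nat_mult[symmetric] exp_le_cancel_iff .
    then have "norm (jfun w) * norm (qpar z) ^ N \<le> norm (jfun w) * norm (qpar w)"
      by (intro mult_left_mono) auto
    then show ?thesis using le by (simp add: jrep_def s w_def norm_mult norm_power)
  qed
  then show ?thesis by blast
qed

lemma jrep_poly_coeff_is_polynomial:
  assumes N: "N > 0"
  shows "\<exists>p. \<forall>z. Im z > 0 \<longrightarrow> coeff (jrep_poly N z) i = poly p (jfun z)"
proof -
  have "\<forall>\<sigma>\<in>hecke_reps N. \<exists>C. \<forall>z. Im z \<ge> 1 \<longrightarrow> norm (jrep \<sigma> z * qpar z ^ N) \<le> C"
    using jrep_bound[OF _ N] by blast
  then obtain C where C: "\<And>\<sigma> z. \<sigma> \<in> hecke_reps N \<Longrightarrow> z \<in> {z. Im z \<ge> 1} \<Longrightarrow> norm (jrep \<sigma> z * qpar z ^ N) \<le> C \<sigma>"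
    by (metis mem_Collect_eq)
  have "\<exists>B. \<forall>z\<in>{z. Im z \<ge> 1}. norm (coeff (jrep_poly N z) i * (qpar z ^ N) ^ card (hecke_reps N)) \<le> B"
    unfolding jrep_poly_def
  proof (rule coeff_prod_linear_bound[OF finite_hecke_reps[OF N] C])
    fix z assume "z \<in> {z. 1 \<le> Im z}"
    then show "norm (qpar z ^ N) \<le> 1"
      unfolding norm_power using norm_qpar_less_1[of z] by (intro power_le_one) auto
  qed
  then obtain B where B: "\<And>z. Im z \<ge> 1 \<Longrightarrow> norm (coeff (jrep_poly N z) i * qpar z ^ (N * card (hecke_reps N))) \<le> B"
    by (auto simp: power_mult)
  show ?thesis
  proof (rule modular_function_is_polynomial_in_jfun[OF _ _ B])
    show "(\<lambda>z. coeff (jrep_poly N z) i) holomorphic_on upper_half_plane"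
      unfolding jrep_poly_def
      by (rule coeff_prod_linear_holomorphic[OF finite_hecke_reps[OF N] jrep_holomorphic[OF _ N]])
    show "modular_weight 0 (\<lambda>z. coeff (jrep_poly N z) i)"
      unfolding modular_weight_def using jrep_poly_modular[OF N] by simp
  qed
qed

lemma poly_jrep_poly: "poly (jrep_poly N z) x = (\<Prod>\<sigma>\<in>hecke_reps N. x - jrep \<sigma> z)"
  by (simp add: jrep_poly_def poly_prod)

lemma
  shows degree_jrep_poly: "degree (jrep_poly N z) = card (hecke_reps N)"
    and lead_coeff_jrep_poly: "coeff (jrep_poly N z) (card (hecke_reps N)) = 1"
proof -
  show deg: "degree (jrep_poly N z) = card (hecke_reps N)"
    unfolding jrep_poly_def by (subst degree_prod_eq_sum_degree) auto
  have "lead_coeff (jrep_poly N z) = 1"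
    unfolding jrep_poly_def lead_coeff_prod by simp
  then show "coeff (jrep_poly N z) (card (hecke_reps N)) = 1" by (simp add: deg)
qed

lemma coeff_map_poly_eval: "coeff (map_poly (\<lambda>c. poly c x) P) i = poly (coeff P i) x"
  by (simp add: coeff_map_poly)

lemma modular_polynomial_exists:
  assumes N: "N > 0"
  obtains P where "degree P = card (hecke_reps N)" "lead_coeff P = 1"
    "\<And>z. Im z > 0 \<Longrightarrow> map_poly (\<lambda>c. poly c (jfun z)) P = jrep_poly N z"
proof -
  define n where "n = card (hecke_reps N)"
  obtain p where p: "\<And>i z. Im z > 0 \<Longrightarrow> coeff (jrep_poly N z) i = poly (p i) (jfun z)"
    using jrep_poly_coeff_is_polynomial[OF N] by metis
  \<comment> \<open>The polynomials \<open>p i\<close> are known only through their values at j, so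
    the leading coefficient and the zeros above it are set by hand.\<close>
  define p' where "p' = (\<lambda>i. if i < n then p i else if i = n then 1 else 0)"
  define P where "P = (\<Sum>i\<le>n. monom (p' i) i)"
  have cP: "coeff P i = p' i" for i
    by (auto simp: P_def coeff_sum p'_def)
  have "degree P = n"
  proof (rule antisym)
    show "degree P \<le> n" by (rule degree_le) (simp add: cP p'_def)
    show "n \<le> degree P" by (rule le_degree) (simp add: cP p'_def)
  qed
  moreover have "map_poly (\<lambda>c. poly c (jfun z)) P = jrep_poly N z" if "Im z > 0" for z
  proof (rule poly_eqI)
    fix i
    consider "i < n" | "i = n" | "i > n" by linarith
    then show "coeff (map_poly (\<lambda>c. poly c (jfun z)) P) i = coeff (jrep_poly N z) i"
    proof cases
      case 1
      then show ?thesis by (simp add: coeff_map_poly_eval cP p'_def p[OF that])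
    next
      case 2
      then show ?thesis using lead_coeff_jrep_poly[of N z] by (simp add: coeff_map_poly_eval cP p'_def n_def)
    next
      case 3
      then have "coeff (jrep_poly N z) i = 0"
        by (intro coeff_eq_0) (simp add: degree_jrep_poly n_def)
      then show ?thesis using 3 by (simp add: coeff_map_poly_eval cP p'_def)
    qed
  qed
  moreover have "lead_coeff P = 1" unfolding \<open>degree P = n\<close> cP by (simp add: p'_def)
  ultimately show ?thesis using that unfolding n_def by blast
qed

section \<open>Polynomials in j along the imaginary axis\<close>

lemma jfun_asymptotics:
  "((\<lambda>y. jfun (\<i> * of_real y) * of_real (exp (- 2 * pi * y))) \<longlongrightarrow> 1) at_top"
  using jrep_asymptotics[of 1 0 1 1] by (simp add: hecke_reps_def jrep_def rep_growth_def)

text \<open>Since j(iy) is asymptotic to X = exp(2 pi y), the term of top degree dominates: degree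
  and leading coefficient become visible in the values at j(iy).\<close>

lemma poly_jfun_asymptotics:
  "((\<lambda>y. poly p (jfun (\<i> * of_real y)) * of_real (exp (- 2 * pi * real (degree p) * y))) \<longlongrightarrow> lead_coeff p) at_top"
proof -
  define x where "x = (\<lambda>y::real. jfun (\<i> * of_real y))"
  define n where "n = degree p"
  have term_lim: "((\<lambda>y. x y ^ i * of_real (exp (- 2 * pi * real n * y))) \<longlongrightarrow> (if i = n then 1 else 0)) at_top"
    if "i \<le> n" for i
  proof -
    have "((\<lambda>y. (x y * of_real (exp (- 2 * pi * y))) ^ i) \<longlongrightarrow> 1 ^ i) at_top"
      unfolding x_def by (intro tendsto_power jfun_asymptotics)
    moreover have "(x y * of_real (exp (- 2 * pi * y))) ^ i = x y ^ i * of_real (exp (- 2 * pi * real i * y))" for y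
      unfolding power_mult_distrib of_real_power[symmetric] exp_of_nat_mult[symmetric]
      by (simp add: mult_ac)
    ultimately have *: "((\<lambda>y. x y ^ i * of_real (exp (- 2 * pi * real i * y))) \<longlongrightarrow> 1) at_top" by simp
    show ?thesis
    proof (cases "i = n")
      case False
      then show ?thesis using asymptotics_decay[OF *, of "real n"] that by simp
    qed (use * in simp)
  qed
  have "((\<lambda>y. \<Sum>i\<le>n. coeff p i * (x y ^ i * of_real (exp (- 2 * pi * real n * y)))) \<longlongrightarrow>
      (\<Sum>i\<le>n. coeff p i * (if i = n then 1 else 0))) at_top"
    by (intro tendsto_sum tendsto_mult tendsto_const term_lim) auto
  moreover have "(\<Sum>i\<le>n. coeff p i * (if i = n then 1 else 0)) = (\<Sum>i\<le>n. if i = n then coeff p i else 0)"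
    by (intro sum.cong) auto
  moreover have "\<dots> = coeff p n" by simp
  ultimately show ?thesis
    by (simp add: poly_altdef n_def[symmetric] x_def sum_distrib_right mult.assoc)
qed

lemma poly_eq_0_if_eventually_zero_at_jfun:
  assumes "\<forall>\<^sub>F y in at_top. poly p (jfun (\<i> * of_real y)) = 0"
  shows "p = 0"
proof -
  have "\<forall>\<^sub>F y in at_top. 0 = poly p (jfun (\<i> * of_real y)) * of_real (exp (- 2 * pi * real (degree p) * y))"
    using assms by eventually_elim simp
  then have "((\<lambda>y. poly p (jfun (\<i> * of_real y)) * of_real (exp (- 2 * pi * real (degree p) * y))) \<longlongrightarrow> 0) at_top"
    by (rule Lim_transform_eventually[OF tendsto_const])
  then have "lead_coeff p = 0"
    using poly_jfun_asymptotics[of p] tendsto_unique[OF trivial_limit_at_top_linorder] by blast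
  then show ?thesis by simp
qed

text \<open>The relation is evaluated at the image of z under a matrix carrying j(Nz) to
  \<open>jrep \<sigma>\<close>: j of that point is unchanged, while the other argument becomes the
  conjugate.\<close>

lemma annihilators_vanish_at_jrep:
  assumes "Q \<in> annihilators N" "N > 0" "\<sigma> \<in> hecke_reps N" "Im z > 0"
  shows "eval2 Q (jfun z) (jrep \<sigma> z) = 0"
proof (rule hecke_reps_transitive[OF assms(3,2)])
  fix \<alpha> \<beta> \<gamma> \<delta> :: int
  assume det: "\<alpha> * \<delta> - \<beta> * \<gamma> = 1"
    and eq: "\<And>z. Im z > 0 \<Longrightarrow>
      jfun (of_nat N * ((of_int \<alpha> * z + of_int \<beta>) / (of_int \<gamma> * z + of_int \<delta>))) = jrep \<sigma> z"
  define w where "w = (of_int \<alpha> * z + of_int \<beta>) / (of_int \<gamma> * z + of_int \<delta>)"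
  have "Im w > 0"
    unfolding w_def by (rule Im_moebius_pos[OF assms(4) det]) simp
  then have "eval2 Q (jfun w) (jfun (of_nat N * w)) = 0"
    using assms(1) by (simp add: annihilators_def)
  then show ?thesis
    unfolding w_def eq[OF assms(4)] jfun_modular[OF assms(4) det] .
qed

lemma degree_map_poly_eval_le: "degree (map_poly (\<lambda>c. poly c x) P) \<le> degree P"
  by (rule degree_le) (simp add: coeff_map_poly_eval coeff_eq_0)

lemma poly_eq_0_if_card_roots:
  fixes p :: "complex poly"
  assumes "finite S" "inj_on f S" "\<And>\<sigma>. \<sigma> \<in> S \<Longrightarrow> poly p (f \<sigma>) = 0" "degree p < card S"
  shows "p = 0"
proof (rule ccontr)
  assume "p \<noteq> 0"
  then have "finite {x. poly p x = 0}" "card {x. poly p x = 0} \<le> degree p"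
    by (simp_all add: poly_roots_finite card_poly_roots_bound)
  moreover have "f ` S \<subseteq> {x. poly p x = 0}" using assms(3) by auto
  ultimately have "card (f ` S) \<le> degree p" by (meson card_mono order_trans)
  then show False using assms(2,4) by (simp add: card_image)
qed

text \<open>No Galois theory over C(j) enters. At iy with y large the conjugates are distinct
  numbers, so a polynomial of degree below their number that vanishes at all of them is zero after
  specialisation; its coefficients vanish at j(iy) for all large y, hence identically. Minimality
  and uniqueness both follow.\<close>

lemma Phi_characterization:
  assumes N: "N > 0" and P: "degree P = card (hecke_reps N)" "lead_coeff P = 1"
    "\<And>z. Im z > 0 \<Longrightarrow> map_poly (\<lambda>c. poly c (jfun z)) P = jrep_poly N z"
  shows "Phi N = P"
proof -
  define S where "S = hecke_reps N"
  have fin: "finite S" unfolding S_def by (rule finite_hecke_reps[OF N])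
  have ev: "\<forall>\<^sub>F y in at_top. inj_on (\<lambda>\<sigma>. jrep \<sigma> (\<i> * of_real y)) S \<and> y > 0"
    unfolding S_def by (intro eventually_conj jrep_distinct_eventually N eventually_gt_at_top)
  have "(N, 0, 1) \<in> S" by (simp add: S_def hecke_reps_def)
  moreover have "jrep (N, 0, 1) z = jfun (of_nat N * z)" for z by (simp add: jrep_def)
  ultimately have "poly (jrep_poly N z) (jfun (of_nat N * z)) = 0" for z
    unfolding poly_jrep_poly using fin by (auto simp: S_def intro!: prod_zero bexI[of _ "(N, 0, 1)"])
  then have PA: "P \<in> annihilators N"
    unfolding annihilators_def eval2_def using P by simp
  have van: "\<forall>\<^sub>F y in at_top. D = 0 \<or> card S \<le> degree D \<or> (\<forall>i. poly (coeff D i) (jfun (\<i> * of_real y)) = 0)"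
    if D: "\<And>\<sigma> z. \<sigma> \<in> S \<Longrightarrow> Im z > 0 \<Longrightarrow> eval2 D (jfun z) (jrep \<sigma> z) = 0" for D
    using ev
  proof eventually_elim
    case (elim y)
    define z where "z = \<i> * of_real y"
    have z: "Im z > 0" using elim by (simp add: z_def)
    show ?case
    proof (cases "card S \<le> degree D")
      case False
      have "map_poly (\<lambda>c. poly c (jfun z)) D = 0"
      proof (rule poly_eq_0_if_card_roots[OF fin])
        show "inj_on (\<lambda>\<sigma>. jrep \<sigma> z) S" using elim by (simp add: z_def)
        show "poly (map_poly (\<lambda>c. poly c (jfun z)) D) (jrep \<sigma> z) = 0" if "\<sigma> \<in> S" for \<sigma>
          using D[OF that z] by (simp add: eval2_def)
        show "degree (map_poly (\<lambda>c. poly c (jfun z)) D) < card S"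
          using False degree_map_poly_eval_le[of "jfun z" D] by linarith
      qed
      then show ?thesis by (metis coeff_0 coeff_map_poly_eval z_def)
    qed simp
  qed
  have zero: "D = 0" if "\<And>\<sigma> z. \<sigma> \<in> S \<Longrightarrow> Im z > 0 \<Longrightarrow> eval2 D (jfun z) (jrep \<sigma> z) = 0" "degree D < card S" for D
  proof (rule poly_eqI)
    fix i
    have "\<forall>\<^sub>F y in at_top. D = 0 \<or> card S \<le> degree D \<or> (\<forall>i. poly (coeff D i) (jfun (\<i> * of_real y)) = 0)"
      by (rule van) (rule that(1))
    then have "\<forall>\<^sub>F y in at_top. poly (coeff D i) (jfun (\<i> * of_real y)) = 0"
      using that(2) by (auto elim!: eventually_mono)
    then show "coeff D i = coeff 0 i"
      using poly_eq_0_if_eventually_zero_at_jfun by simp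
  qed
  have vanQ: "eval2 Q (jfun z) (jrep \<sigma> z) = 0" if "Q \<in> annihilators N" "\<sigma> \<in> S" "Im z > 0" for Q \<sigma> z
    using annihilators_vanish_at_jrep[OF that(1) N] that(2,3) by (simp add: S_def)
  have min: "degree P \<le> degree Q" if Q: "Q \<in> annihilators N" for Q
  proof (rule ccontr)
    assume "\<not> ?thesis"
    then have "Q = 0" by (intro zero vanQ[OF Q]) (auto simp: P S_def)
    then show False using Q by (simp add: annihilators_def)
  qed
  have uniq: "Q = P" if Q: "Q \<in> annihilators N" "\<forall>R\<in>annihilators N. degree Q \<le> degree R" for Q
  proof -
    have deg: "degree Q = degree P" using min[OF Q(1)] Q(2) PA by (simp add: antisym)
    have lc: "lead_coeff Q = 1" using Q(1) by (simp add: annihilators_def)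
    have "card S > 0" using fin \<open>(N, 0, 1) \<in> S\<close> card_gt_0_iff by blast
    \<comment> \<open>Both polynomials are monic of the same degree, so the leading terms cancel in
      the difference.\<close>
    have "degree (Q - P) < card S"
    proof (cases "Q - P = 0")
      case False
      have "degree (Q - P) \<le> card S" using degree_diff_le[of Q "card S" P] deg P(1) by (simp add: S_def)
      moreover have "coeff (Q - P) (card S) = 0" using lc P deg by (simp add: S_def)
      ultimately show ?thesis using False by (metis leading_coeff_0_iff le_neq_implies_less)
    qed (use \<open>card S > 0\<close> in simp)
    moreover have "eval2 (Q - P) (jfun z) (jrep \<sigma> z) = 0" if "\<sigma> \<in> S" "Im z > 0" for \<sigma> z
    proof -
      have "map_poly (\<lambda>c. poly c (jfun z)) (Q - P) = map_poly (\<lambda>c. poly c (jfun z)) Q - map_poly (\<lambda>c. poly c (jfun z)) P"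
        by (rule poly_eqI) (simp add: coeff_map_poly_eval)
      then show ?thesis using vanQ[OF Q(1) that] vanQ[OF PA that] by (simp add: eval2_def)
    qed
    ultimately have "Q - P = 0" by (intro zero)
    then show ?thesis by simp
  qed
  show ?thesis
    unfolding Phi_def using PA min uniq by (intro the_equality) blast+
qed

section \<open>Degrees\<close>

text \<open>Growth is measured in powers of X = exp(2 pi y), the polynomial variable having weight
  1. A linear factor then has weight at most \<open>m \<sigma>\<close>, and the coefficient of the
  i-th power gets the total weight minus i.\<close>

lemma coeff_prod_linear_growth:
  fixes f :: "'a \<Rightarrow> real \<Rightarrow> complex"
  assumes "finite S" "C \<ge> 0" "\<And>\<sigma>. \<sigma> \<in> S \<Longrightarrow> m \<sigma> \<ge> 1"
    and "\<And>\<sigma>. \<sigma> \<in> S \<Longrightarrow> \<forall>\<^sub>F y in at_top. norm (f \<sigma> y) \<le> C * exp (2 * pi * m \<sigma> * y)"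
  shows "\<exists>B\<ge>0. \<forall>\<^sub>F y in at_top. norm (coeff (\<Prod>\<sigma>\<in>S. [:- f \<sigma> y, 1:]) i) \<le> B * exp (2 * pi * (sum m S - real i) * y)"
  using assms(1,3,4)
proof (induction S arbitrary: i rule: finite_induct)
  case empty
  show ?case by (intro exI[of _ 1]) (cases i, auto)
next
  case (insert \<sigma> S)
  define p where "p = (\<lambda>y. \<Prod>\<sigma>\<in>S. [:- f \<sigma> y, 1:])"
  define M where "M = sum m S"
  have IH: "\<exists>B\<ge>0. \<forall>\<^sub>F y in at_top. norm (coeff (p y) i) \<le> B * exp (2 * pi * (M - real i) * y)" for i
    using insert.IH insert.prems unfolding p_def M_def by simp
  define c where "c = (\<lambda>y. case i of 0 \<Rightarrow> 0 | Suc k \<Rightarrow> coeff (p y) k)"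
  have "\<exists>B\<ge>0. \<forall>\<^sub>F y in at_top. norm (c y) \<le> B * exp (2 * pi * (M + 1 - real i) * y)"
  proof (cases i)
    case 0
    then show ?thesis by (intro exI[of _ 0]) (simp add: c_def)
  next
    case (Suc k)
    then show ?thesis using IH[of k] by (simp add: c_def)
  qed
  then obtain B1 where B1: "B1 \<ge> 0" "\<forall>\<^sub>F y in at_top. norm (c y) \<le> B1 * exp (2 * pi * (M + 1 - real i) * y)" by blast
  obtain B2 where B2: "B2 \<ge> 0" "\<forall>\<^sub>F y in at_top. norm (coeff (p y) i) \<le> B2 * exp (2 * pi * (M - real i) * y)" using IH by blast
  have fb: "\<forall>\<^sub>F y in at_top. norm (f \<sigma> y) \<le> C * exp (2 * pi * m \<sigma> * y)" using insert.prems by simp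
  have m1: "m \<sigma> \<ge> 1" using insert.prems by simp
  have "\<forall>\<^sub>F y in at_top. norm (coeff (\<Prod>\<sigma>\<in>insert \<sigma> S. [:- f \<sigma> y, 1:]) i) \<le>
      (B1 + C * B2) * exp (2 * pi * (sum m (insert \<sigma> S) - real i) * y)"
    using B1(2) B2(2) fb eventually_ge_at_top[of 0]
  proof eventually_elim
    case (elim y)
    define E where "E = exp (2 * pi * (m \<sigma> + M - real i) * y)"
    have py: "(\<Prod>\<sigma>\<in>S. [:- f \<sigma> y, 1:]) = p y" by (simp add: p_def)
    have cy: "(case i of 0 \<Rightarrow> 0 | Suc k \<Rightarrow> coeff (p y) k) = c y" by (simp add: c_def)
    have "norm (coeff (\<Prod>\<sigma>\<in>insert \<sigma> S. [:- f \<sigma> y, 1:]) i) = norm (c y - f \<sigma> y * coeff (p y) i)"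
      unfolding prod.insert[OF insert(1,2)] coeff_linear_mult py cy ..
    also have "\<dots> \<le> norm (c y) + norm (f \<sigma> y) * norm (coeff (p y) i)"
      by (rule order_trans[OF norm_triangle_ineq4]) (simp add: norm_mult)
    also have "\<dots> \<le> B1 * exp (2 * pi * (M + 1 - real i) * y) +
        (C * exp (2 * pi * m \<sigma> * y)) * (B2 * exp (2 * pi * (M - real i) * y))"
      using elim assms(2) by (intro add_mono mult_mono) auto
    also have "(C * exp (2 * pi * m \<sigma> * y)) * (B2 * exp (2 * pi * (M - real i) * y)) = C * B2 * E"
      by (simp add: E_def exp_add[symmetric] algebra_simps)
    \<comment> \<open>Taking the variable from the new factor adds 1 to the exponent, which is
      absorbed by \<open>m \<sigma> \<ge> 1\<close>.\<close>
    also have "B1 * exp (2 * pi * (M + 1 - real i) * y) \<le> B1 * E"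
      unfolding E_def using m1 elim B1 by (intro mult_left_mono) (auto intro!: mult_right_mono mult_left_mono)
    finally show ?case using insert(1,2) by (simp add: E_def M_def algebra_simps)
  qed
  moreover have "B1 + C * B2 \<ge> 0" using B1 B2 assms(2) by simp
  ultimately show ?case by blast
qed

lemma jrep_eventually_le:
  assumes "\<sigma> \<in> hecke_reps N" "N > 0"
  shows "\<forall>\<^sub>F y in at_top. norm (jrep \<sigma> (\<i> * of_real y)) \<le> 2 * exp (2 * pi * max 1 (rep_growth \<sigma>) * y)"
proof -
  obtain a b d where s: "\<sigma> = (a, b, d)" by (cases \<sigma>) auto
  have "((\<lambda>y. norm (jrep \<sigma> (\<i> * of_real y) * of_real (exp (- 2 * pi * rep_growth \<sigma> * y)))) \<longlongrightarrow>
      norm (cis (- 2 * pi * (real b / real d)))) at_top"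
    unfolding s by (intro tendsto_norm jrep_asymptotics[OF assms(1)[unfolded s] assms(2)])
  \<comment> \<open>The limit has modulus 1, so 2 is an eventual upper bound.\<close>
  then have "\<forall>\<^sub>F y in at_top. norm (jrep \<sigma> (\<i> * of_real y) * of_real (exp (- 2 * pi * rep_growth \<sigma> * y))) < 2"
    by (rule order_tendstoD) simp
  then show ?thesis using eventually_ge_at_top[of 0]
  proof eventually_elim
    case (elim y)
    have "norm (jrep \<sigma> (\<i> * of_real y)) * exp (- (2 * pi * rep_growth \<sigma> * y)) < 2"
      using elim(1) by (simp add: norm_mult)
    then have "norm (jrep \<sigma> (\<i> * of_real y)) \<le> 2 * exp (2 * pi * rep_growth \<sigma> * y)"
      by (simp add: exp_minus field_simps)
    also have "\<dots> \<le> 2 * exp (2 * pi * max 1 (rep_growth \<sigma>) * y)"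
      using elim(2) by (auto intro!: mult_right_mono)
    finally show ?case .
  qed
qed

lemma degree_le_if_growth:
  assumes "\<forall>\<^sub>F y in at_top. norm (poly p (jfun (\<i> * of_real y))) \<le> B * exp (2 * pi * s * y)" "p \<noteq> 0"
  shows "real (degree p) \<le> s"
proof (rule ccontr)
  assume "\<not> ?thesis"
  then have lt: "s < real (degree p)" by simp
  define h where "h = (\<lambda>y. poly p (jfun (\<i> * of_real y)))"
  have "B * exp (2 * pi * s * y) * exp (- 2 * pi * s * y) = B" for y
    by (simp add: exp_minus)
  then have "((\<lambda>y. (of_real (B * exp (2 * pi * s * y)) :: complex) * of_real (exp (- 2 * pi * s * y))) \<longlongrightarrow> of_real B) at_top"
    by (simp only: of_real_mult[symmetric] tendsto_const)
  from asymptotics_decay[OF this lt]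
  have 0: "((\<lambda>y. (of_real (B * exp (2 * pi * s * y)) :: complex) * of_real (exp (- 2 * pi * real (degree p) * y))) \<longlongrightarrow> 0) at_top" .
  have "((\<lambda>y. h y * of_real (exp (- 2 * pi * real (degree p) * y))) \<longlongrightarrow> 0) at_top"
  proof (rule Lim_null_comparison[OF _ tendsto_norm_zero[OF 0]])
    show "\<forall>\<^sub>F y in at_top. norm (h y * of_real (exp (- 2 * pi * real (degree p) * y))) \<le>
      norm ((of_real (B * exp (2 * pi * s * y)) :: complex) * of_real (exp (- 2 * pi * real (degree p) * y)))"
      using assms(1)
    proof eventually_elim
      case (elim y)
      then have "norm (h y) \<le> \<bar>B * exp (2 * pi * s * y)\<bar>" unfolding h_def by linarith
      then show ?case unfolding norm_mult norm_of_real by (intro mult_right_mono) auto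
    qed
  qed
  then have "lead_coeff p = 0"
    using poly_jfun_asymptotics[of p] tendsto_unique[OF trivial_limit_at_top_linorder] unfolding h_def by blast
  then show False using assms(2) by simp
qed

text \<open>If s exceeded the degree, the limit l would be 0; if s were smaller, the leading
  coefficient would be 0.\<close>

lemma degree_eq_if_asymptotics:
  assumes "((\<lambda>y. poly p (jfun (\<i> * of_real y)) * of_real (exp (- 2 * pi * s * y))) \<longlongrightarrow> l) at_top" "l \<noteq> 0"
  shows "real (degree p) = s"
proof -
  note lim = poly_jfun_asymptotics[of p]
  note unique = tendsto_unique[OF trivial_limit_at_top_linorder]
  have "p \<noteq> 0"
  proof
    assume "p = 0"
    then have "((\<lambda>y. 0 :: complex) \<longlongrightarrow> l) (at_top :: real filter)" using assms(1) by simp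
    then show False using assms(2) unique[OF tendsto_const] by blast
  qed
  then have lc: "lead_coeff p \<noteq> 0" by simp
  have "\<not> real (degree p) < s"
    using asymptotics_decay[OF lim, of s] unique[OF assms(1)] assms(2) by blast
  moreover have "\<not> s < real (degree p)"
    using asymptotics_decay[OF assms(1), of "real (degree p)"] unique[OF lim] lc by blast
  ultimately show ?thesis by linarith
qed

lemma poly_diag: "poly (diag P) x = eval2 P x x"
proof -
  have "poly (diag P) x = (\<Sum>i\<le>degree P. poly (coeff P i) x * x ^ i)"
    by (simp add: diag_def poly_sum poly_power)
  also have "\<dots> = eval2 P x x"
    unfolding eval2_def
    unfolding poly_altdef[of "map_poly (\<lambda>c. poly c x) P"] coeff_map_poly_eval
  \<comment> \<open>Evaluating the coefficients at x may lower the degree; the surplus terms are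
    zero.\<close>
  proof (rule sum.mono_neutral_right)
    show "{..degree (map_poly (\<lambda>c. poly c x) P)} \<subseteq> {..degree P}"
      using degree_map_poly_eval_le by auto
    show "\<forall>i\<in>{..degree P} - {..degree (map_poly (\<lambda>c. poly c x) P)}. poly (coeff P i) x * x ^ i = 0"
      by (auto simp: coeff_eq_0 simp flip: coeff_map_poly_eval)
  qed simp
  finally show ?thesis .
qed

lemma degree_diag_le_total_degree:
  assumes "P \<noteq> 0"
  shows "degree (diag P) \<le> total_degree P"
  unfolding diag_def
proof (rule degree_sum_le)
  fix i assume i: "i \<in> {..degree P}"
  show "degree (coeff P i * [:0, 1:] ^ i) \<le> total_degree P"
  proof (cases "coeff P i = 0")
    case False
    have "degree (coeff P i * [:0, 1:] ^ i) \<le> degree (coeff P i) + degree ([:0, 1:] ^ i :: complex poly)"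
      by (rule degree_mult_le)
    also have "\<dots> = degree (coeff P i) + i" by (simp add: degree_power_eq)
    also have "\<dots> \<le> total_degree P"
      unfolding total_degree_def using i False by (intro Max_ge) auto
    finally show ?thesis .
  qed simp
qed simp

theorem theorem1:
  fixes N :: nat
  assumes "N \<ge> 2"
  shows "total_degree (Phi N) = deg_formula N \<and> degree (diag (Phi N)) = deg_formula N"
proof -
  have N: "N > 0" using assms by simp
  define S where "S = hecke_reps N"
  define m where "m = (\<lambda>\<sigma>. max 1 (rep_growth \<sigma>))"
  have fin: "finite S" unfolding S_def by (rule finite_hecke_reps[OF N])
  obtain P where P: "degree P = card (hecke_reps N)" "lead_coeff P = 1"
    "\<And>z. Im z > 0 \<Longrightarrow> map_poly (\<lambda>c. poly c (jfun z)) P = jrep_poly N z"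
    using modular_polynomial_exists[OF N] by blast
  have Phi: "Phi N = P" by (rule Phi_characterization[OF N P])
  have sum_m: "sum m S = real (deg_formula N)"
    unfolding m_def S_def by (rule sum_rep_growth[OF N])
  \<comment> \<open>At j the polynomial is the product over the conjugates, so its i-th coefficient
    grows at most like X to the power \<open>sum m S - i\<close>.\<close>
  have coeff_bound: "degree (coeff P i) + i \<le> deg_formula N" if "coeff P i \<noteq> 0" for i
  proof -
    obtain B where B: "\<forall>\<^sub>F y in at_top. norm (coeff (\<Prod>\<sigma>\<in>S. [:- jrep \<sigma> (\<i> * of_real y), 1:]) i) \<le>
        B * exp (2 * pi * (sum m S - real i) * y)"
      using coeff_prod_linear_growth[of S 2 m "\<lambda>\<sigma> y. jrep \<sigma> (\<i> * of_real y)" i] fin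
        jrep_eventually_le[OF _ N] unfolding m_def S_def by auto
    have "\<forall>\<^sub>F y in at_top. norm (poly (coeff P i) (jfun (\<i> * of_real y))) \<le> B * exp (2 * pi * (sum m S - real i) * y)"
      using B eventually_gt_at_top[of 0]
    proof eventually_elim
      case (elim y)
      have "poly (coeff P i) (jfun (\<i> * of_real y)) = coeff (jrep_poly N (\<i> * of_real y)) i"
        using P(3)[of "\<i> * of_real y"] elim(2) by (simp flip: coeff_map_poly_eval)
      then show ?case using elim(1) by (simp add: jrep_poly_def S_def)
    qed
    then have "real (degree (coeff P i)) \<le> sum m S - real i"
      using that by (rule degree_le_if_growth)
    then show ?thesis unfolding sum_m by linarith
  qed
  have "P \<noteq> 0" using P(2) by auto
  have total_le: "total_degree P \<le> deg_formula N"
    unfolding total_degree_def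
  proof (rule Max.boundedI)
    show "finite {degree (coeff P i) + i |i. i \<le> degree P \<and> coeff P i \<noteq> 0}" by simp
    show "{degree (coeff P i) + i |i. i \<le> degree P \<and> coeff P i \<noteq> 0} \<noteq> {}"
      using \<open>P \<noteq> 0\<close> by (auto intro!: exI[of _ "degree P"])
  qed (use coeff_bound in auto)
  have "\<exists>l. l \<noteq> 0 \<and> ((\<lambda>y. (jfun (\<i> * of_real y) - jrep \<sigma> (\<i> * of_real y)) *
      of_real (exp (- 2 * pi * m \<sigma> * y))) \<longlongrightarrow> l) at_top" if \<sigma>: "\<sigma> \<in> S" for \<sigma>
  proof -
    obtain a b d where s: "\<sigma> = (a, b, d)" by (cases \<sigma>) auto
    have s': "(a, b, d) \<in> hecke_reps N" using \<sigma> by (simp add: S_def s)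
    note pos = hecke_repsD[OF s' N]
    have id: "(1, 0, 1) \<in> hecke_reps 1" by (simp add: hecke_reps_def)
    have "rep_growth (1, 0, 1) \<noteq> rep_growth \<sigma> \<or>
      cis (- 2 * pi * (real (fst (snd (1, 0, 1 :: nat))) / real (snd (snd (1, 0 :: nat, 1))))) \<noteq>
      cis (- 2 * pi * (real (fst (snd \<sigma>)) / real (snd (snd \<sigma>))))"
    proof (rule ccontr)
      assume "\<not> ?thesis"
      then have 1: "real a / real d = 1" and 2: "cis (- 2 * pi * (real 0 / real d)) = cis (- 2 * pi * (real b / real d))"
        by (auto simp: rep_growth_def s)
      have ad: "a = d" using 1 pos by simp
      \<comment> \<open>Equal phases with a = d force b = 0; primitivity then gives a = d = 1, that
        is N = 1, against the assumption.\<close>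
      have "b = 0" using cis_root_eq_iff[OF _ _ 2] pos by simp
      then have "d = 1" using s' ad by (simp add: hecke_reps_def)
      then show False using ad pos assms by simp
    qed
    from jrep_difference_asymptotics[OF id s'[folded s] zero_less_one N this]
    obtain l where "l \<noteq> 0" "((\<lambda>y. (jrep (1, 0, 1) (\<i> * of_real y) - jrep \<sigma> (\<i> * of_real y)) *
      of_real (exp (- 2 * pi * max (rep_growth (1, 0, 1)) (rep_growth \<sigma>) * y))) \<longlongrightarrow> l) at_top"
      by blast
    moreover have "jrep (1, 0, 1) = jfun" "rep_growth (1, 0, 1) = 1"
      by (simp_all add: jrep_def[abs_def] rep_growth_def)
    ultimately show ?thesis by (auto simp: m_def)
  qed
  then obtain l where l: "\<And>\<sigma>. \<sigma> \<in> S \<Longrightarrow> l \<sigma> \<noteq> 0"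
    "\<And>\<sigma>. \<sigma> \<in> S \<Longrightarrow> ((\<lambda>y. (jfun (\<i> * of_real y) - jrep \<sigma> (\<i> * of_real y)) *
      of_real (exp (- 2 * pi * m \<sigma> * y))) \<longlongrightarrow> l \<sigma>) at_top"
    by metis
  \<comment> \<open>Every difference j - \<open>jrep \<sigma>\<close> has the exact growth exponent
    \<open>m \<sigma>\<close>; since no limit is zero, the exponents add up without loss.\<close>
  have "((\<lambda>y. \<Prod>\<sigma>\<in>S. (jfun (\<i> * of_real y) - jrep \<sigma> (\<i> * of_real y)) *
      of_real (exp (- 2 * pi * m \<sigma> * y))) \<longlongrightarrow> (\<Prod>\<sigma>\<in>S. l \<sigma>)) at_top"
    by (intro tendsto_prod l(2))
  moreover have "\<forall>\<^sub>F y in at_top. (\<Prod>\<sigma>\<in>S. (jfun (\<i> * of_real y) - jrep \<sigma> (\<i> * of_real y)) *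
      of_real (exp (- 2 * pi * m \<sigma> * y))) = poly (diag P) (jfun (\<i> * of_real y)) * of_real (exp (- 2 * pi * sum m S * y))"
    using eventually_gt_at_top[of 0]
  proof eventually_elim
    case (elim y)
    have "poly (diag P) (jfun (\<i> * of_real y)) = (\<Prod>\<sigma>\<in>S. jfun (\<i> * of_real y) - jrep \<sigma> (\<i> * of_real y))"
      using P(3)[of "\<i> * of_real y"] elim by (simp add: poly_diag eval2_def poly_jrep_poly S_def)
    moreover have "exp (- 2 * pi * sum m S * y) = (\<Prod>\<sigma>\<in>S. exp (- 2 * pi * m \<sigma> * y))"
      by (subst exp_sum[OF fin, symmetric]) (simp add: sum_distrib_left sum_distrib_right sum_negf)
    ultimately show ?case by (simp add: prod.distrib)
  qed
  ultimately have "((\<lambda>y. poly (diag P) (jfun (\<i> * of_real y)) * of_real (exp (- 2 * pi * sum m S * y))) \<longlongrightarrow> (\<Prod>\<sigma>\<in>S. l \<sigma>)) at_top"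
    by (rule Lim_transform_eventually)
  moreover have "(\<Prod>\<sigma>\<in>S. l \<sigma>) \<noteq> 0" using l(1) fin by simp
  ultimately have "real (degree (diag P)) = sum m S" by (rule degree_eq_if_asymptotics)
  then have diag: "degree (diag P) = deg_formula N" unfolding sum_m by simp
  then have "total_degree P = deg_formula N"
    using degree_diag_le_total_degree[OF \<open>P \<noteq> 0\<close>] total_le by simp
  then show ?thesis using diag Phi by simp
qed

end
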